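(* For every integer $n\ge 13$, every $(K_3,K_{1,3})$-co-critical graph on $n$ vertices has at least $3n-4$ edges. This bound is sharp for all $n\ge 13$; that is, for every integer $n\ge 13$ there exists a $(K_3,K_{1,3})$-co-critical graph on $n$ vertices with exactly $3n-4$ edges.
   Context: All graphs are finite and simple (no loops or multiple edges). $\overline{G}$ denotes the complement of $G$, $K_3$ the triangle, and $K_{1,3}$ the star with $3$ edges. For an edge $e$ of $\overline{G}$, $G+e$ is the graph obtained from $G$ by adding the edge $e$. For graphs $G,H_1,H_2$, write $G\rightarrow(H_1,H_2)$ if every coloring of the edges of $G$ with the colors red and blue contains a red copy of $H_1$ or a blue copy of $H_2$ (copies as not necessarily induced subgraphs). A non-complete graph $G$ is $(H_1,H_2)$-co-critical if $G\nrightarrow(H_1,H_2)$, but $G+e\rightarrow(H_1,H_2)$ for every edge $e$ of $\overline{G}$. *)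

theory Defs
  imports Main "HOL-Library.Ramsey"
begin

text \<open>A finite simple graph is a finite vertex set together with a set of two-element subsets
  of it; \<^term>\<open>nsets V 2\<close> is the library's set of all two-element subsets of \<^term>\<open>V\<close>.\<close>

record 'a graph =
  verts :: "'a set"
  edges :: "'a set set"

definition simple_graph :: "'a graph \<Rightarrow> bool" where
  "simple_graph G \<longleftrightarrow> finite (verts G) \<and> edges G \<subseteq> nsets (verts G) 2"

definition complement :: "'a graph \<Rightarrow> 'a graph" where
  "complement G = \<lparr>verts = verts G, edges = nsets (verts G) 2 - edges G\<rparr>"

definition add_edge :: "'a graph \<Rightarrow> 'a set \<Rightarrow> 'a graph" where
  "add_edge G e = \<lparr>verts = verts G, edges = insert e (edges G)\<rparr>"

definition is_complete :: "'a graph \<Rightarrow> bool" where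
  "is_complete G \<longleftrightarrow> edges G = nsets (verts G) 2"

definition complete_graph :: "nat \<Rightarrow> nat graph" where
  "complete_graph t = \<lparr>verts = {..<t}, edges = nsets {..<t} 2\<rparr>"

text \<open>The star with \<^term>\<open>k\<close> edges: centre \<^term>\<open>0::nat\<close>, leaves \<open>1, \<dots>, k\<close>.\<close>

definition star :: "nat \<Rightarrow> nat graph" where
  "star k = \<lparr>verts = {0..k}, edges = {{0, i} | i. i \<in> {1..k}}\<rparr>"

text \<open>Copies are not necessarily induced.\<close>

definition contains_copy :: "'a graph \<Rightarrow> 'b graph \<Rightarrow> bool" where
  "contains_copy G H \<longleftrightarrow>
     (\<exists>f. inj_on f (verts H) \<and> f ` verts H \<subseteq> verts G \<and> (\<forall>e\<in>edges H. f ` e \<in> edges G))"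

datatype colour = Red | Blue

definition colour_class :: "'a graph \<Rightarrow> ('a set \<Rightarrow> colour) \<Rightarrow> colour \<Rightarrow> 'a graph" where
  "colour_class G c k = \<lparr>verts = verts G, edges = {e \<in> edges G. c e = k}\<rparr>"

text \<open>A colouring is a total function, but only its values on \<^term>\<open>edges G\<close> matter.\<close>

definition arrows :: "'a graph \<Rightarrow> 'b graph \<Rightarrow> 'c graph \<Rightarrow> bool" where
  "arrows G H1 H2 \<longleftrightarrow>
     (\<forall>c :: 'a set \<Rightarrow> colour.
        contains_copy (colour_class G c Red) H1 \<or> contains_copy (colour_class G c Blue) H2)"

definition co_critical :: "'a graph \<Rightarrow> 'b graph \<Rightarrow> 'c graph \<Rightarrow> bool" where
  "co_critical G H1 H2 \<longleftrightarrow>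
     \<not> is_complete G \<and> \<not> arrows G H1 H2 \<and>
     (\<forall>e\<in>edges (complement G). arrows (add_edge G e) H1 H2)"

end

theory Submission
  imports Defs
begin

text \<open>
A colouring of the edges of a graph is recorded by its red adjacency relation \<open>r\<close>; the other edges are
blue. It is critical if red is triangle-free and every vertex has at most two blue edges. Adding a
missing edge \<open>uv\<close> in red fails exactly if \<open>u\<close> and \<open>v\<close> have a common red neighbour, and adding it in blue
fails exactly if one of them already has two blue edges. Hence (\<open>co_critical_iff\<close>) a graph is co-critical
iff it is not complete, has a critical colouring, and in every critical colouring any two non-adjacent
vertices have a common red neighbour and do not both have blue degree at most one.

Lower bound. The vertices of blue degree at most one form a clique. As red is triangle-free, this clique
is so small that the blue degrees add up to at least \<open>2n - 4\<close> (\<open>deficit\<close>). It therefore suffices to find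
red degree sum at least \<open>4n - 4\<close>. Take a critical colouring with as many red edges as possible. Then
recolouring a blue edge red must create a red triangle, so the red graph is a maximal triangle-free graph
(\<open>max_red_saturated\<close>). The proof splits according to its minimum degree. If it is at least four, the sum is
at least \<open>4n\<close>.
Degree three gives \<open>4n - 4\<close> for \<open>n \<ge> 13\<close> (\<open>cubic_vertex.degree_sum\<close>), a statement about maximal
triangle-free graphs only. Degree one makes the red graph a star, and degree two makes it a blow-up of the five-cycle
\<open>x - P - Q - y - M - x\<close> with \<open>x\<close> and \<open>y\<close> not blown up, with \<open>2n - 5 + (|P| - 1)(|Q| - 1)\<close> edges. In the last
two cases there may be too few red edges, and these colourings have to be refuted by recolouring.

All recolourings have one shape (\<open>fold_complete\<close>). Place the vertices on a five-cycle and colour red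
exactly the edges between consecutive positions. Red is then triangle-free. If moreover every vertex has
at most two edges outside the red ones, the colouring is critical. Two vertices in consecutive positions
have no common red neighbour, so in a co-critical graph they must be adjacent. A contradiction arises
from a placement with two non-adjacent vertices in consecutive positions, usually one vertex of the large
class \<open>M\<close>; the placements use only two positions or modify the blow-up slightly.

Sharpness. Let a five-cycle be blown up to classes of sizes \<open>1, 2, 3, 1, n - 7\<close> and coloured red, and add
blue edges as follows: eight edges on the first classes and two vertices of the last, and a cycle on the
remaining \<open>n - 9\<close> vertices. The eight edges are chosen such that the colour of every edge is forced
(\<open>unique_colouring\<close>), so that co-criticality has to be checked for a single colouring.
\<close>

section \<open>Critical colourings\<close>

definition adj :: "'a graph \<Rightarrow> 'a \<Rightarrow> 'a \<Rightarrow> bool" where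
  "adj G u v \<longleftrightarrow> {u, v} \<in> edges G"

definition critical :: "('a \<Rightarrow> 'a \<Rightarrow> bool) \<Rightarrow> ('a \<Rightarrow> 'a \<Rightarrow> bool) \<Rightarrow> bool" where
  "critical g r \<longleftrightarrow>
     (\<forall>u v. r u v \<longrightarrow> r v u \<and> g u v) \<and>
     (\<forall>u v w. r u v \<longrightarrow> r v w \<longrightarrow> \<not> r u w) \<and>
     (\<forall>v. \<exists>a b. \<forall>w. g v w \<and> \<not> r v w \<longrightarrow> w = a \<or> w = b)"

definition blue_le_1 :: "('a \<Rightarrow> 'a \<Rightarrow> bool) \<Rightarrow> ('a \<Rightarrow> 'a \<Rightarrow> bool) \<Rightarrow> 'a \<Rightarrow> bool" where
  "blue_le_1 g r v \<longleftrightarrow> (\<exists>a. \<forall>w. g v w \<and> \<not> r v w \<longrightarrow> w = a)"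

lemma criticalI:
  assumes "\<And>u v. r u v \<Longrightarrow> r v u" "\<And>u v. r u v \<Longrightarrow> g u v"
    "\<And>u v w. r u v \<Longrightarrow> r v w \<Longrightarrow> r u w \<Longrightarrow> False"
    "\<And>v. \<exists>a b. \<forall>w. g v w \<and> \<not> r v w \<longrightarrow> w = a \<or> w = b"
  shows "critical g r"
  unfolding critical_def using assms by blast

lemma criticalD:
  assumes "critical g r"
  shows "r u v \<Longrightarrow> r v u" "r u v \<Longrightarrow> g u v" "r u v \<Longrightarrow> r v w \<Longrightarrow> r u w \<Longrightarrow> False"
    "\<exists>a b. \<forall>w. g v w \<and> \<not> r v w \<longrightarrow> w = a \<or> w = b"
  using assms unfolding critical_def by blast+

lemma adj_sym: "adj G u v \<longleftrightarrow> adj G v u"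
  by (simp add: adj_def insert_commute)

lemma adj_verts: "simple_graph G \<Longrightarrow> adj G u v \<Longrightarrow> u \<in> verts G \<and> v \<in> verts G \<and> u \<noteq> v"
proof -
  assume G: "simple_graph G" and "adj G u v"
  then have "{u, v} \<subseteq> verts G" "card {u, v} = 2"
    unfolding simple_graph_def adj_def nsets_def by blast+
  then show ?thesis by (cases "u = v") auto
qed

lemma edge_adj: "simple_graph G \<Longrightarrow> e \<in> edges G \<Longrightarrow> \<exists>u v. e = {u, v} \<and> adj G u v"
proof -
  assume G: "simple_graph G" and e: "e \<in> edges G"
  then have "card e = 2" unfolding simple_graph_def nsets_def by blast
  then show ?thesis using e unfolding card_2_iff adj_def by blast
qed

text \<open>Degree bounds are expressed by naming the possible exceptions, so that recolouring arguments need no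
  cardinalities.\<close>

lemma not_three_iff:
  "(\<not> (\<exists>a b c. P a \<and> P b \<and> P c \<and> a \<noteq> b \<and> a \<noteq> c \<and> b \<noteq> c)) \<longleftrightarrow> (\<exists>a b. \<forall>w. P w \<longrightarrow> w = a \<or> w = b)"
proof (cases "\<exists>a b. P a \<and> P b \<and> a \<noteq> b")
  case True
  then obtain a b where ab: "P a" "P b" "a \<noteq> b" by blast
  show ?thesis
  proof
    assume "\<not> (\<exists>a b c. P a \<and> P b \<and> P c \<and> a \<noteq> b \<and> a \<noteq> c \<and> b \<noteq> c)"
    then have "\<forall>w. P w \<longrightarrow> w = a \<or> w = b" using ab by blast
    then show "\<exists>a b. \<forall>w. P w \<longrightarrow> w = a \<or> w = b" by blast
  qed blast
next
  case False
  then have "\<exists>a. \<forall>w. P w \<longrightarrow> w = a" by blast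
  then show ?thesis using False by blast
qed

lemma contains_triangle_iff:
  "contains_copy H (complete_graph 3) \<longleftrightarrow>
     (\<exists>u v w. u \<in> verts H \<and> v \<in> verts H \<and> w \<in> verts H \<and> u \<noteq> v \<and> u \<noteq> w \<and> v \<noteq> w \<and>
        {u, v} \<in> edges H \<and> {u, w} \<in> edges H \<and> {v, w} \<in> edges H)"
  (is "?L \<longleftrightarrow> ?R")
proof -
  have lt3: "{..<3::nat} = {0, 1, 2}" by auto
  have ns: "nsets {0, 1, 2::nat} 2 = {{0, 1}, {0, 2}, {1, 2}}"
  proof -
    have "e \<in> {{0, 1}, {0, 2}, {1, 2}}" if "e \<subseteq> {0, 1, 2}" "card e = 2" for e :: "nat set"
      using that unfolding card_2_iff by auto
    moreover have "card e = 2" if "e \<in> {{0, 1}, {0, 2}, {1, 2::nat}}" for e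
      using that by (auto simp: card_insert_if)
    ultimately show ?thesis unfolding nsets_def by auto
  qed
  show ?thesis
  proof
    assume ?L
    then obtain f :: "nat \<Rightarrow> 'a" where f: "inj_on f {0, 1, 2}" "f ` {0, 1, 2} \<subseteq> verts H"
      "\<forall>e \<in> {{0, 1}, {0, 2}, {1, 2}}. f ` e \<in> edges H"
      unfolding contains_copy_def complete_graph_def graph.simps lt3 ns by (elim exE conjE) (rule that)
    show ?R
      by (rule exI[of _ "f 0"], rule exI[of _ "f 1"], rule exI[of _ "f 2"])
        (use f in \<open>auto simp: inj_on_def\<close>)
  next
    assume ?R
    then obtain u v w where *: "u \<in> verts H" "v \<in> verts H" "w \<in> verts H" "u \<noteq> v" "u \<noteq> w" "v \<noteq> w"
        "{u, v} \<in> edges H" "{u, w} \<in> edges H" "{v, w} \<in> edges H" by blast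
    show ?L
      unfolding contains_copy_def complete_graph_def graph.simps lt3 ns
      by (rule exI[of _ "\<lambda>i::nat. if i = 0 then u else if i = 1 then v else w"])
        (use * in \<open>auto simp: inj_on_def insert_commute\<close>)
  qed
qed

lemma contains_claw_iff:
  "contains_copy H (star 3) \<longleftrightarrow>
     (\<exists>v a b c. v \<in> verts H \<and> a \<in> verts H \<and> b \<in> verts H \<and> c \<in> verts H \<and> v \<noteq> a \<and> v \<noteq> b \<and> v \<noteq> c \<and>
        a \<noteq> b \<and> a \<noteq> c \<and> b \<noteq> c \<and> {v, a} \<in> edges H \<and> {v, b} \<in> edges H \<and> {v, c} \<in> edges H)"
  (is "?L \<longleftrightarrow> ?R")
proof -
  have lt3: "{0..3::nat} = {0, 1, 2, 3}" "{1..3::nat} = {1, 2, 3}" by auto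
  have ns: "{{0, i} | i. i \<in> {1, 2, 3::nat}} = {{0, 1}, {0, 2}, {0, 3}}"
    by auto
  show ?thesis
  proof
    assume ?L
    then obtain f :: "nat \<Rightarrow> 'a" where f: "inj_on f {0, 1, 2, 3}" "f ` {0, 1, 2, 3} \<subseteq> verts H"
      "\<forall>e \<in> {{0, 1}, {0, 2}, {0, 3}}. f ` e \<in> edges H"
      unfolding contains_copy_def star_def graph.simps lt3 ns by (elim exE conjE) (rule that)
    show ?R
      by (rule exI[of _ "f 0"], rule exI[of _ "f 1"], rule exI[of _ "f 2"], rule exI[of _ "f 3"])
        (use f in \<open>auto simp: inj_on_def\<close>)
  next
    assume ?R
    then obtain v a b c where *: "v \<in> verts H" "a \<in> verts H" "b \<in> verts H" "c \<in> verts H"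
        "v \<noteq> a" "v \<noteq> b" "v \<noteq> c" "a \<noteq> b" "a \<noteq> c" "b \<noteq> c"
        "{v, a} \<in> edges H" "{v, b} \<in> edges H" "{v, c} \<in> edges H" by blast
    show ?L
      unfolding contains_copy_def star_def graph.simps lt3 ns
      by (rule exI[of _ "\<lambda>i::nat. if i = 0 then v else if i = 1 then a else if i = 2 then b else c"])
        (use * in \<open>auto simp: inj_on_def insert_commute\<close>)
  qed
qed

lemma arrows_iff:
  assumes "simple_graph G"
  shows "arrows G (complete_graph 3) (star 3) \<longleftrightarrow> \<not> (\<exists>r. critical (adj G) r)"
proof -
  note V = adj_verts[OF assms]
  have tri: "contains_copy (colour_class G c Red) (complete_graph 3) \<longleftrightarrow>
      (\<exists>u v w. (adj G u v \<and> c {u, v} = Red) \<and> (adj G v w \<and> c {v, w} = Red) \<and> (adj G u w \<and> c {u, w} = Red))" for c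
    unfolding contains_triangle_iff colour_class_def
    using V by (simp add: adj_def[symmetric]) blast
  have claw: "contains_copy (colour_class G c Blue) (star 3) \<longleftrightarrow>
      (\<exists>v. \<not> (\<exists>a b. \<forall>w. adj G v w \<and> c {v, w} = Blue \<longrightarrow> w = a \<or> w = b))" for c
  proof -
    have "contains_copy (colour_class G c Blue) (star 3) \<longleftrightarrow>
      (\<exists>v a b d. (adj G v a \<and> c {v, a} = Blue) \<and> (adj G v b \<and> c {v, b} = Blue) \<and>
         (adj G v d \<and> c {v, d} = Blue) \<and> a \<noteq> b \<and> a \<noteq> d \<and> b \<noteq> d)"
      (is "?L \<longleftrightarrow> ?R")
    proof
      assume ?L then show ?R
        unfolding contains_claw_iff colour_class_def by (simp add: adj_def[symmetric]) blast
    next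
      assume ?R
      then obtain v a b d where *: "adj G v a \<and> c {v, a} = Blue" "adj G v b \<and> c {v, b} = Blue"
        "adj G v d \<and> c {v, d} = Blue" "a \<noteq> b" "a \<noteq> d" "b \<noteq> d" by blast
      then show ?L unfolding contains_claw_iff colour_class_def
        using V[of v a] V[of v b] V[of v d]
        by (intro exI[of _ v] exI[of _ a] exI[of _ b] exI[of _ d]) (simp add: adj_def[symmetric])
    qed
    then show ?thesis unfolding not_three_iff[symmetric] by (simp only: not_not conj_assoc)
  qed
  have nb: "c = Blue \<longleftrightarrow> c \<noteq> Red" for c by (cases c) auto
  have "\<exists>r. critical (adj G) r" if na: "\<not> arrows G (complete_graph 3) (star 3)"
  proof -
    obtain c where c1: "\<not> contains_copy (colour_class G c Red) (complete_graph 3)"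
      and c2: "\<not> contains_copy (colour_class G c Blue) (star 3)"
      using na unfolding arrows_def by blast
    have "critical (adj G) (\<lambda>u v. adj G u v \<and> c {u, v} = Red)"
      unfolding critical_def
    proof (intro conjI)
      show "\<forall>u v w. adj G u v \<and> c {u, v} = Red \<longrightarrow>
          adj G v w \<and> c {v, w} = Red \<longrightarrow> \<not> (adj G u w \<and> c {u, w} = Red)"
        using c1 unfolding tri by blast
      show "\<forall>v. \<exists>a b. \<forall>w. adj G v w \<and> \<not> (adj G v w \<and> c {v, w} = Red) \<longrightarrow> w = a \<or> w = b"
        using c2 unfolding claw nb by meson
    qed (auto simp: adj_sym insert_commute)
    then show ?thesis by blast
  qed
  moreover have "\<not> arrows G (complete_graph 3) (star 3)" if "critical (adj G) r" for r
  proof -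
    define c where "c e = (if \<exists>u v. e = {u, v} \<and> r u v then Red else Blue)" for e
    have sym: "r u v \<longleftrightarrow> r v u" for u v using that unfolding critical_def by blast
    have c: "c {u, v} = Red \<longleftrightarrow> r u v" for u v
      unfolding c_def using sym by (auto simp: doubleton_eq_iff)
    have "\<not> contains_copy (colour_class G c Red) (complete_graph 3)"
      unfolding tri c using criticalD(3)[OF that] by blast
    moreover have "\<not> contains_copy (colour_class G c Blue) (star 3)"
      unfolding claw nb c using criticalD(4)[OF that] by blast
    ultimately show ?thesis unfolding arrows_def by blast
  qed
  ultimately show ?thesis by blast
qed

text \<open>The two conditions on a non-adjacent pair say that the missing edge can be added neither in red nor in blue.
  Conversely, a critical colouring of the graph with the new edge restricts to a critical colouring of
  \<open>G\<close> that violates the condition belonging to the colour of the new edge.\<close>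

lemma co_critical_iff:
  assumes G: "simple_graph G"
  shows "co_critical G (complete_graph 3) (star 3) \<longleftrightarrow>
    \<not> is_complete G \<and> (\<exists>r. critical (adj G) r) \<and>
    (\<forall>r u v. critical (adj G) r \<longrightarrow> u \<in> verts G \<longrightarrow> v \<in> verts G \<longrightarrow> u \<noteq> v \<longrightarrow> \<not> adj G u v \<longrightarrow>
       (\<exists>w. r u w \<and> r v w) \<and> (\<not> blue_le_1 (adj G) r u \<or> \<not> blue_le_1 (adj G) r v))"
proof -
  have compl: "e \<in> edges (complement G) \<longleftrightarrow>
      (\<exists>u v. e = {u, v} \<and> u \<in> verts G \<and> v \<in> verts G \<and> u \<noteq> v \<and> \<not> adj G u v)" for e
  proof
    assume e: "e \<in> edges (complement G)"
    then have "e \<subseteq> verts G" "card e = 2" "e \<notin> edges G"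
      unfolding complement_def nsets_def by simp_all
    moreover from this obtain u v where "e = {u, v}" "u \<noteq> v" by (auto simp: card_2_iff)
    ultimately show "\<exists>u v. e = {u, v} \<and> u \<in> verts G \<and> v \<in> verts G \<and> u \<noteq> v \<and> \<not> adj G u v"
      unfolding adj_def by (intro exI[of _ u] exI[of _ v]) simp
  next
    assume "\<exists>u v. e = {u, v} \<and> u \<in> verts G \<and> v \<in> verts G \<and> u \<noteq> v \<and> \<not> adj G u v"
    then show "e \<in> edges (complement G)"
      unfolding complement_def nsets_def adj_def by auto
  qed
  have main: "arrows (add_edge G {u, v}) (complete_graph 3) (star 3) \<longleftrightarrow>
      (\<forall>r. critical (adj G) r \<longrightarrow> (\<exists>w. r u w \<and> r v w) \<and> (\<not> blue_le_1 (adj G) r u \<or> \<not> blue_le_1 (adj G) r v))"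
    if uv: "u \<in> verts G" "v \<in> verts G" "u \<noteq> v" "\<not> adj G u v" for u v
  proof -
    let ?H = "add_edge G {u, v}"
    have H: "simple_graph ?H"
      using G uv unfolding simple_graph_def add_edge_def by (auto simp: nsets_def)
    have aH: "adj ?H a b \<longleftrightarrow> adj G a b \<or> (a = u \<and> b = v) \<or> (a = v \<and> b = u)" for a b
      unfolding adj_def add_edge_def by (auto simp: doubleton_eq_iff)
    \<comment> \<open>Without a common red neighbour the new edge may be red.\<close>
    have "\<exists>r. critical (adj ?H) r" if r: "critical (adj G) r" and nc: "\<not> (\<exists>w. r u w \<and> r v w)" for r
    proof (rule exI[of _ "\<lambda>a b. r a b \<or> (a = u \<and> b = v) \<or> (a = v \<and> b = u)"], unfold critical_def, intro conjI)
      have s: "r a b \<Longrightarrow> r b a" "r a b \<Longrightarrow> adj G a b" "r a b \<Longrightarrow> r b c \<Longrightarrow> \<not> r a c" for a b c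
        using r unfolding critical_def by blast+
      have irr: "\<not> r a a" for a using s(2)[of a a] adj_verts[OF G] by blast
      show "\<forall>a b. r a b \<or> a = u \<and> b = v \<or> a = v \<and> b = u \<longrightarrow>
          (r b a \<or> b = u \<and> a = v \<or> b = v \<and> a = u) \<and> adj ?H a b"
        using s unfolding aH by blast
      show "\<forall>a b c. r a b \<or> a = u \<and> b = v \<or> a = v \<and> b = u \<longrightarrow>
        r b c \<or> b = u \<and> c = v \<or> b = v \<and> c = u \<longrightarrow>
        \<not> (r a c \<or> a = u \<and> c = v \<or> a = v \<and> c = u)"
        using s nc irr uv(3) by metis
      show "\<forall>a. \<exists>b c. \<forall>w. adj ?H a w \<and> \<not> (r a w \<or> a = u \<and> w = v \<or> a = v \<and> w = u) \<longrightarrow> w = b \<or> w = c"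
        using criticalD(4)[OF r] unfolding aH by blast
    qed
    \<comment> \<open>If both ends have blue degree at most one, the new edge may be blue.\<close>
    moreover have "critical (adj ?H) r"
      if r: "critical (adj G) r" and l: "blue_le_1 (adj G) r u" "blue_le_1 (adj G) r v" for r
    proof (rule criticalI)
      show "\<exists>b c. \<forall>w. adj ?H a w \<and> \<not> r a w \<longrightarrow> w = b \<or> w = c" for a
      proof (cases "a = u \<or> a = v")
        case True
        then show ?thesis using l unfolding blue_le_1_def aH by metis
      next
        case False
        then show ?thesis using criticalD(4)[OF r, of a] unfolding aH by blast
      qed
      show "adj ?H a b" if "r a b" for a b using criticalD(2)[OF r that] unfolding aH by blast
    qed (use criticalD[OF r] in blast)+
    moreover have False
      if r: "critical (adj ?H) r" and
        *: "\<forall>r. critical (adj G) r \<longrightarrow> (\<exists>w. r u w \<and> r v w) \<and> (\<not> blue_le_1 (adj G) r u \<or> \<not> blue_le_1 (adj G) r v)" for r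
    proof -
      let ?r = "\<lambda>a b. r a b \<and> adj G a b"
      have rG: "critical (adj G) ?r"
      proof (rule criticalI)
        show "\<exists>b c. \<forall>w. adj G a w \<and> \<not> (r a w \<and> adj G a w) \<longrightarrow> w = b \<or> w = c" for a
          using criticalD(4)[OF r, of a] unfolding aH by blast
        show "r b a \<and> adj G b a" if "r a b \<and> adj G a b" for a b
          using that criticalD(1)[OF r] adj_sym by metis
      qed (use criticalD[OF r] in blast)+
      show False
      proof (cases "r u v")
        case True
        then show False using * rG criticalD[OF r] by blast
      next
        case False
        then have F: "\<not> r u v" "\<not> r v u" using r unfolding critical_def by blast+
        have d: "\<exists>b c. \<forall>w. adj ?H a w \<and> \<not> r a w \<longrightarrow> w = b \<or> w = c" for a
          using r unfolding critical_def by blast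
        have "blue_le_1 (adj G) ?r u"
        proof -
          obtain b c where bc: "\<forall>w. adj ?H u w \<and> \<not> r u w \<longrightarrow> w = b \<or> w = c" using d by blast
          then have "v = b \<or> v = c" using F aH by blast
          then have "\<forall>w. adj G u w \<and> \<not> r u w \<longrightarrow> w = (if v = b then c else b)"
            using bc uv(4) unfolding aH by auto
          then show ?thesis unfolding blue_le_1_def by blast
        qed
        moreover have "blue_le_1 (adj G) ?r v"
        proof -
          obtain b c where bc: "\<forall>w. adj ?H v w \<and> \<not> r v w \<longrightarrow> w = b \<or> w = c" using d by blast
          then have "u = b \<or> u = c" using F aH by blast
          then have "\<forall>w. adj G v w \<and> \<not> r v w \<longrightarrow> w = (if u = b then c else b)"
            using bc uv(4) unfolding aH adj_sym[of G u v] by auto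
          then show ?thesis unfolding blue_le_1_def by blast
        qed
        ultimately show False using * rG by blast
      qed
    qed
    ultimately show ?thesis
      unfolding arrows_iff[OF H] by metis
  qed
  have "(\<forall>e\<in>edges (complement G). arrows (add_edge G e) (complete_graph 3) (star 3)) \<longleftrightarrow>
      (\<forall>u v. u \<in> verts G \<and> v \<in> verts G \<and> u \<noteq> v \<and> \<not> adj G u v \<longrightarrow>
         arrows (add_edge G {u, v}) (complete_graph 3) (star 3))"
    unfolding Ball_def compl by blast
  also have "\<dots> \<longleftrightarrow> (\<forall>r u v. critical (adj G) r \<longrightarrow> u \<in> verts G \<longrightarrow> v \<in> verts G \<longrightarrow> u \<noteq> v \<longrightarrow> \<not> adj G u v \<longrightarrow>
       (\<exists>w. r u w \<and> r v w) \<and> (\<not> blue_le_1 (adj G) r u \<or> \<not> blue_le_1 (adj G) r v))"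
    using main by blast
  finally show ?thesis
    unfolding co_critical_def arrows_iff[OF G] by simp
qed

section \<open>Folding a graph onto the five-cycle\<close>

definition c5 :: "nat \<Rightarrow> nat \<Rightarrow> bool" where
  "c5 i j \<longleftrightarrow> i = 0 \<and> (j = 1 \<or> j = 4) \<or> i = 1 \<and> (j = 0 \<or> j = 2) \<or> i = 2 \<and> (j = 1 \<or> j = 3) \<or>
     i = 3 \<and> (j = 2 \<or> j = 4) \<or> i = 4 \<and> (j = 3 \<or> j = 0)"

lemma two_exceptions_mono:
  assumes "\<exists>a b. \<forall>w. S w \<longrightarrow> w = a \<or> w = b" "\<And>w. w \<in> A \<Longrightarrow> T w \<Longrightarrow> S w"
  shows "\<exists>a b. \<forall>w\<in>A. T w \<longrightarrow> w = a \<or> w = b"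
proof -
  obtain a b where "\<forall>w. S w \<longrightarrow> w = a \<or> w = b" using assms(1) by blast
  then have "\<forall>w\<in>A. T w \<longrightarrow> w = a \<or> w = b" using assms(2) by blast
  then show ?thesis by blast
qed

lemma two_exceptions_imp:
  assumes "\<exists>a b. \<forall>w. S w \<longrightarrow> w = a \<or> w = b" "\<And>w. w \<in> A \<Longrightarrow> G w \<Longrightarrow> \<not> C w \<Longrightarrow> S w"
  shows "\<exists>a b. \<forall>w\<in>A. G w \<longrightarrow> \<not> C w \<longrightarrow> w = a \<or> w = b"
proof -
  obtain a b where "\<forall>w. S w \<longrightarrow> w = a \<or> w = b" using assms(1) by blast
  then have "\<forall>w\<in>A. G w \<longrightarrow> \<not> C w \<longrightarrow> w = a \<or> w = b" using assms(2) by blast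
  then show ?thesis by blast
qed

lemma one_exception_imp:
  assumes "\<exists>a. \<forall>w. S w \<longrightarrow> w = a" "\<And>w. w \<in> A \<Longrightarrow> G w \<Longrightarrow> \<not> C w \<Longrightarrow> w \<noteq> d \<Longrightarrow> S w"
  shows "\<exists>a b. \<forall>w\<in>A. G w \<longrightarrow> \<not> C w \<longrightarrow> w = a \<or> w = b"
proof -
  obtain a where "\<forall>w. S w \<longrightarrow> w = a" using assms(1) by blast
  then have "\<forall>w\<in>A. G w \<longrightarrow> \<not> C w \<longrightarrow> w = a \<or> w = d" using assms(2) by blast
  then show ?thesis by blast
qed

lemma two_exceptions_pick:
  assumes "\<exists>a b. \<forall>w. S w \<longrightarrow> w = a \<or> w = b" "S c"
  shows "\<exists>d. \<forall>w. S w \<longrightarrow> w = c \<or> w = d"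
proof -
  obtain a b where ab: "\<forall>w. S w \<longrightarrow> w = a \<or> w = b" using assms(1) by blast
  then have "c = a \<or> c = b" using assms(2) by blast
  then show ?thesis using ab by blast
qed

lemma two_exceptions_eq:
  assumes "\<exists>a b. \<forall>w. S w \<longrightarrow> w = a \<or> w = b" "S c" "S d" "c \<noteq> d" "S w"
  shows "w = c \<or> w = d"
  using assms by metis

text \<open>Hence every graph mapped homomorphically to the five-cycle is triangle-free.\<close>

lemma c5_no_triangle:
  assumes "c5 i j" "c5 j k" "c5 i k"
  shows False
proof -
  consider "i = 0" | "i = 1" | "i = 2" | "i = 3" | "i = 4" using assms(1) unfolding c5_def by blast
  then show False by cases (use assms in \<open>auto simp: c5_def\<close>)
qed

lemma c5_sym: "c5 i j \<Longrightarrow> c5 j i"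
  unfolding c5_def by auto

text \<open>The neighbourhood conditions of a co-critical graph, for the adjacency relation \<open>g\<close> alone.\<close>

locale cocritical =
  fixes V :: "'a set" and g :: "'a \<Rightarrow> 'a \<Rightarrow> bool"
  assumes fin: "finite V"
    and gsym: "g u v \<Longrightarrow> g v u"
    and girr: "\<not> g u u"
    and gV: "g u v \<Longrightarrow> u \<in> V"
    and common: "critical g r \<Longrightarrow> u \<in> V \<Longrightarrow> v \<in> V \<Longrightarrow> u \<noteq> v \<Longrightarrow> \<not> g u v \<Longrightarrow> \<exists>w. r u w \<and> r v w"
    and full: "critical g r \<Longrightarrow> u \<in> V \<Longrightarrow> v \<in> V \<Longrightarrow> u \<noteq> v \<Longrightarrow> \<not> g u v \<Longrightarrow> blue_le_1 g r u \<Longrightarrow> \<not> blue_le_1 g r v"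
begin

lemma gV2: "g u v \<Longrightarrow> v \<in> V"
  using gsym gV by blast

text \<open>The edges between consecutive positions form a critical red graph, and two vertices in consecutive positions
  have no common neighbour in it, since the five-cycle has no triangle.\<close>

lemma fold_complete:
  assumes f: "\<And>v. v \<in> V \<Longrightarrow> \<exists>a b. \<forall>w\<in>V. g v w \<longrightarrow> \<not> c5 (f v) (f w) \<longrightarrow> w = a \<or> w = b"
    and uv: "u \<in> V" "v \<in> V" "c5 (f u) (f v)"
  shows "g u v"
proof (rule ccontr)
  assume n: "\<not> g u v"
  let ?r = "\<lambda>u v. g u v \<and> c5 (f u) (f v)"
  have "critical g ?r"
  proof (rule criticalI)
    show "\<exists>a b. \<forall>w. g v w \<and> \<not> (g v w \<and> c5 (f v) (f w)) \<longrightarrow> w = a \<or> w = b" for v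
      using f[of v] gV gV2 by (cases "v \<in> V") blast+
  qed (use gsym c5_sym c5_no_triangle in blast)+
  moreover have "u \<noteq> v" using uv(3) unfolding c5_def by auto
  ultimately obtain w where "?r u w" "?r v w" using common uv(1,2) n by blast
  then show False using uv(3) c5_no_triangle c5_sym by blast
qed

text \<open>The special case of two positions: the red graph is bipartite between \<open>X\<close> and its complement.\<close>

lemma split_edges:
  assumes X: "X \<subseteq> V"
    and in_X: "\<And>v. v \<in> X \<Longrightarrow> \<exists>a b. \<forall>w\<in>X. g v w \<longrightarrow> w = a \<or> w = b"
    and out_X: "\<And>v. v \<in> V - X \<Longrightarrow> \<exists>a b. \<forall>w\<in>V - X. g v w \<longrightarrow> w = a \<or> w = b"
    and "u \<in> X" "v \<in> V - X"
  shows "g u v"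
proof (rule fold_complete[of "\<lambda>w. if w \<in> X then 0 else 1"])
  fix v assume "v \<in> V"
  show "\<exists>a b. \<forall>w\<in>V. g v w \<longrightarrow> \<not> c5 (if v \<in> X then 0 else 1) (if w \<in> X then 0 else 1) \<longrightarrow> w = a \<or> w = b"
  proof (cases "v \<in> X")
    case True
    then show ?thesis using in_X[of v] by (auto simp: c5_def)
  next
    case False
    then have "v \<in> V - X" using \<open>v \<in> V\<close> by simp
    then show ?thesis using out_X[of v] by (auto simp: c5_def)
  qed
qed (use assms in \<open>auto simp: c5_def\<close>)

section \<open>Blow-ups of the five-cycle\<close>

definition blow_up :: "('a \<Rightarrow> 'a \<Rightarrow> bool) \<Rightarrow> 'a \<Rightarrow> 'a \<Rightarrow> 'a set \<Rightarrow> 'a set \<Rightarrow> 'a set \<Rightarrow> bool" where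
  "blow_up r x y P Q M \<longleftrightarrow> critical g r \<and> V = insert x (insert y (P \<union> Q \<union> M)) \<and> x \<noteq> y \<and>
     x \<notin> P \<union> Q \<union> M \<and> y \<notin> P \<union> Q \<union> M \<and> P \<inter> Q = {} \<and> P \<inter> M = {} \<and> Q \<inter> M = {} \<and>
     (\<forall>w. r x w \<longleftrightarrow> w \<in> P \<union> M) \<and> (\<forall>w. r y w \<longleftrightarrow> w \<in> Q \<union> M) \<and>
     (\<forall>u\<in>P. \<forall>w. r u w \<longleftrightarrow> w = x \<or> w \<in> Q) \<and> (\<forall>u\<in>Q. \<forall>w. r u w \<longleftrightarrow> w = y \<or> w \<in> P) \<and>
     (\<forall>u\<in>M. \<forall>w. r u w \<longleftrightarrow> w = x \<or> w = y)"

lemma blow_up_swap: "blow_up r x y P Q M \<Longrightarrow> blow_up r y x Q P M"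
  unfolding blow_up_def by auto

end

text \<open>The names suggest the five-cycle \<open>x - P - Q - y - M - x\<close>. Reflecting it exchanges
  \<open>x\<close> with \<open>y\<close> and \<open>P\<close> with \<open>Q\<close>, so every lemma below has a
  mirror image.\<close>

locale pentagon = cocritical +
  fixes r x y P Q M
  assumes p: "blow_up r x y P Q M"
begin

lemma crit: "critical g r" using p unfolding blow_up_def by blast
lemma V: "V = insert x (insert y (P \<union> Q \<union> M))" using p unfolding blow_up_def by blast

lemma blow_up_disjoint:
  "x \<noteq> y" "x \<notin> P \<union> Q \<union> M" "y \<notin> P \<union> Q \<union> M" "P \<inter> Q = {}" "P \<inter> M = {}" "Q \<inter> M = {}"
  using p unfolding blow_up_def by simp_all

lemma disj: "x \<noteq> y" "x \<notin> P" "x \<notin> Q" "x \<notin> M" "y \<notin> P" "y \<notin> Q" "y \<notin> M"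
  "u \<in> P \<Longrightarrow> u \<notin> Q" "u \<in> P \<Longrightarrow> u \<notin> M" "u \<in> Q \<Longrightarrow> u \<notin> M" "u \<in> Q \<Longrightarrow> u \<notin> P" "u \<in> M \<Longrightarrow> u \<notin> P" "u \<in> M \<Longrightarrow> u \<notin> Q"
  "u \<in> P \<Longrightarrow> u \<noteq> x" "u \<in> P \<Longrightarrow> u \<noteq> y" "u \<in> Q \<Longrightarrow> u \<noteq> x" "u \<in> Q \<Longrightarrow> u \<noteq> y" "u \<in> M \<Longrightarrow> u \<noteq> x" "u \<in> M \<Longrightarrow> u \<noteq> y"
  using blow_up_disjoint by auto

text \<open>Only one orientation of each disjointness fact, so that the simplifier terminates.\<close>
lemmas disj_simps = disj(1-7,11-19)

lemma red: "r x w \<longleftrightarrow> w \<in> P \<union> M" "r y w \<longleftrightarrow> w \<in> Q \<union> M" "u \<in> P \<Longrightarrow> r u w \<longleftrightarrow> w = x \<or> w \<in> Q"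
  "u \<in> Q \<Longrightarrow> r u w \<longleftrightarrow> w = y \<or> w \<in> P" "u \<in> M \<Longrightarrow> r u w \<longleftrightarrow> w = x \<or> w = y"
  using p unfolding blow_up_def by simp_all

lemma inV: "x \<in> V" "y \<in> V" "u \<in> P \<Longrightarrow> u \<in> V" "u \<in> Q \<Longrightarrow> u \<in> V" "u \<in> M \<Longrightarrow> u \<in> V"
  using V by blast+

lemma blue2:
  "\<exists>a b. \<forall>w. g x w \<and> w \<notin> P \<and> w \<notin> M \<longrightarrow> w = a \<or> w = b"
  "\<exists>a b. \<forall>w. g y w \<and> w \<notin> Q \<and> w \<notin> M \<longrightarrow> w = a \<or> w = b"
  "u \<in> P \<Longrightarrow> \<exists>a b. \<forall>w. g u w \<and> w \<noteq> x \<and> w \<notin> Q \<longrightarrow> w = a \<or> w = b"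
  "u \<in> Q \<Longrightarrow> \<exists>a b. \<forall>w. g u w \<and> w \<noteq> y \<and> w \<notin> P \<longrightarrow> w = a \<or> w = b"
  "u \<in> M \<Longrightarrow> \<exists>a b. \<forall>w. g u w \<and> w \<noteq> x \<and> w \<noteq> y \<longrightarrow> w = a \<or> w = b"
  using criticalD(4)[OF crit, of x] criticalD(4)[OF crit, of y] criticalD(4)[OF crit, of u]
  by (auto simp: red)

lemma low:
  "blue_le_1 g r x \<longleftrightarrow> (\<exists>a. \<forall>w. g x w \<and> w \<notin> P \<and> w \<notin> M \<longrightarrow> w = a)"
  "blue_le_1 g r y \<longleftrightarrow> (\<exists>a. \<forall>w. g y w \<and> w \<notin> Q \<and> w \<notin> M \<longrightarrow> w = a)"
  "u \<in> P \<Longrightarrow> blue_le_1 g r u \<longleftrightarrow> (\<exists>a. \<forall>w. g u w \<and> w \<noteq> x \<and> w \<notin> Q \<longrightarrow> w = a)"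
  "u \<in> Q \<Longrightarrow> blue_le_1 g r u \<longleftrightarrow> (\<exists>a. \<forall>w. g u w \<and> w \<noteq> y \<and> w \<notin> P \<longrightarrow> w = a)"
  "u \<in> M \<Longrightarrow> blue_le_1 g r u \<longleftrightarrow> (\<exists>a. \<forall>w. g u w \<and> w \<noteq> x \<and> w \<noteq> y \<longrightarrow> w = a)"
  unfolding blue_le_1_def by (auto simp: red)

lemma obtain_nonadjacent:
  assumes "\<exists>a b. \<forall>w\<in>A. g u w \<longrightarrow> w = a \<or> w = b" "4 \<le> card A"
  obtains z where "z \<in> A" "z \<noteq> u" "\<not> g u z"
proof -
  obtain a b where ab: "\<forall>w\<in>A. g u w \<longrightarrow> w = a \<or> w = b" using assms(1) by blast
  have "card {u, a, b} \<le> 3" by (simp add: card_insert_if)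
  then have "\<not> A \<subseteq> {u, a, b}" using assms(2) card_mono[of "{u, a, b}" A] by auto
  then show thesis using that ab by blast
qed

lemma obtain_nonadjacent_in_M:
  assumes "u \<in> P \<union> Q \<union> M" "4 \<le> card M"
  obtains z where "z \<in> M" "z \<noteq> u" "\<not> g u z" "\<not> g z u"
proof -
  have "\<exists>a b. \<forall>w\<in>M. g u w \<longrightarrow> w = a \<or> w = b"
  proof -
    have m: "w \<noteq> x \<and> w \<noteq> y \<and> w \<notin> P \<and> w \<notin> Q" if "w \<in> M" for w using that disj_simps by simp
    consider "u \<in> P" | "u \<in> Q" | "u \<in> M" using assms(1) by blast
    then show ?thesis
    proof cases
      case 1 then show ?thesis using two_exceptions_mono[OF blue2(3)[OF 1], of M "g u"] m by simp
    next
      case 2 then show ?thesis using two_exceptions_mono[OF blue2(4)[OF 2], of M "g u"] m by simp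
    next
      case 3 then show ?thesis using two_exceptions_mono[OF blue2(5)[OF 3], of M "g u"] m by simp
    qed
  qed
  then show thesis using obtain_nonadjacent assms(2) that gsym by metis
qed

text \<open>Here the red graph is complete bipartite between \<open>x, y\<close> and \<open>M\<close>. Moving a vertex
  \<open>u\<close> of \<open>M\<close> to the side of \<open>x\<close> and \<open>y\<close> turns its red edges
  blue and its blue edges red.\<close>

lemma bipartite_absurd:
  assumes PQ: "P = {}" "Q = {}" and M: "4 \<le> card M"
  shows False
proof -
  obtain u where u: "u \<in> M" using M by fastforce
  obtain z where z: "z \<in> M" "z \<noteq> u" "\<not> g u z" using obtain_nonadjacent_in_M[of u] u M by blast
  have "g u z"
  proof (rule split_edges[of "{x, y, u}"])
    show "{x, y, u} \<subseteq> V" using inV u by blast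
    show "\<exists>a b. \<forall>w\<in>{x, y, u}. g v w \<longrightarrow> w = a \<or> w = b" if "v \<in> {x, y, u}" for v
      using that girr by blast
    show "\<exists>a b. \<forall>w\<in>V - {x, y, u}. g v w \<longrightarrow> w = a \<or> w = b" if "v \<in> V - {x, y, u}" for v
    proof -
      have "v \<in> M" using that V PQ by blast
      then show ?thesis using blue2(5)[of v] by blast
    qed
  qed (use u z disj_simps inV in auto)
  then show False using z by blast
qed

text \<open>The placement that puts \<open>x\<close>, \<open>y\<close> and \<open>P\<close> on one side and \<open>Q\<close>
  and \<open>M\<close> on the other. Inside \<open>Q\<close> and \<open>M\<close> it only keeps blue edges blue,
  so just the degrees within the first side matter.\<close>

lemma xyP_complete_to_QM:
  assumes x: "\<exists>a b. \<forall>w. w \<in> P \<or> w = y \<and> g x y \<longrightarrow> w = a \<or> w = b"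
    and y: "\<exists>a b. \<forall>w. g y w \<and> (w \<in> P \<or> w = x) \<longrightarrow> w = a \<or> w = b"
    and P: "\<And>p. p \<in> P \<Longrightarrow> \<exists>a. \<forall>w. g p w \<and> (w \<in> P \<or> w = y) \<longrightarrow> w = a"
    and uv: "u \<in> insert x P" "v \<in> Q \<union> M"
  shows "g u v"
proof (rule split_edges[of "{x, y} \<union> P"])
  show "{x, y} \<union> P \<subseteq> V" using inV by blast
  show "\<exists>a b. \<forall>w\<in>{x, y} \<union> P. g v w \<longrightarrow> w = a \<or> w = b" if v: "v \<in> {x, y} \<union> P" for v
  proof -
    consider "v = x" | "v = y" | "v \<in> P" using v by blast
    then show ?thesis
    proof cases
      case 1 then show ?thesis using x girr by blast
    next
      case 2 then show ?thesis using y girr by blast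
    next
      case 3 then show ?thesis using P[OF 3] girr by blast
    qed
  qed
  show "\<exists>a b. \<forall>w\<in>V - ({x, y} \<union> P). g v w \<longrightarrow> w = a \<or> w = b" if "v \<in> V - ({x, y} \<union> P)" for v
  proof -
    have "v \<in> Q \<or> v \<in> M" using that V by blast
    then show ?thesis using blue2(4,5)[of v] by blast
  qed
qed (use uv disj_simps inV in auto)

text \<open>With a single vertex in \<open>P\<close> the first side has three vertices, so its degree conditions are
  automatic. The red graph then demands that \<open>p1\<close> be adjacent to all of \<open>M\<close> and
  \<open>x\<close> to all of \<open>Q\<close>, by edges that were blue.\<close>

lemma single_P_absurd:
  assumes P: "P = {p1}" and big: "4 \<le> card M \<or> 4 \<le> card Q"
  shows False
proof -
  have all: "g u v" if "u \<in> {x, p1}" "v \<in> Q \<union> M" for u v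
    by (rule xyP_complete_to_QM) (use that P girr in auto)
  from big show False
  proof
    assume "4 \<le> card M"
    then show False using obtain_nonadjacent_in_M[of p1] all[of p1] P by blast
  next
    assume 4: "4 \<le> card Q"
    have "\<exists>a b. \<forall>w\<in>Q. g x w \<longrightarrow> w = a \<or> w = b" using two_exceptions_mono[OF blue2(1), of Q "g x"] disj(10,11) by simp
    then show False using obtain_nonadjacent[of Q x] 4 all[of x] by blast
  qed
qed

text \<open>Moving \<open>u\<close> from \<open>M\<close> to the position of \<open>Q\<close> costs one blue edge at
  \<open>u\<close> and at \<open>x\<close>, which both can afford.\<close>

lemma shift_M:
  assumes u: "u \<in> M" "blue_le_1 g r u" and x: "blue_le_1 g r x" and p: "p \<in> P"
  shows "g u p"
proof -
  \<comment> \<open>Positions \<open>0, 1, 2, 3, 4\<close> belong to \<open>x, P, Q, y, M\<close>; only \<open>u\<close> is misplaced.\<close>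
  define f where "f w = (if w = x then 0 else if w = y then 3 else if w \<in> P then 1 else if w \<in> Q \<or> w = u then 2 else (4::nat))" for w
  have fs: "f x = 0" "f y = 3" "w \<in> P \<Longrightarrow> f w = 1" "w \<in> Q \<Longrightarrow> f w = 2" "f u = 2" "w \<in> M \<Longrightarrow> w \<noteq> u \<Longrightarrow> f w = 4" for w
    using u disj_simps unfolding f_def by auto
  \<comment> \<open>Red neighbourhoods of the five positions in the new placement.\<close>
  have c: "c5 0 (f w) \<longleftrightarrow> w \<in> P \<or> w \<in> M \<and> w \<noteq> u" "c5 1 (f w) \<longleftrightarrow> w = x \<or> w \<in> Q \<or> w = u"
    "c5 2 (f w) \<longleftrightarrow> w = y \<or> w \<in> P" "c5 3 (f w) \<longleftrightarrow> w \<in> Q \<or> w \<in> M" "c5 4 (f w) \<longleftrightarrow> w = x \<or> w = y" if "w \<in> V" for w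
    using that u(1) unfolding V f_def c5_def by (auto simp: disj_simps)
  show ?thesis
  proof (rule fold_complete[of f])
    fix v assume "v \<in> V"
    then consider "v = x" | "v = y" | "v \<in> P" | "v \<in> Q" | "v = u" | "v \<in> M" "v \<noteq> u" using V by blast
    then show "\<exists>a b. \<forall>w\<in>V. g v w \<longrightarrow> \<not> c5 (f v) (f w) \<longrightarrow> w = a \<or> w = b"
    proof cases
      case 1
      then show ?thesis by (intro one_exception_imp[OF x[unfolded low], where d = u]) (auto simp: fs c simp del: One_nat_def)
    next
      case 2
      then show ?thesis by (intro two_exceptions_imp[OF blue2(2)]) (auto simp: fs c simp del: One_nat_def)
    next
      case 3
      then show ?thesis by (intro two_exceptions_imp[OF blue2(3)[OF 3]]) (auto simp: fs c simp del: One_nat_def)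
    next
      case 4
      then show ?thesis by (intro two_exceptions_imp[OF blue2(4)[OF 4]]) (auto simp: fs c simp del: One_nat_def)
    next
      case 5
      then show ?thesis by (intro one_exception_imp[OF u(2)[unfolded low(5)[OF u(1)]], where d = x]) (auto simp: fs c simp del: One_nat_def)
    next
      case 6
      then show ?thesis by (intro two_exceptions_imp[OF blue2(5)[OF 6(1)]]) (auto simp: fs c simp del: One_nat_def)
    qed
  qed (use u p inV fs in \<open>auto simp: c5_def\<close>)
qed

text \<open>Moving \<open>p1\<close> from \<open>P\<close> to the position of \<open>y\<close> costs one blue edge at
  \<open>x\<close> and at \<open>p1\<close>; in return the blue edges from \<open>p1\<close> to \<open>M\<close>
  become red.\<close>

lemma shift_P:
  assumes x: "blue_le_1 g r x" and p1: "p1 \<in> P" and a1: "\<forall>w. g p1 w \<and> (w \<in> P \<or> w = y) \<longrightarrow> w = a1" and m: "m \<in> M"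
  shows "g p1 m"
proof -
  define f where "f w = (if w = x then 0 else if w = y \<or> w = p1 then 3 else if w \<in> P then 1 else if w \<in> Q then 2 else (4::nat))" for w
  have fs: "f x = 0" "f y = 3" "f p1 = 3" "w \<in> P \<Longrightarrow> w \<noteq> p1 \<Longrightarrow> f w = 1" "w \<in> Q \<Longrightarrow> f w = 2" "w \<in> M \<Longrightarrow> f w = 4" for w
    using p1 disj_simps disj(8,9)[OF p1] unfolding f_def by auto
  have c: "c5 0 (f w) \<longleftrightarrow> w \<in> P \<and> w \<noteq> p1 \<or> w \<in> M" "c5 1 (f w) \<longleftrightarrow> w = x \<or> w \<in> Q"
    "c5 2 (f w) \<longleftrightarrow> w = y \<or> w \<in> P" "c5 3 (f w) \<longleftrightarrow> w \<in> Q \<or> w \<in> M" "c5 4 (f w) \<longleftrightarrow> w = x \<or> w = y \<or> w = p1"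
    if "w \<in> V" for w
    using that p1 unfolding V f_def c5_def by (auto simp: disj_simps)
  show ?thesis
  proof (rule fold_complete[of f])
    fix v assume "v \<in> V"
    then consider "v = x" | "v = y" | "v \<in> P" "v \<noteq> p1" | "v \<in> Q" | "v = p1" | "v \<in> M" using V by blast
    then show "\<exists>a b. \<forall>w\<in>V. g v w \<longrightarrow> \<not> c5 (f v) (f w) \<longrightarrow> w = a \<or> w = b"
    proof cases
      case 1
      then show ?thesis by (intro one_exception_imp[OF x[unfolded low], where d = p1]) (auto simp: fs c simp del: One_nat_def)
    next
      case 2
      then show ?thesis by (intro two_exceptions_imp[OF blue2(2)]) (auto simp: fs c simp del: One_nat_def)
    next
      case 3
      then show ?thesis by (intro two_exceptions_imp[OF blue2(3)[OF 3(1)]]) (auto simp: fs c simp del: One_nat_def)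
    next
      case 4
      then show ?thesis by (intro two_exceptions_imp[OF blue2(4)[OF 4]]) (auto simp: fs c simp del: One_nat_def)
    next
      case 5
      have "w = a1 \<or> w = x" if "w \<in> V" "g p1 w" "w \<notin> Q" "w \<notin> M" for w
        using that a1 V by blast
      then show ?thesis using 5 by (simp add: fs c del: One_nat_def) blast
    next
      case 6
      then show ?thesis by (intro two_exceptions_imp[OF blue2(5)[OF 6]]) (auto simp: fs c simp del: One_nat_def)
    qed
  qed (use p1 m inV fs in \<open>auto simp: c5_def\<close>)
qed

text \<open>If \<open>x\<close> has a spare blue edge, the previous recolouring is prevented only by two blue edges from
  \<open>p1\<close> into \<open>P\<close> and \<open>y\<close>, because \<open>M\<close> is too large for the blue
  edges of \<open>p1\<close>.\<close>

lemma low_x_blocks_P: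
  assumes x: "blue_le_1 g r x" and p1: "p1 \<in> P" and M: "4 \<le> card M"
  shows "\<nexists>a. \<forall>w. g p1 w \<and> (w \<in> P \<or> w = y) \<longrightarrow> w = a"
proof
  assume "\<exists>a. \<forall>w. g p1 w \<and> (w \<in> P \<or> w = y) \<longrightarrow> w = a"
  then obtain a where a: "\<forall>w. g p1 w \<and> (w \<in> P \<or> w = y) \<longrightarrow> w = a" by blast
  obtain m where "m \<in> M" "\<not> g p1 m" using obtain_nonadjacent_in_M[of p1] p1 M by blast
  then show False using shift_P[OF x p1 a] by blast
qed

lemma swapped: "pentagon V g r y x Q P M"
  by unfold_locales (rule blow_up_swap[OF p])

text \<open>A spare blue edge at \<open>x\<close> makes \<open>y\<close>, \<open>p1\<close>, \<open>p2\<close> a blue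
  triangle, and the mirror image of \<open>xyP_complete_to_QM\<close> forces a blue path
  \<open>x - q - q'\<close>. All vertices other than \<open>x\<close> have then two blue edges, and
  \<open>x\<close> has one; the last assumption excludes just this.\<close>

lemma blow_up_2_2_low_x:
  assumes P: "P = {p1, p2}" "p1 \<noteq> p2" and Q: "Q = {q1, q2}" "q1 \<noteq> q2" and M: "4 \<le> card M"
    and x: "blue_le_1 g r x"
    and D: "(\<forall>w. g x w \<longrightarrow> r x w) \<or> (\<exists>v\<in>V. v \<noteq> x \<and> blue_le_1 g r v)"
  shows False
proof -
  interpret sw: pentagon V g r y x Q P M by (rule swapped)
  have pP: "p1 \<in> P" "p2 \<in> P" and qQ: "q1 \<in> Q" "q2 \<in> Q" using P Q by auto
  have gp: "g p1 p2" "g p1 y" "g p2 y"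
  proof -
    have n1: "\<nexists>a. \<forall>w. g p1 w \<and> (w \<in> P \<or> w = y) \<longrightarrow> w = a" by (rule low_x_blocks_P[OF x pP(1) M])
    have n2: "\<nexists>a. \<forall>w. g p2 w \<and> (w \<in> P \<or> w = y) \<longrightarrow> w = a" by (rule low_x_blocks_P[OF x pP(2) M])
    show "g p1 p2" using n1 girr P by (metis insertE singletonD)
    show "g p1 y" using n1 girr P by (metis insertE singletonD)
    show "g p2 y" using n2 girr P by (metis insertE singletonD)
  qed
  have yb: "w = p1 \<or> w = p2" if "g y w" "w \<notin> Q" "w \<notin> M" for w
  proof -
    obtain a b where ab: "\<forall>w. g y w \<and> w \<notin> Q \<and> w \<notin> M \<longrightarrow> w = a \<or> w = b" using blue2(2) by blast
    have "p1 = a \<or> p1 = b" "p2 = a \<or> p2 = b" "w = a \<or> w = b"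
      using ab that gsym[OF gp(2)] gsym[OF gp(3)] disj(8,9)[OF pP(1)] disj(8,9)[OF pP(2)] by blast+
    then show ?thesis using P(2) by blast
  qed
  \<comment> \<open>The two blue edges of \<open>y\<close> lead to \<open>p1\<close> and \<open>p2\<close>.\<close>
  have nxy: "\<not> g y x" using yb[of x] disj(3,4) disj(14)[OF pP(1)] disj(14)[OF pP(2)] by blast
  obtain a where a: "\<forall>w. g x w \<and> w \<notin> P \<and> w \<notin> M \<longrightarrow> w = a" using x low(1) by blast
  have "g q1 q2 \<and> (g x q1 \<or> g x q2)"
  proof (rule ccontr)
    assume n: "\<not> (g q1 q2 \<and> (g x q1 \<or> g x q2))"
    have "g u v" if "u \<in> insert y Q" "v \<in> P \<union> M" for u v
    proof (rule sw.xyP_complete_to_QM[OF _ _ _ that])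
      show "\<exists>a b. \<forall>w. w \<in> Q \<or> w = x \<and> g y x \<longrightarrow> w = a \<or> w = b" using Q nxy by auto
      show "\<exists>a b. \<forall>w. g x w \<and> (w \<in> Q \<or> w = y) \<longrightarrow> w = a \<or> w = b"
      proof -
        have "g x w \<and> (w \<in> Q \<or> w = y) \<longrightarrow> w = a" for w
          using a nxy gsym[of x w] disj(10,11)[of w] by blast
        then show ?thesis by blast
      qed
      show "\<exists>a. \<forall>w. g q w \<and> (w \<in> Q \<or> w = x) \<longrightarrow> w = a" if q: "q \<in> Q" for q
      proof (cases "g q1 q2")
        case True
        then have "\<not> g q x" using n q Q gsym[of q x] by blast
        then show ?thesis using q Q girr by (cases "q = q1") auto
      next
        case False
        then have "\<not> g q w" if "w \<in> Q" for w
          using that q Q girr[of q1] girr[of q2] gsym[of q2 q1] by blast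
        then show ?thesis by blast
      qed
    qed
    then show False using obtain_nonadjacent_in_M[of q1] M qQ by (metis UnI1 UnI2 insertI2)
  qed
  then obtain q q' where q: "Q = {q, q'}" "q \<noteq> q'" "g q q'" "g x q"
  proof (cases "g x q1")
    case True
    then show ?thesis using that[of q1 q2] Q \<open>g q1 q2 \<and> _\<close> by blast
  next
    case False
    then show ?thesis using that[of q2 q1] Q \<open>g q1 q2 \<and> _\<close> gsym[of q1 q2] by blast
  qed
  then have qQ: "q \<in> Q" "q' \<in> Q" by auto
  have aq: "a = q" using a q(4) disj(10,11)[OF qQ(1)] by blast
  then have nq': "\<not> g x q'" using a q(2) disj(10,11)[OF qQ(2)] by blast
  have "\<not> r x q" using red(1) disj(10,11)[OF qQ(1)] by blast
  then obtain v where v: "v \<in> V" "v \<noteq> x" "blue_le_1 g r v" using D q(4) by blast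
  consider "v = y" | "v = p1" | "v = p2" | "v = q" | "v = q'" | "v \<in> M" using v(1,2) V P q(1) by blast
  then show False
  proof cases
    case 1
    then obtain b where "\<forall>w. g y w \<and> w \<notin> Q \<and> w \<notin> M \<longrightarrow> w = b" using v(3) low(2) by blast
    then show False using gsym[OF gp(2)] gsym[OF gp(3)] disj(8,9)[OF pP(1)] disj(8,9)[OF pP(2)] P(2) by blast
  next
    case 2
    then obtain b where "\<forall>w. g p1 w \<and> w \<noteq> x \<and> w \<notin> Q \<longrightarrow> w = b" using v(3) low(3)[OF pP(1)] by blast
    then show False using gp disj(8,14,15)[OF pP(2)] disj(1,6) by metis
  next
    case 3
    then obtain b where "\<forall>w. g p2 w \<and> w \<noteq> x \<and> w \<notin> Q \<longrightarrow> w = b" using v(3) low(3)[OF pP(2)] by blast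
    then show False using gp gsym[OF gp(1)] disj(8,14,15)[OF pP(1)] disj(1,6) by metis
  next
    case 4
    then obtain b where "\<forall>w. g q w \<and> w \<noteq> y \<and> w \<notin> P \<longrightarrow> w = b" using v(3) low(4)[OF qQ(1)] by blast
    then show False using q(3) gsym[OF q(4)] disj(11,16,17)[OF qQ(2)] disj(1,2) by metis
  next
    case 5
    then show False using full[OF crit inV(1) inV(4)[OF qQ(2)] _ nq' x] v(3) disj(16)[OF qQ(2)] by metis
  next
    case 6
    then obtain b where b: "\<forall>w. g v w \<and> w \<noteq> x \<and> w \<noteq> y \<longrightarrow> w = b" using v(3) low(5) by blast
    have "g v p1" "g v p2" using shift_M[OF 6 v(3) x] pP by blast+
    then show False using b P(2) disj(14,15)[OF pP(1)] disj(14,15)[OF pP(2)] by metis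
  qed
qed

text \<open>Without the edge \<open>xy\<close> and with two vertices in \<open>P\<close>, the placement
  \<open>xyP_complete_to_QM\<close> can fail only at a vertex of \<open>P\<close> that is adjacent both to
  \<open>y\<close> and to the other one.\<close>

lemma xyP_absurd:
  assumes P: "P = {p1, p2}" "p1 \<noteq> p2" and M: "4 \<le> card M" and nxy: "\<not> g x y"
    and n: "\<not> (g p1 p2 \<and> (g y p1 \<or> g y p2))"
  shows False
proof -
  have "g u v" if "u \<in> insert x P" "v \<in> Q \<union> M" for u v
  proof (rule xyP_complete_to_QM[OF _ _ _ that])
    show "\<exists>a b. \<forall>w. w \<in> P \<or> w = y \<and> g x y \<longrightarrow> w = a \<or> w = b" using P nxy by auto
    show "\<exists>a b. \<forall>w. g y w \<and> (w \<in> P \<or> w = x) \<longrightarrow> w = a \<or> w = b"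
      using P nxy gsym[of y x] by blast
    show "\<exists>a. \<forall>w. g q w \<and> (w \<in> P \<or> w = y) \<longrightarrow> w = a" if q: "q \<in> P" for q
    proof (cases "g p1 p2")
      case True
      then have "\<not> g q y" using n q P gsym[of q y] by blast
      then show ?thesis using q P girr by (cases "q = p1") auto
    next
      case False
      then have "\<not> g q w" if "w \<in> P" for w
        using that q P girr[of p1] girr[of p2] gsym[of p2 p1] by blast
      then show ?thesis by blast
    qed
  qed
  moreover have "p1 \<in> P" using P by simp
  ultimately show False using obtain_nonadjacent_in_M[of p1] M by (metis UnI1 UnI2 insertI2)
qed

lemma nbrs_x: "g x w \<Longrightarrow> w \<notin> P \<Longrightarrow> w \<notin> M \<Longrightarrow> w = y \<or> w \<in> Q"
  using gV2[of x w] V girr[of x] by blast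

lemma not_low_x_nonadj:
  assumes "Q = {q1, q2}" "\<not> g x y" "\<not> blue_le_1 g r x"
  shows "g x q1" "g x q2"
proof -
  have *: "w = q1 \<or> w = q2" if "g x w" "w \<notin> P" "w \<notin> M" for w using nbrs_x that assms by blast
  show "g x q1" using * assms(2,3) low(1) by metis
  show "g x q2" using * assms(2,3) low(1) by metis
qed

lemma not_low_x_adj:
  assumes xy: "g x y" and l: "\<not> blue_le_1 g r x"
  obtains q where "q \<in> Q" "g x q" "\<forall>w. g x w \<longrightarrow> w \<notin> P \<longrightarrow> w \<notin> M \<longrightarrow> w = y \<or> w = q"
proof -
  obtain q where q: "g x q" "q \<notin> P" "q \<notin> M" "q \<noteq> y" using l low(1) by blast
  then have "q \<in> Q" using nbrs_x by blast
  moreover have "w = y \<or> w = q" if "g x w" "w \<notin> P" "w \<notin> M" for w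
    using two_exceptions_eq[OF blue2(1), of y q w] xy q that disj(5,7) by blast
  ultimately show thesis using that q(1) by blast
qed

text \<open>The placement of \<open>xyP_absurd\<close> and its mirror image fail only if \<open>y\<close>,
  \<open>p1\<close>, \<open>p2\<close> and \<open>x\<close>, \<open>q1\<close>, \<open>q2\<close> are blue
  triangles, so that \<open>P\<close> and \<open>Q\<close> span a complete graph joined to \<open>x\<close> and
  \<open>y\<close>. Putting \<open>q2\<close> on the side of \<open>x\<close> and \<open>y\<close> makes
  \<open>p1\<close>, \<open>p2\<close>, \<open>q1\<close> a blue triangle instead.\<close>

lemma blow_up_2_2_nonadjacent:
  assumes P: "P = {p1, p2}" "p1 \<noteq> p2" and Q: "Q = {q1, q2}" "q1 \<noteq> q2" and M: "4 \<le> card M"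
    and nlx: "\<not> blue_le_1 g r x" and nly: "\<not> blue_le_1 g r y" and nxy: "\<not> g x y"
  shows False
proof -
  interpret sw: pentagon V g r y x Q P M by (rule swapped)
  have pP: "p1 \<in> P" "p2 \<in> P" and qQ: "q1 \<in> Q" "q2 \<in> Q" using P Q by auto
  have nyx: "\<not> g y x" using nxy gsym by blast
  have gx: "g q1 x" "g q2 x" and gy: "g p1 y" "g p2 y"
    using not_low_x_nonadj[OF Q(1) nxy nlx] sw.not_low_x_nonadj[OF P(1) nyx nly] gsym by auto
  have gp: "g p1 p2" and gq: "g q1 q2"
    using xyP_absurd[OF P M nxy] sw.xyP_absurd[OF Q M nyx] by auto
  have bp1: "w = y \<or> w = p2" if "g p1 w" "w \<noteq> x" "w \<notin> Q" for w
    using two_exceptions_eq[OF blue2(3)[OF pP(1)], of y p2 w] gy gp that disj(1,6) disj(8,14,15)[OF pP(2)] by metis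
  have bp2: "w = y \<or> w = p1" if "g p2 w" "w \<noteq> x" "w \<notin> Q" for w
    using two_exceptions_eq[OF blue2(3)[OF pP(2)], of y p1 w] gy gsym[OF gp] that disj(1,6) disj(8,14,15)[OF pP(1)] by metis
  have bq1: "w = x \<or> w = q2" if "g q1 w" "w \<noteq> y" "w \<notin> P" for w
    using two_exceptions_eq[OF blue2(4)[OF qQ(1)], of x q2 w] gx gq that disj(1,2) disj(11,16,17)[OF qQ(2)] by metis
  obtain m where m: "m \<in> M" "\<not> g q2 m" using obtain_nonadjacent_in_M[of q2] qQ M by blast
  have "g q2 m"
  proof (rule split_edges[of "{x, y, q2}"])
    show "{x, y, q2} \<subseteq> V" using inV qQ by blast
    show "\<exists>a b. \<forall>w\<in>{x, y, q2}. g v w \<longrightarrow> w = a \<or> w = b" if "v \<in> {x, y, q2}" for v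
      using that girr by blast
    show "\<exists>a b. \<forall>w\<in>V - {x, y, q2}. g v w \<longrightarrow> w = a \<or> w = b" if v: "v \<in> V - {x, y, q2}" for v
    proof -
      consider "v = p1" | "v = p2" | "v = q1" | "v \<in> M" using v V P(1) Q(1) by blast
      then show ?thesis
      proof cases
        case 1
        have "w = p2 \<or> w = q1" if "w \<in> V - {x, y, q2}" "g p1 w" for w
          using that bp1[of w] Q(1) by blast
        then show ?thesis using 1 by blast
      next
        case 2
        have "w = p1 \<or> w = q1" if "w \<in> V - {x, y, q2}" "g p2 w" for w
          using that bp2[of w] Q(1) by blast
        then show ?thesis using 2 by blast
      next
        case 3
        have "w = p1 \<or> w = p2" if "w \<in> V - {x, y, q2}" "g q1 w" for w
          using that bq1[of w] P(1) by blast
        then show ?thesis using 3 by blast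
      next
        case 4
        then show ?thesis using two_exceptions_mono[OF blue2(5)[OF 4], of "V - {x, y, q2}" "g v"] by simp
      qed
    qed
    show "m \<in> V - {x, y, q2}" using m inV disj_simps disj(10)[OF qQ(2)] by blast
  qed simp
  then show False using m by blast
qed

text \<open>The edge \<open>xy\<close> leaves each of \<open>x\<close> and \<open>y\<close> one more blue edge, to
  \<open>q1\<close> and \<open>p1\<close>. On the side \<open>x, y, p2, q2\<close> the graph is then at most a
  four-cycle.\<close>

lemma blow_up_2_2_adjacent:
  assumes P: "P = {p1, p2}" "p1 \<noteq> p2" and Q: "Q = {q1, q2}" "q1 \<noteq> q2" and M: "4 \<le> card M"
    and xy: "g x y" and xq1: "g x q1" and yp1: "g y p1"
  shows False
proof -
  interpret sw: pentagon V g r y x Q P M by (rule swapped)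
  have pP: "p1 \<in> P" "p2 \<in> P" and qQ: "q1 \<in> Q" "q2 \<in> Q" using P Q by auto
  have yx: "g y x" using xy gsym by blast
  have nxq2: "\<not> g x q2"
    using two_exceptions_eq[OF blue2(1), of y q1 q2] xy xq1 disj(5,7) disj(10,11,17)[OF qQ(1)] disj(10,11,17)[OF qQ(2)] Q(2) by metis
  have nyp2: "\<not> g y p2"
    using two_exceptions_eq[OF blue2(2), of x p1 p2] yx yp1 disj(3,4) disj(8,9,14)[OF pP(1)] disj(8,9,14)[OF pP(2)] P(2) by metis
  obtain m where m: "m \<in> M" "\<not> g p2 m" using obtain_nonadjacent_in_M[of p2] pP M by blast
  have "g p2 m"
  proof (rule split_edges[of "{x, y, p2, q2}"])
    show "{x, y, p2, q2} \<subseteq> V" using inV qQ pP by blast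
    show "\<exists>a b. \<forall>w\<in>{x, y, p2, q2}. g v w \<longrightarrow> w = a \<or> w = b" if v: "v \<in> {x, y, p2, q2}" for v
    proof -
      consider "v = x" | "v = y" | "v = p2" | "v = q2" using v by blast
      then show ?thesis
      proof cases
        case 1 then show ?thesis using nxq2 girr[of x] by blast
      next
        case 2 then show ?thesis using nyp2 girr[of y] by blast
      next
        case 3 then show ?thesis using nyp2 gsym[of p2 y] girr[of p2] by blast
      next
        case 4 then show ?thesis using nxq2 gsym[of q2 x] girr[of q2] by blast
      qed
    qed
    show "\<exists>a b. \<forall>w\<in>V - {x, y, p2, q2}. g v w \<longrightarrow> w = a \<or> w = b" if v: "v \<in> V - {x, y, p2, q2}" for v
    proof -
      consider "v = p1" | "v = q1" | "v \<in> M" using v V P(1) Q(1) by blast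
      then show ?thesis
      proof cases
        case 1
        have "\<exists>d. \<forall>w. g p1 w \<and> w \<noteq> x \<and> w \<notin> Q \<longrightarrow> w = y \<or> w = d"
          using two_exceptions_pick[OF blue2(3)[OF pP(1)], of y] gsym[OF yp1] disj(1,6) by blast
        then obtain d where d: "\<forall>w. g p1 w \<and> w \<noteq> x \<and> w \<notin> Q \<longrightarrow> w = y \<or> w = d" by blast
        have "w = d \<or> w = q1" if "w \<in> V - {x, y, p2, q2}" "g p1 w" for w
          using that d Q(1) by blast
        then show ?thesis using 1 by blast
      next
        case 2
        have "\<exists>d. \<forall>w. g q1 w \<and> w \<noteq> y \<and> w \<notin> P \<longrightarrow> w = x \<or> w = d"
          using two_exceptions_pick[OF blue2(4)[OF qQ(1)], of x] gsym[OF xq1] disj(1,2) by blast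
        then obtain d where d: "\<forall>w. g q1 w \<and> w \<noteq> y \<and> w \<notin> P \<longrightarrow> w = x \<or> w = d" by blast
        have "w = d \<or> w = p1" if "w \<in> V - {x, y, p2, q2}" "g q1 w" for w
          using that d P(1) by blast
        then show ?thesis using 2 by blast
      next
        case 3
        then show ?thesis using two_exceptions_mono[OF blue2(5)[OF 3], of "V - {x, y, p2, q2}" "g v"] by simp
      qed
    qed
    show "m \<in> V - {x, y, p2, q2}" using m inV(5)[OF m(1)] disj_simps(13-16)[of m] disj(10)[OF qQ(2)] disj(9)[OF pP(2)] disj(18,19)[OF m(1)] by blast
  qed simp
  then show False using m by blast
qed

lemma blow_up_2_2_absurd:
  assumes P: "P = {p1, p2}" "p1 \<noteq> p2" and Q: "Q = {q1, q2}" "q1 \<noteq> q2" and M: "4 \<le> card M"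
    and D: "\<And>z. (\<forall>w. g z w \<longrightarrow> r z w) \<or> (\<exists>v\<in>V. v \<noteq> z \<and> blue_le_1 g r v)"
  shows False
proof -
  interpret sw: pentagon V g r y x Q P M by (rule swapped)
  have nlx: "\<not> blue_le_1 g r x" using blow_up_2_2_low_x[OF P Q M _ D] by blast
  have nly: "\<not> blue_le_1 g r y" using sw.blow_up_2_2_low_x[OF Q P M _ D] by blast
  show False
  proof (cases "g x y")
    case False
    then show False using blow_up_2_2_nonadjacent[OF P Q M nlx nly] by blast
  next
    case True
    obtain q where q: "q \<in> Q" "g x q" by (rule not_low_x_adj[OF True nlx])
    obtain p where p: "p \<in> P" "g y p" by (rule sw.not_low_x_adj[OF gsym[OF True] nly])
    obtain q' where q': "Q = {q, q'}" "q \<noteq> q'" using Q q by blast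
    obtain p' where p': "P = {p, p'}" "p \<noteq> p'" using P p by blast
    show False using blow_up_2_2_adjacent[OF p' q' M True q(2) p(2)] .
  qed
qed

text \<open>Here the blue edges of \<open>x\<close> lead to \<open>y\<close> and \<open>q1\<close> only. Moving
  \<open>q1\<close> to the position of \<open>M\<close> frees one of them, which pays for moving \<open>p1\<close>
  to the position of \<open>y\<close>; the price is the blue edge \<open>p2 q1\<close>.\<close>

lemma shift_PQ:
  assumes P: "P = {p1, p2}" "p1 \<noteq> p2" and q1: "q1 \<in> Q" "g x q1"
    and xb: "\<forall>w. g x w \<longrightarrow> w \<notin> P \<longrightarrow> w \<notin> M \<longrightarrow> w = y \<or> w = q1"
    and low2: "blue_le_1 g r p2" and n12: "\<not> g p1 p2" and m: "m \<in> M"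
  shows "g p1 m"
proof -
  have pP: "p1 \<in> P" "p2 \<in> P" using P by auto
  define f where "f w = (if w = x then 0 else if w = y \<or> w = p1 then 3 else if w = p2 then 1
      else if w \<in> Q \<and> w \<noteq> q1 then 2 else (4::nat))" for w
  have fs: "f x = 0" "f y = 3" "f p1 = 3" "f p2 = 1" "w \<in> Q \<Longrightarrow> w \<noteq> q1 \<Longrightarrow> f w = 2" "f q1 = 4" "w \<in> M \<Longrightarrow> f w = 4" for w
    using pP P(2) q1(1) disj_simps disj(8,9)[OF pP(1)] disj(8,9)[OF pP(2)] disj(10)[OF q1(1)] unfolding f_def by auto
  have c: "c5 0 (f w) \<longleftrightarrow> w = p2 \<or> w = q1 \<or> w \<in> M" "c5 1 (f w) \<longleftrightarrow> w = x \<or> w \<in> Q \<and> w \<noteq> q1"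
    "c5 2 (f w) \<longleftrightarrow> w = y \<or> w = p1 \<or> w = p2" "c5 3 (f w) \<longleftrightarrow> w \<in> Q \<or> w \<in> M" "c5 4 (f w) \<longleftrightarrow> w = x \<or> w = y \<or> w = p1"
    if "w \<in> V" for w
  proof -
    have dq: "w \<noteq> x" "w \<noteq> y" "w \<noteq> p1" "w \<noteq> p2" "w \<notin> M" if "w \<in> Q" for w
      using that disj(10,16,17)[OF that] disj(8)[OF pP(1)] disj(8)[OF pP(2)] by auto
    have dm: "w \<noteq> x" "w \<noteq> y" "w \<noteq> p1" "w \<noteq> p2" "w \<noteq> q1" "w \<notin> Q" if "w \<in> M" for w
      using that disj(13,18,19)[OF that] disj(9)[OF pP(1)] disj(9)[OF pP(2)] q1(1) by auto
    note dp = disj(8,9,14,15)[OF pP(1)] disj(8,9,14,15)[OF pP(2)] P(2) not_sym[OF P(2)] dq[OF q1(1)] disj(1-7) q1(1)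
      fs(1-4,6)
    consider "w = x" | "w = y" | "w = p1" | "w = p2" | "w = q1" | "w \<in> Q" "w \<noteq> q1" | "w \<in> M"
      using \<open>w \<in> V\<close> V P(1) by blast
    then have "(c5 0 (f w) \<longleftrightarrow> w = p2 \<or> w = q1 \<or> w \<in> M) \<and> (c5 1 (f w) \<longleftrightarrow> w = x \<or> w \<in> Q \<and> w \<noteq> q1) \<and>
      (c5 2 (f w) \<longleftrightarrow> w = y \<or> w = p1 \<or> w = p2) \<and> (c5 3 (f w) \<longleftrightarrow> w \<in> Q \<or> w \<in> M) \<and>
      (c5 4 (f w) \<longleftrightarrow> w = x \<or> w = y \<or> w = p1)"
    proof cases
      case 6 then show ?thesis using dq[OF 6(1)] by (simp add: fs(5)[OF 6] c5_def)
    next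
      case 7 then show ?thesis using dm[OF 7] by (simp add: fs(7)[OF 7] c5_def)
    qed (use dp in \<open>simp_all add: c5_def\<close>)
    then show "c5 0 (f w) \<longleftrightarrow> w = p2 \<or> w = q1 \<or> w \<in> M" "c5 1 (f w) \<longleftrightarrow> w = x \<or> w \<in> Q \<and> w \<noteq> q1"
      "c5 2 (f w) \<longleftrightarrow> w = y \<or> w = p1 \<or> w = p2" "c5 3 (f w) \<longleftrightarrow> w \<in> Q \<or> w \<in> M" "c5 4 (f w) \<longleftrightarrow> w = x \<or> w = y \<or> w = p1"
      by blast+
  qed
  show ?thesis
  proof (rule fold_complete[of f])
    fix v assume "v \<in> V"
    then consider "v = x" | "v = y" | "v = p1" | "v = p2" | "v = q1" | "v \<in> Q" "v \<noteq> q1" | "v \<in> M" using V P(1) by blast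
    then show "\<exists>a b. \<forall>w\<in>V. g v w \<longrightarrow> \<not> c5 (f v) (f w) \<longrightarrow> w = a \<or> w = b"
    proof cases
      case 1
      have "w = p1 \<or> w = y" if "w \<in> V" "g x w" "w \<noteq> p2" "w \<noteq> q1" "w \<notin> M" for w
        using xb that P(1) by blast
      then show ?thesis using 1 by (simp add: fs c del: One_nat_def) blast
    next
      case 2
      then show ?thesis by (intro two_exceptions_imp[OF blue2(2)]) (auto simp: fs c simp del: One_nat_def)
    next
      case 3
      have "w = x \<or> w = y" if "w \<in> V" "g p1 w" "w \<notin> Q" "w \<notin> M" for w
        using that V n12 girr[of p1] P(1) by blast
      then show ?thesis using 3 by (simp add: fs c del: One_nat_def) blast
    next
      case 4
      then show ?thesis by (intro one_exception_imp[OF low2[unfolded low(3)[OF pP(2)]], where d = q1]) (auto simp: fs c simp del: One_nat_def)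
    next
      case 5
      have "\<exists>d. \<forall>w. g q1 w \<and> w \<noteq> y \<and> w \<notin> P \<longrightarrow> w = x \<or> w = d"
        using two_exceptions_pick[OF blue2(4)[OF q1(1)], of x] gsym[OF q1(2)] disj(1,2) by blast
      then obtain d where d: "\<forall>w. g q1 w \<and> w \<noteq> y \<and> w \<notin> P \<longrightarrow> w = x \<or> w = d" by blast
      have "w = d \<or> w = p2" if "w \<in> V" "g q1 w" "w \<noteq> x" "w \<noteq> y" "w \<noteq> p1" for w
        using that d P(1) by blast
      then show ?thesis using 5 by (simp add: fs c del: One_nat_def) blast
    next
      case 6
      then show ?thesis by (intro two_exceptions_imp[OF blue2(4)[OF 6(1)]]) (auto simp: fs c P(1) simp del: One_nat_def)
    next
      case 7
      then show ?thesis by (intro two_exceptions_imp[OF blue2(5)[OF 7]]) (auto simp: fs c simp del: One_nat_def)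
    qed
  qed (use pP m inV fs in \<open>auto simp: c5_def\<close>)
qed

text \<open>The red edge \<open>st\<close> joins two vertices with spare blue edges. The two shifts rule out every place for
  it except between \<open>P\<close> and \<open>Q\<close>. Since \<open>x\<close> and \<open>y\<close> have no
  spare blue edge, the closure assumption keeps the blue edges of \<open>s\<close> and \<open>t\<close> away from
  them, and \<open>shift_PQ\<close> applies.\<close>

lemma blow_up_2_3_absurd:
  assumes P: "P = {p1, p2}" "p1 \<noteq> p2" and M: "4 \<le> card M"
    and qs: "qa \<in> Q" "qb \<in> Q" "qa \<noteq> qb"
    and st: "r s t" "blue_le_1 g r s" "blue_le_1 g r t"
    and closed: "\<And>z w. z \<in> {s, t} \<Longrightarrow> g z w \<Longrightarrow> \<not> r z w \<Longrightarrow> blue_le_1 g r w"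
  shows False
proof -
  interpret sw: pentagon V g r y x Q P M by (rule swapped)
  have pP: "p1 \<in> P" "p2 \<in> P" using P by auto
  have xP: "\<not> blue_le_1 g r u" if z: "blue_le_1 g r x" and uin: "u \<in> P" for u
  proof
    assume "blue_le_1 g r u"
    then obtain a where "\<forall>w. g u w \<and> w \<noteq> x \<and> w \<notin> Q \<longrightarrow> w = a" using low(3)[OF uin] by blast
    then have "\<forall>w. g u w \<and> (w \<in> P \<or> w = y) \<longrightarrow> w = a" using disj(1,6) disj(8,14) by metis
    then show False using low_x_blocks_P[OF z uin M] by blast
  qed
  have yQ: "\<not> blue_le_1 g r u" if z: "blue_le_1 g r y" and uin: "u \<in> Q" for u
  proof
    assume "blue_le_1 g r u"
    then obtain a where "\<forall>w. g u w \<and> w \<noteq> y \<and> w \<notin> P \<longrightarrow> w = a" using low(4)[OF uin] by blast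
    then have "\<forall>w. g u w \<and> (w \<in> Q \<or> w = x) \<longrightarrow> w = a" using disj(1,2) disj(11,17) by metis
    then show False using sw.low_x_blocks_P[OF z uin M] by blast
  qed
  have xM: "\<not> blue_le_1 g r u" if z: "blue_le_1 g r x" and uin: "u \<in> M" for u
  proof
    assume l: "blue_le_1 g r u"
    then obtain b where b: "\<forall>w. g u w \<and> w \<noteq> x \<and> w \<noteq> y \<longrightarrow> w = b" using low(5)[OF uin] by blast
    have "g u p1" "g u p2" using shift_M[OF uin l z] pP by blast+
    then show False using b P(2) disj(14,15)[OF pP(1)] disj(14,15)[OF pP(2)] by metis
  qed
  have yM: "\<not> blue_le_1 g r u" if z: "blue_le_1 g r y" and uin: "u \<in> M" for u
  proof
    assume l: "blue_le_1 g r u"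
    then obtain b where b: "\<forall>w. g u w \<and> w \<noteq> x \<and> w \<noteq> y \<longrightarrow> w = b" using low(5)[OF uin] by blast
    have "g u qa" "g u qb" using sw.shift_M[OF uin l z] qs by blast+
    then show False using b qs(3) disj(16,17)[OF qs(1)] disj(16,17)[OF qs(2)] by metis
  qed
  obtain p q where pq: "p \<in> P" "q \<in> Q" "blue_le_1 g r p" "blue_le_1 g r q"
    and cl: "\<And>z w. z \<in> {p, q} \<Longrightarrow> g z w \<Longrightarrow> \<not> r z w \<Longrightarrow> blue_le_1 g r w"
  proof -
    have "s \<in> V" using criticalD(2)[OF crit st(1)] gV by blast
    then consider "s = x" | "s = y" | "s \<in> P" | "s \<in> Q" | "s \<in> M" using V by blast
    then show thesis
    proof cases
      case 1
      then have "t \<in> P \<or> t \<in> M" using st(1) red(1) by blast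
      then show thesis using 1 st xP xM by blast
    next
      case 2
      then have "t \<in> Q \<or> t \<in> M" using st(1) red(2) by blast
      then show thesis using 2 st yQ yM by blast
    next
      case 3
      then have "t = x \<or> t \<in> Q" using st(1) red(3) by blast
      then have "t \<in> Q" using 3 st xP by blast
      then show thesis using that[of s t] 3 st closed by blast
    next
      case 4
      then have "t = y \<or> t \<in> P" using st(1) red(4) by blast
      then have "t \<in> P" using 4 st yQ by blast
      then show thesis using that[of t s] 4 st closed by blast
    next
      case 5
      then have "t = x \<or> t = y" using st(1) red(5) by blast
      then show thesis using 5 st xM yM by blast
    qed
  qed
  have nlx: "\<not> blue_le_1 g r x" using xP pq by blast
  have nly: "\<not> blue_le_1 g r y" using yQ pq by blast
  obtain p' where p': "P = {p', p}" "p' \<noteq> p" using P pq(1) by blast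
  then have p'P: "p' \<in> P" by blast
  have npy: "\<not> g y p"
  proof
    assume "g y p"
    then have "g p y" using gsym by blast
    moreover have "\<not> r p y" using red(3)[OF pq(1), of y] disj(1,6) by simp
    ultimately show False using cl nly by blast
  qed
  have xy: "g x y"
  proof (rule ccontr)
    assume "\<not> g x y"
    then have "\<not> g y x" using gsym by blast
    then show False using sw.not_low_x_nonadj[OF p'(1) _ nly] npy by blast
  qed
  have yp': "g y p'"
  proof -
    obtain p'' where "p'' \<in> P" "g y p''" by (rule sw.not_low_x_adj[OF gsym[OF xy] nly])
    then show ?thesis using p' npy by blast
  qed
  obtain q1 where q1: "q1 \<in> Q" "g x q1" "\<forall>w. g x w \<longrightarrow> w \<notin> P \<longrightarrow> w \<notin> M \<longrightarrow> w = y \<or> w = q1"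
    by (rule not_low_x_adj[OF xy nlx])
  have "\<not> g p' p"
  proof
    assume pp: "g p' p"
    have "\<not> r p p'" using red(3)[OF pq(1), of p'] disj(8,14)[OF p'P] by simp
    then have "blue_le_1 g r p'" using cl[of p p'] gsym[OF pp] by blast
    then obtain b where "\<forall>w. g p' w \<and> w \<noteq> x \<and> w \<notin> Q \<longrightarrow> w = b" using low(3)[OF p'P] by blast
    then show False using pp gsym[OF yp'] disj(8,14,15)[OF pq(1)] disj(1,6) by metis
  qed
  then have "g p' m" if "m \<in> M" for m
    using shift_PQ[OF p' q1 pq(3) _ that] by blast
  then show False using obtain_nonadjacent_in_M[of p'] p'P M by blast
qed

end

section \<open>Counting edges in a tripartite graph\<close>

lemma mult_ge_add: "1 \<le> a \<Longrightarrow> 1 \<le> b \<Longrightarrow> a + b \<le> a * b + (1::nat)"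
  by (cases a; cases b) auto

definition ecount :: "('a \<Rightarrow> 'a \<Rightarrow> bool) \<Rightarrow> 'a set \<Rightarrow> 'a set \<Rightarrow> nat" where
  "ecount h X Y = (\<Sum>u\<in>X. card {w\<in>Y. h u w})"

lemma ecount_pairs:
  assumes "finite X" "finite Y"
  shows "ecount h X Y = card {(u, w). u \<in> X \<and> w \<in> Y \<and> h u w}"
proof -
  have "{(u, w). u \<in> X \<and> w \<in> Y \<and> h u w} = (SIGMA u:X. {w\<in>Y. h u w})" by auto
  then show ?thesis unfolding ecount_def using assms by (simp add: card_SigmaI)
qed

lemma ecount_sym:
  assumes "finite X" "finite Y" "\<And>u w. h u w \<Longrightarrow> h w u"
  shows "ecount h X Y = ecount h Y X"
proof -
  have "bij_betw prod.swap {(u, w). u \<in> X \<and> w \<in> Y \<and> h u w} {(u, w). u \<in> Y \<and> w \<in> X \<and> h u w}"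
    using assms(3) by (auto simp: bij_betw_def inj_on_def image_iff)
  then show ?thesis unfolding ecount_pairs[OF assms(1,2)] ecount_pairs[OF assms(2,1)] by (rule bij_betw_same_card)
qed

lemma ecount_ge:
  assumes "finite X" "finite Y" "A \<subseteq> {(u, w). u \<in> X \<and> w \<in> Y \<and> h u w}"
  shows "card A \<le> ecount h X Y"
proof -
  have "finite {(u, w). u \<in> X \<and> w \<in> Y \<and> h u w}"
    by (rule finite_subset[of _ "X \<times> Y"]) (use assms in auto)
  then show ?thesis unfolding ecount_pairs[OF assms(1,2)] using assms(3) by (rule card_mono)
qed

text \<open>This is what remains around a vertex of degree three in a maximal triangle-free graph. The classes
  \<open>C1\<close>, \<open>C2\<close>, \<open>C3\<close> consist of the vertices adjacent to exactly one of the
  three neighbours, \<open>b1\<close> counts those adjacent to the second and the third neighbour only, which are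
  adjacent to all of \<open>C1\<close>, and \<open>k\<close> counts those adjacent to all three neighbours.\<close>

locale tripartite =
  fixes C1 C2 C3 :: "'a set" and h :: "'a \<Rightarrow> 'a \<Rightarrow> bool" and b1 b2 b3 k :: nat
  assumes fin: "finite C1" "finite C2" "finite C3"
    and disj: "C1 \<inter> C2 = {}" "C1 \<inter> C3 = {}" "C2 \<inter> C3 = {}"
    and hsym: "h u w \<Longrightarrow> h w u"
    and tri: "h u v \<Longrightarrow> h v w \<Longrightarrow> \<not> h u w"
    and dist12: "u \<in> C1 \<Longrightarrow> v \<in> C2 \<Longrightarrow> \<not> h u v \<Longrightarrow> \<exists>w\<in>C3. h u w \<and> h v w"
    and dist13: "u \<in> C1 \<Longrightarrow> v \<in> C3 \<Longrightarrow> \<not> h u v \<Longrightarrow> \<exists>w\<in>C2. h u w \<and> h v w"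
    and dist23: "u \<in> C2 \<Longrightarrow> v \<in> C3 \<Longrightarrow> \<not> h u v \<Longrightarrow> \<exists>w\<in>C1. h u w \<and> h v w"
    and nbr1: "b1 = 0 \<Longrightarrow> u \<in> C1 \<Longrightarrow> (\<exists>w\<in>C2. h u w) \<and> (\<exists>w\<in>C3. h u w)"
    and nbr2: "b2 = 0 \<Longrightarrow> u \<in> C2 \<Longrightarrow> (\<exists>w\<in>C1. h u w) \<and> (\<exists>w\<in>C3. h u w)"
    and nbr3: "b3 = 0 \<Longrightarrow> u \<in> C3 \<Longrightarrow> (\<exists>w\<in>C1. h u w) \<and> (\<exists>w\<in>C2. h u w)"
    and ne: "0 < b1 \<Longrightarrow> C1 \<noteq> {}" "0 < b2 \<Longrightarrow> C2 \<noteq> {}" "0 < b3 \<Longrightarrow> C3 \<noteq> {}"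
    and deg1: "u \<in> C1 \<Longrightarrow> 2 \<le> b1 + card {w\<in>C2. h u w} + card {w\<in>C3. h u w}"
    and deg2: "u \<in> C2 \<Longrightarrow> 2 \<le> b2 + card {w\<in>C1. h u w} + card {w\<in>C3. h u w}"
    and deg3: "u \<in> C3 \<Longrightarrow> 2 \<le> b3 + card {w\<in>C1. h u w} + card {w\<in>C2. h u w}"
    and size: "9 \<le> k + b1 + b2 + b3 + card C1 + card C2 + card C3"
begin

lemma dist_sym:
  "u \<in> C2 \<Longrightarrow> v \<in> C1 \<Longrightarrow> \<not> h u v \<Longrightarrow> \<exists>w\<in>C3. h u w \<and> h v w"
  "u \<in> C3 \<Longrightarrow> v \<in> C1 \<Longrightarrow> \<not> h u v \<Longrightarrow> \<exists>w\<in>C2. h u w \<and> h v w"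
  "u \<in> C3 \<Longrightarrow> v \<in> C2 \<Longrightarrow> \<not> h u v \<Longrightarrow> \<exists>w\<in>C1. h u w \<and> h v w"
  using dist12[of v u] dist13[of v u] dist23[of v u] hsym[of v u] by blast+

lemma swap: "tripartite C1 C3 C2 h b1 b3 b2 k"
proof unfold_locales
  show "C3 \<inter> C2 = {}" using disj by blast
  show "\<exists>w\<in>C2. h u w \<and> h v w" if "u \<in> C1" "v \<in> C3" "\<not> h u v" for u v using dist13 that .
  show "\<exists>w\<in>C3. h u w \<and> h v w" if "u \<in> C1" "v \<in> C2" "\<not> h u v" for u v using dist12 that .
  show "\<exists>w\<in>C1. h u w \<and> h v w" if "u \<in> C3" "v \<in> C2" "\<not> h u v" for u v using dist_sym(3) that .
  show "(\<exists>w\<in>C3. h u w) \<and> (\<exists>w\<in>C2. h u w)" if "b1 = 0" "u \<in> C1" for u using nbr1[OF that] by blast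
  show "(\<exists>w\<in>C1. h u w) \<and> (\<exists>w\<in>C2. h u w)" if "b3 = 0" "u \<in> C3" for u using nbr3[OF that] .
  show "(\<exists>w\<in>C1. h u w) \<and> (\<exists>w\<in>C3. h u w)" if "b2 = 0" "u \<in> C2" for u using nbr2[OF that] .
  show "2 \<le> b1 + card {w\<in>C3. h u w} + card {w\<in>C2. h u w}" if "u \<in> C1" for u using deg1[OF that] by linarith
  show "2 \<le> b3 + card {w\<in>C1. h u w} + card {w\<in>C2. h u w}" if "u \<in> C3" for u using deg3[OF that] .
  show "2 \<le> b2 + card {w\<in>C1. h u w} + card {w\<in>C3. h u w}" if "u \<in> C2" for u using deg2[OF that] .
  show "9 \<le> k + b1 + b3 + b2 + card C1 + card C3 + card C2" using size by linarith
qed (fact fin disj(1,2) hsym tri ne)+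

lemma rot: "tripartite C2 C3 C1 h b2 b3 b1 k"
proof unfold_locales
  show "C2 \<inter> C1 = {}" "C3 \<inter> C1 = {}" using disj by blast+
  show "\<exists>w\<in>C1. h u w \<and> h v w" if "u \<in> C2" "v \<in> C3" "\<not> h u v" for u v using dist23 that .
  show "\<exists>w\<in>C3. h u w \<and> h v w" if "u \<in> C2" "v \<in> C1" "\<not> h u v" for u v using dist_sym(1) that .
  show "\<exists>w\<in>C2. h u w \<and> h v w" if "u \<in> C3" "v \<in> C1" "\<not> h u v" for u v using dist_sym(2) that .
  show "(\<exists>w\<in>C3. h u w) \<and> (\<exists>w\<in>C1. h u w)" if "b2 = 0" "u \<in> C2" for u using nbr2[OF that] by blast
  show "(\<exists>w\<in>C2. h u w) \<and> (\<exists>w\<in>C1. h u w)" if "b3 = 0" "u \<in> C3" for u using nbr3[OF that] by blast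
  show "(\<exists>w\<in>C2. h u w) \<and> (\<exists>w\<in>C3. h u w)" if "b1 = 0" "u \<in> C1" for u using nbr1[OF that] .
  show "2 \<le> b2 + card {w\<in>C3. h u w} + card {w\<in>C1. h u w}" if "u \<in> C2" for u using deg2[OF that] by linarith
  show "2 \<le> b3 + card {w\<in>C2. h u w} + card {w\<in>C1. h u w}" if "u \<in> C3" for u using deg3[OF that] by linarith
  show "2 \<le> b1 + card {w\<in>C2. h u w} + card {w\<in>C3. h u w}" if "u \<in> C1" for u using deg1[OF that] .
  show "9 \<le> k + b2 + b3 + b1 + card C2 + card C3 + card C1" using size by linarith
qed (fact fin disj hsym tri ne)+

text \<open>The inequality \<open>bound\<close> is the one that gives a degree sum of at least four times the number of
  vertices, minus four.\<close>

definition E where "E = ecount h C1 C2 + ecount h C1 C3 + ecount h C2 C3"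
definition bound :: bool where
  "bound \<longleftrightarrow> card C1 + card C2 + card C3 + 3 \<le> E + k + b1 * card C1 + b2 * card C2 + b3 * card C3"

lemma bound_swap: "tripartite.bound C1 C3 C2 h b1 b3 b2 k \<longleftrightarrow> bound"
  using ecount_sym[of C3 C2 h] fin hsym
  unfolding bound_def tripartite.bound_def[OF swap] E_def tripartite.E_def[OF swap] by (simp add: add_ac)

lemma bound_rot: "tripartite.bound C2 C3 C1 h b2 b3 b1 k \<longleftrightarrow> bound"
  using ecount_sym[of C3 C1 h] ecount_sym[of C2 C1 h] fin hsym
  unfolding bound_def tripartite.bound_def[OF rot] E_def tripartite.E_def[OF rot] by (simp add: add_ac)

lemma card_pos: "u \<in> C1 \<Longrightarrow> 1 \<le> card C1" "u \<in> C2 \<Longrightarrow> 1 \<le> card C2" "u \<in> C3 \<Longrightarrow> 1 \<le> card C3"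
  using fin by (auto simp: Suc_le_eq card_gt_0_iff)

text \<open>With two empty classes, all degrees in \<open>C2\<close> come from \<open>b2\<close>, so
  \<open>b2 \<ge> 2\<close> and the product \<open>b2 |C2|\<close> outweighs the sum.\<close>

lemma bound_one_empty_aux:
  assumes "C1 = {}" "C3 = {}"
  shows bound
proof (cases "C2 = {}")
  case True
  then have "b1 = 0" "b2 = 0" "b3 = 0" using ne assms by auto
  then show ?thesis using size assms True unfolding bound_def by simp
next
  case False
  then obtain u where u: "u \<in> C2" by blast
  have "b1 = 0" "b3 = 0" using ne assms by auto
  moreover have "2 \<le> b2" using deg2[OF u] assms by simp
  moreover have "1 \<le> card C2" using card_pos u by blast
  moreover have "(b2 - 1) + card C2 \<le> (b2 - 1) * card C2 + 1"
    using mult_ge_add[of "b2 - 1" "card C2"] calculation by simp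
  moreover have "b2 * card C2 = (b2 - 1) * card C2 + card C2" using \<open>2 \<le> b2\<close> by (cases b2) auto
  ultimately show ?thesis using size assms unfolding bound_def by simp
qed

text \<open>The two remaining classes are joined completely, since \<open>C1\<close> offers no common neighbours.\<close>

lemma bound_one_empty:
  assumes C1: "C1 = {}"
  shows bound
proof -
  consider "C3 = {}" | "C2 = {}" | "C2 \<noteq> {}" "C3 \<noteq> {}" by blast
  then show ?thesis
  proof cases
    case 1 then show ?thesis using bound_one_empty_aux C1 by blast
  next
    case 2 then show ?thesis using tripartite.bound_one_empty_aux[OF swap] C1 bound_swap by blast
  next
    case 3
    then obtain u v where uv: "u \<in> C2" "v \<in> C3" by blast
    have "C2 \<times> C3 \<subseteq> {(u, w). u \<in> C2 \<and> w \<in> C3 \<and> h u w}" using dist23 C1 by blast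
    then have "card (C2 \<times> C3) \<le> ecount h C2 C3" using ecount_ge fin by blast
    then have 1: "card C2 * card C3 \<le> E" unfolding E_def by (simp add: card_cartesian_product)
    have b: "b1 = 0" "1 \<le> b2" "1 \<le> b3" using ne(1) nbr2[OF _ uv(1)] nbr3[OF _ uv(2)] C1 by fastforce+
    have c: "1 \<le> card C2" "1 \<le> card C3" using card_pos uv by blast+
    show ?thesis
      using 1 b c size C1 mult_ge_add[OF c] mult_ge_add[OF b(2) c(1)] mult_ge_add[OF b(3) c(2)]
      unfolding bound_def by simp
  qed
qed

text \<open>A vertex \<open>z\<close> that is a class of its own splits both other classes into neighbours and
  non-neighbours of \<open>z\<close>. As only \<open>z\<close> can be a common neighbour of the two classes, all
  their pairs except those between neighbours of \<open>z\<close> are edges.\<close>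

lemma bound_single:
  assumes C1: "C1 = {z}" and ne2: "C2 \<noteq> {}" and ne3: "C3 \<noteq> {}"
  shows bound
proof -
  define Y where "Y = {w\<in>C2. h z w}"
  define Y' where "Y' = C2 - Y"
  define Z where "Z = {w\<in>C3. h z w}"
  define Z' where "Z' = C3 - Z"
  have fins: "finite Y" "finite Y'" "finite Z" "finite Z'" unfolding Y_def Y'_def Z_def Z'_def using fin by auto
  have c2: "card C2 = card Y + card Y'" and c3: "card C3 = card Z + card Z'"
    unfolding Y'_def Z'_def using card_Diff_subset[of Y C2] card_Diff_subset[of Z C3] card_mono[of C2 Y] card_mono[of C3 Z] fin fins
    by (auto simp: Y_def Z_def)
  have e1: "ecount h C1 C2 = card Y" "ecount h C1 C3 = card Z"
    unfolding ecount_def C1 Y_def Z_def by simp_all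
  have "C2 \<times> C3 - Y \<times> Z \<subseteq> {(u, w). u \<in> C2 \<and> w \<in> C3 \<and> h u w}"
    using dist23 C1 hsym unfolding Y_def Z_def by blast
  then have "card (C2 \<times> C3 - Y \<times> Z) \<le> ecount h C2 C3" by (rule ecount_ge[OF fin(2,3)])
  moreover have "card (C2 \<times> C3 - Y \<times> Z) = card C2 * card C3 - card Y * card Z"
    by (subst card_Diff_subset) (use fins in \<open>auto simp: card_cartesian_product Y_def Z_def\<close>)
  ultimately have e2: "card Y * card Z' + card Y' * card Z + card Y' * card Z' \<le> ecount h C2 C3"
    unfolding c2 c3 by (simp add: algebra_simps)
  have E: "card Y + card Z + card Y * card Z' + card Y' * card Z + card Y' * card Z' \<le> E"
    using e1 e2 unfolding E_def by simp
  have Y': "1 \<le> card Z" "1 \<le> b2" if nonempty: "Y' \<noteq> {}"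
  proof -
    obtain u where u: "u \<in> C2" "\<not> h z u" using nonempty unfolding Y'_def Y_def by blast
    then obtain w where "w \<in> C3" "h z w" using dist12[of z u] C1 by blast
    then have "w \<in> Z" unfolding Z_def by blast
    then show "1 \<le> card Z" using fins by (auto simp: Suc_le_eq card_gt_0_iff)
    show "1 \<le> b2" using nbr2[OF _ u(1)] u(2) C1 hsym by fastforce
  qed
  have Z': "1 \<le> card Y" "1 \<le> b3" if nonempty: "Z' \<noteq> {}"
  proof -
    obtain u where u: "u \<in> C3" "\<not> h z u" using nonempty unfolding Z'_def Z_def by blast
    then obtain w where "w \<in> C2" "h z w" using dist13[of z u] C1 by blast
    then have "w \<in> Y" unfolding Y_def by blast
    then show "1 \<le> card Y" using fins by (auto simp: Suc_le_eq card_gt_0_iff)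
    show "1 \<le> b3" using nbr3[OF _ u(1)] u(2) C1 hsym by fastforce
  qed
  have pos: "1 \<le> card Y'" if "Y' \<noteq> {}" using that fins by (auto simp: Suc_le_eq card_gt_0_iff)
  have pos': "1 \<le> card Z'" if "Z' \<noteq> {}" using that fins by (auto simp: Suc_le_eq card_gt_0_iff)
  have c: "1 \<le> card C2" "1 \<le> card C3" using ne2 ne3 card_pos by blast+
  have b2c: "b2 + card C2 \<le> b2 * card C2 + 1" if "1 \<le> b2" using mult_ge_add[OF that c(1)] .
  have b3c: "b3 + card C3 \<le> b3 * card C3 + 1" if "1 \<le> b3" using mult_ge_add[OF that c(2)] .
  have b3w: "b3 \<le> b3 * card C3" and b2w: "b2 \<le> b2 * card C2" using c by auto
  have cC1: "card C1 = 1" "b1 * card C1 = b1" using C1 by simp_all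
  show ?thesis
  proof (cases "Y' = {}"; cases "Z' = {}")
    assume yz: "Y' = {}" "Z' = {}"
    then have all: "h z u" if "u \<in> C2 \<union> C3" for u using that unfolding Y'_def Y_def Z'_def Z_def by blast
    then have no: "\<not> h u w" if "u \<in> C2" "w \<in> C3" for u w using that tri[of z u w] by blast
    have "1 \<le> b2" using ne2 nbr2 no by fastforce
    moreover have "1 \<le> b3" using ne3 nbr3 no hsym by (metis One_nat_def Suc_leI equals0I gr0I)
    ultimately show bound using E b2c b3c yz size c2 c3 cC1 unfolding bound_def by simp
  next
    assume yz: "Y' \<noteq> {}" "Z' = {}"
    have "card Z' = 0" "card Y + card Z + card Y' * card Z \<le> E" using E yz(2) by simp_all
    then show bound using b2c[OF Y'(2)[OF yz(1)]] b3w mult_ge_add[OF pos[OF yz(1)] Y'(1)[OF yz(1)]] pos[OF yz(1)] size c2 c3 cC1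
      unfolding bound_def by linarith
  next
    assume yz: "Y' = {}" "Z' \<noteq> {}"
    have "card Y' = 0" "card Y + card Z + card Y * card Z' \<le> E" using E yz(1) by simp_all
    then show bound using b3c[OF Z'(2)[OF yz(2)]] b2w mult_ge_add[OF Z'(1)[OF yz(2)] pos'[OF yz(2)]] pos'[OF yz(2)] size c2 c3 cC1
      unfolding bound_def by linarith
  next
    assume yz: "Y' \<noteq> {}" "Z' \<noteq> {}"
    note Y' = Y'[OF yz(1)] and Z' = Z'[OF yz(2)] and pos = pos[OF yz(1)] and pos' = pos'[OF yz(2)]
    show bound using E b3c[OF Z'(2)] b2c[OF Y'(2)] mult_ge_add[OF Z'(1) pos'] mult_ge_add[OF pos Y'(1)] mult_ge_add[OF pos pos'] pos pos' size c2 c3 cC1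
      unfolding bound_def by linarith
  qed
qed

text \<open>A vertex without neighbours in one of the other classes is adjacent to the whole of the other one, because a
  common neighbour would have to lie in the class that it misses.\<close>

lemma two_nbrs:
  assumes "2 \<le> card C2" "2 \<le> card C3" "u \<in> C1"
  shows "2 \<le> card {w\<in>C2. h u w} + card {w\<in>C3. h u w}"
proof -
  have 1: "{w\<in>C2. h u w} = C2" if "{w\<in>C3. h u w} = {}" using dist12[OF assms(3)] that by blast
  have 2: "{w\<in>C3. h u w} = C3" if "{w\<in>C2. h u w} = {}" using dist13[OF assms(3)] that by blast
  have 3: "1 \<le> card {w\<in>X. h u w}" if "{w\<in>X. h u w} \<noteq> {}" "finite X" for X
    using that by (auto simp: Suc_le_eq card_gt_0_iff)
  show ?thesis using 1 2 3[OF _ fin(2)] 3[OF _ fin(3)] assms(1,2) by fastforce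
qed

lemma ecount_two:
  assumes "2 \<le> card C2" "2 \<le> card C3"
  shows "2 * card C1 \<le> ecount h C1 C2 + ecount h C1 C3"
proof -
  have "card C1 * 2 \<le> (\<Sum>u\<in>C1. card {w\<in>C2. h u w} + card {w\<in>C3. h u w})"
    using sum_bounded_below[of C1 2 "\<lambda>u. card {w\<in>C2. h u w} + card {w\<in>C3. h u w}"] two_nbrs[OF assms] by simp
  then show ?thesis unfolding ecount_def by (simp add: sum.distrib)
qed

lemma ecounts_sym: "ecount h C2 C1 = ecount h C1 C2" "ecount h C3 C1 = ecount h C1 C3" "ecount h C3 C2 = ecount h C2 C3"
  using ecount_sym[of C2 C1 h] ecount_sym[of C3 C1 h] ecount_sym[of C3 C2 h] fin hsym by blast+

lemma E_ge:
  assumes "2 \<le> card C1" "2 \<le> card C2" "2 \<le> card C3"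
  shows "card C1 + card C2 + card C3 \<le> E"
  using ecount_two[OF assms(2,3)] tripartite.ecount_two[OF rot assms(3,1)]
    tripartite.ecount_two[OF tripartite.rot[OF rot] assms(1,2)]
  unfolding E_def ecounts_sym by linarith

text \<open>Every vertex outside \<open>C1\<close> is adjacent to exactly one of \<open>y1\<close> and \<open>y2\<close>: it
  has a neighbour in each class, and if it were adjacent to both, it would form a triangle with one of them and
  any of its neighbours in the third class. Vertices of different classes on different sides are then adjacent.\<close>

lemma bound_pair:
  assumes c1: "card C1 = 2" and b: "b2 = 0" "b3 = 0"
  shows bound
proof -
  obtain y1 y2 where C1: "C1 = {y1, y2}" "y1 \<noteq> y2" using c1 by (auto simp: card_2_iff)
  define N where "N X y = {w\<in>X. h y w}" for X y
  have fN: "finite (N C2 y)" "finite (N C3 y)" for y unfolding N_def using fin by auto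
  have e: "ecount h C1 C2 = card (N C2 y1) + card (N C2 y2)" "ecount h C1 C3 = card (N C3 y1) + card (N C3 y2)"
    unfolding ecount_def N_def C1(1) using C1(2) by simp_all
  have cov: "N C2 y1 \<union> N C2 y2 = C2" "N C3 y1 \<union> N C3 y2 = C3"
    using nbr2[OF b(1)] nbr3[OF b(2)] hsym unfolding N_def C1(1) by blast+
  have dj: "N C2 y1 \<inter> N C2 y2 = {}"
  proof -
    have False if v: "v \<in> C2" "h y1 v" "h y2 v" for v
    proof -
      obtain w where w: "w \<in> C3" "h v w" using nbr2[OF b(1) v(1)] by blast
      have "w \<notin> N C3 y1" "w \<notin> N C3 y2" using tri[of y1 v w] tri[of y2 v w] v w unfolding N_def by blast+
      then show False using cov(2) w(1) by blast
    qed
    then show ?thesis unfolding N_def by blast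
  qed
  have dj3: "N C3 y1 \<inter> N C3 y2 = {}"
  proof -
    have False if v: "v \<in> C3" "h y1 v" "h y2 v" for v
    proof -
      obtain w where w: "w \<in> C2" "h v w" using nbr3[OF b(2) v(1)] by blast
      have "w \<notin> N C2 y1" "w \<notin> N C2 y2" using tri[of y1 v w] tri[of y2 v w] v w unfolding N_def by blast+
      then show False using cov(1) w(1) by blast
    qed
    then show ?thesis unfolding N_def by blast
  qed
  have c: "card C2 = card (N C2 y1) + card (N C2 y2)" "card C3 = card (N C3 y1) + card (N C3 y2)"
    using card_Un_disjoint[OF fN(1) fN(1) dj] card_Un_disjoint[OF fN(2) fN(2) dj3] cov by simp_all
  have cross: "N C2 y \<noteq> {} \<longleftrightarrow> N C3 y' \<noteq> {}" if yy: "{y, y'} = C1" for y y'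
  proof
    assume "N C2 y \<noteq> {}"
    then obtain v where v: "v \<in> C2" "h y v" unfolding N_def by blast
    obtain w where w: "w \<in> C3" "h v w" using nbr2[OF b(1) v(1)] by blast
    have "w \<notin> N C3 y" using tri[of y v w] v w unfolding N_def by blast
    then have "w \<in> N C3 y'" using cov(2) w(1) yy C1(1) by (auto simp: doubleton_eq_iff)
    then show "N C3 y' \<noteq> {}" by blast
  next
    assume "N C3 y' \<noteq> {}"
    then obtain v where v: "v \<in> C3" "h y' v" unfolding N_def by blast
    obtain w where w: "w \<in> C2" "h v w" using nbr3[OF b(2) v(1)] by blast
    have "w \<notin> N C2 y'" using tri[of y' v w] v w unfolding N_def by blast
    then have "w \<in> N C2 y" using cov(1) w(1) yy C1(1) by (auto simp: doubleton_eq_iff)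
    then show "N C2 y \<noteq> {}" by blast
  qed
  have prod: "card (N C2 y) + card (N C3 y') \<le> card (N C2 y) * card (N C3 y') + 1" if yy: "{y, y'} = C1" for y y'
  proof (cases "N C2 y = {}")
    case True then show ?thesis using cross[OF yy] by simp
  next
    case False
    then have "1 \<le> card (N C2 y)" "1 \<le> card (N C3 y')"
      using cross[OF yy] fN by (auto simp: Suc_le_eq card_gt_0_iff)
    then show ?thesis by (rule mult_ge_add)
  qed
  have "N C2 y1 \<times> N C3 y2 \<union> N C2 y2 \<times> N C3 y1 \<subseteq> {(u, w). u \<in> C2 \<and> w \<in> C3 \<and> h u w}"
  proof -
    have "h u w" if u: "u \<in> N C2 y" "u \<notin> N C2 y'" "w \<in> N C3 y'" "w \<notin> N C3 y" and yy: "{y, y'} = C1" for u w y y'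
    proof (rule ccontr)
      assume "\<not> h u w"
      then obtain z where "z \<in> C1" "h u z" "h w z" using dist23[of u w] u unfolding N_def by blast
      then have "u \<in> N C2 z" "w \<in> N C3 z" using u hsym unfolding N_def by blast+
      then show False using u yy \<open>z \<in> C1\<close> by blast
    qed
    note * = this
    have "h u w" if "u \<in> N C2 y1" "w \<in> N C3 y2" for u w
      using *[of u y1 y2 w] that dj dj3 C1(1) by blast
    moreover have "h u w" if "u \<in> N C2 y2" "w \<in> N C3 y1" for u w
      using *[of u y2 y1 w] that dj dj3 C1(1) by blast
    ultimately show ?thesis unfolding N_def by blast
  qed
  then have "card (N C2 y1 \<times> N C3 y2 \<union> N C2 y2 \<times> N C3 y1) \<le> ecount h C2 C3"
    by (rule ecount_ge[OF fin(2,3)])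
  moreover have "card (N C2 y1 \<times> N C3 y2 \<union> N C2 y2 \<times> N C3 y1) = card (N C2 y1) * card (N C3 y2) + card (N C2 y2) * card (N C3 y1)"
    by (subst card_Un_disjoint) (use fN dj in \<open>auto simp: card_cartesian_product\<close>)
  ultimately show ?thesis
    using prod[of y1 y2] prod[of y2 y1] C1(1) size e c c1 b unfolding bound_def E_def by (simp add: insert_commute)
qed

text \<open>Two vertices in different classes are adjacent or have a common neighbour in the third class.\<close>

lemma pair_count:
  "card C1 * card C2 \<le> ecount h C1 C2 + (\<Sum>z\<in>C3. card {w\<in>C1. h z w} * card {w\<in>C2. h z w})"
proof -
  have "C1 \<times> C2 \<subseteq> {(u, w). u \<in> C1 \<and> w \<in> C2 \<and> h u w} \<union> (\<Union>z\<in>C3. {w\<in>C1. h z w} \<times> {w\<in>C2. h z w})"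
  proof (rule subsetI, clarify)
    fix u w assume uw: "u \<in> C1" "w \<in> C2" "(u, w) \<notin> (\<Union>z\<in>C3. {w\<in>C1. h z w} \<times> {w\<in>C2. h z w})"
    show "h u w"
    proof (rule ccontr)
      assume "\<not> h u w"
      then obtain z where z: "z \<in> C3" "h u z" "h w z" using dist12[OF uw(1,2)] by blast
      then show False using uw hsym[OF z(2)] hsym[OF z(3)] by blast
    qed
  qed
  moreover have fin': "finite {(u, w). u \<in> C1 \<and> w \<in> C2 \<and> h u w}"
    by (rule finite_subset[of _ "C1 \<times> C2"]) (use fin in auto)
  ultimately have "card (C1 \<times> C2) \<le> card ({(u, w). u \<in> C1 \<and> w \<in> C2 \<and> h u w} \<union> (\<Union>z\<in>C3. {w\<in>C1. h z w} \<times> {w\<in>C2. h z w}))"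
    using fin by (intro card_mono) auto
  also have "\<dots> \<le> card {(u, w). u \<in> C1 \<and> w \<in> C2 \<and> h u w} + card (\<Union>z\<in>C3. {w\<in>C1. h z w} \<times> {w\<in>C2. h z w})"
    by (rule card_Un_le)
  also have "card (\<Union>z\<in>C3. {w\<in>C1. h z w} \<times> {w\<in>C2. h z w}) \<le> (\<Sum>z\<in>C3. card ({w\<in>C1. h z w} \<times> {w\<in>C2. h z w}))"
    by (rule card_UN_le[OF fin(3)])
  finally show ?thesis unfolding ecount_pairs[OF fin(1,2)] by (simp add: card_cartesian_product)
qed

text \<open>With \<open>t = p + q\<close>, the product is at most \<open>t^2 / 4\<close>, which between
  \<open>t = 2\<close> and \<open>t = 6\<close> lies below its secant \<open>2 t - 3\<close>.\<close>

lemma prod_le: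
  assumes "1 \<le> p" "1 \<le> q" "p + q \<le> (6::nat)"
  shows "p * q + 3 \<le> 2 * (p + q)"
proof -
  have "p \<in> {1, 2, 3, 4, 5}" using assms by auto
  then show ?thesis using assms by auto
qed

text \<open>If \<open>bound\<close> fails, the degrees exceed two by at most four in total, so none is larger than six and
  \<open>prod_le\<close> applies.\<close>

lemma pair_count_weak:
  assumes b: "b1 = 0" "b2 = 0" "b3 = 0" and c: "3 \<le> card C1" "3 \<le> card C2" "3 \<le> card C3" and nb: "\<not> bound"
  shows "card C1 * card C2 + 3 * card C3 \<le> ecount h C1 C2 + 2 * (ecount h C1 C3 + ecount h C2 C3)"
proof -
  let ?p = "\<lambda>z. card {w\<in>C1. h z w}" and ?q = "\<lambda>z. card {w\<in>C2. h z w}"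
  have sum: "(\<Sum>z\<in>C3. ?p z + ?q z) = ecount h C1 C3 + ecount h C2 C3"
    using ecounts_sym(2,3) unfolding ecount_def by (simp add: sum.distrib)
  have one: "1 \<le> ?p z" "1 \<le> ?q z" if "z \<in> C3" for z
    using nbr3[OF b(3) that] fin by (auto simp: Suc_le_eq card_gt_0_iff)
  have six: "?p z + ?q z \<le> 6" if z: "z \<in> C3" for z
  proof -
    have "card (C3 - {z}) * 2 \<le> (\<Sum>z\<in>C3 - {z}. ?p z + ?q z)"
      using sum_bounded_below[of "C3 - {z}" 2 "\<lambda>z. ?p z + ?q z"] one by fastforce
    moreover have "(\<Sum>z\<in>C3. ?p z + ?q z) = ?p z + ?q z + (\<Sum>z\<in>C3 - {z}. ?p z + ?q z)"
      by (rule sum.remove[OF fin(3) z])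
    moreover have "card (C3 - {z}) = card C3 - 1" using z by simp
    ultimately show ?thesis
      using sum ecount_two c tripartite.ecount_two[OF rot] ecounts_sym nb unfolding bound_def E_def by simp
  qed
  have "(\<Sum>z\<in>C3. ?p z * ?q z + 3) \<le> (\<Sum>z\<in>C3. 2 * (?p z + ?q z))"
    by (rule sum_mono, rule prod_le) (use one six in auto)
  then have "(\<Sum>z\<in>C3. ?p z * ?q z) + 3 * card C3 \<le> 2 * (ecount h C1 C3 + ecount h C2 C3)"
    unfolding sum[symmetric] sum_distrib_left by (simp add: sum.distrib)
  then show ?thesis using pair_count by linarith
qed

text \<open>No vertex can be adjacent to all of another class, for a neighbour of it in the third class would then lie in a
  triangle. With classes of three vertices the two partial degrees are thus one or two.\<close>

lemma pair_count_strong: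
  assumes b: "b1 = 0" "b2 = 0" "b3 = 0" and c: "card C1 = 3" "card C2 = 3"
  shows "2 * (card C1 * card C2) + 4 * card C3 \<le> 2 * ecount h C1 C2 + 3 * (ecount h C1 C3 + ecount h C2 C3)"
proof -
  let ?p = "\<lambda>z. card {w\<in>C1. h z w}" and ?q = "\<lambda>z. card {w\<in>C2. h z w}"
  have sum: "(\<Sum>z\<in>C3. ?p z + ?q z) = ecount h C1 C3 + ecount h C2 C3"
    using ecounts_sym(2,3) unfolding ecount_def by (simp add: sum.distrib)
  have one: "1 \<le> ?p z" "1 \<le> ?q z" if "z \<in> C3" for z
    using nbr3[OF b(3) that] fin by (auto simp: Suc_le_eq card_gt_0_iff)
  have "?p z \<le> 2 \<and> ?q z \<le> 2" if z: "z \<in> C3" for z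
  proof -
    obtain v w where vw: "v \<in> C1" "h z v" "w \<in> C2" "h z w" using nbr3[OF b(3) z] by blast
    obtain v' where v': "v' \<in> C2" "h v v'" using nbr1[OF b(1) vw(1)] by blast
    obtain w' where w': "w' \<in> C1" "h w w'" using nbr2[OF b(2) vw(3)] by blast
    have "{u\<in>C1. h z u} \<subset> C1" using tri[OF vw(4) w'(2)] w'(1) by blast
    moreover have "{u\<in>C2. h z u} \<subset> C2" using tri[OF vw(2) v'(2)] v'(1) by blast
    ultimately have "?p z < card C1" "?q z < card C2" using psubset_card_mono fin(1,2) by blast+
    then show ?thesis using c by linarith
  qed
  then have "2 * (?p z * ?q z) + 4 \<le> 3 * (?p z + ?q z)" if "z \<in> C3" for z
  proof -
    have "?p z \<in> {1, 2}" "?q z \<in> {1, 2}" using one[OF that] \<open>\<And>z. z \<in> C3 \<Longrightarrow> ?p z \<le> 2 \<and> ?q z \<le> 2\<close>[OF that] by auto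
    then show ?thesis by auto
  qed
  then have "(\<Sum>z\<in>C3. 2 * (?p z * ?q z) + 4) \<le> (\<Sum>z\<in>C3. 3 * (?p z + ?q z))" by (rule sum_mono)
  then have "2 * (\<Sum>z\<in>C3. ?p z * ?q z) + 4 * card C3 \<le> 3 * (ecount h C1 C3 + ecount h C2 C3)"
    unfolding sum[symmetric] sum_distrib_left by (simp add: sum.distrib)
  then show ?thesis using pair_count by linarith
qed

text \<open>The weak count leaves only three classes of three vertices each and \<open>k = 0\<close>; the strong count
  excludes this.\<close>

lemma bound_big:
  assumes b: "b1 = 0" "b2 = 0" "b3 = 0" and c: "3 \<le> card C1" "3 \<le> card C2" "3 \<le> card C3"
  shows bound
proof (rule ccontr)
  assume nb: "\<not> bound"
  note rr = tripartite.rot[OF rot]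
  have nb': "\<not> tripartite.bound C2 C3 C1 h b2 b3 b1 k" using nb bound_rot by blast
  have nb'': "\<not> tripartite.bound C3 C1 C2 h b3 b1 b2 k" using nb' tripartite.bound_rot[OF rot] by blast
  have w: "card C1 * card C2 + card C2 * card C3 + card C3 * card C1 + 3 * (card C1 + card C2 + card C3) \<le> 5 * E"
    using pair_count_weak[OF b c nb] tripartite.pair_count_weak[OF rot b(2,3,1) c(2,3,1) nb']
      tripartite.pair_count_weak[OF rr b(3,1,2) c(3,1,2) nb''] ecounts_sym unfolding E_def by simp
  obtain t1 t2 t3 where t: "card C1 = 3 + t1" "card C2 = 3 + t2" "card C3 = 3 + t3"
    using c by (metis le_Suc_ex)
  have "27 + 6 * (t1 + t2 + t3) \<le> card C1 * card C2 + card C2 * card C3 + card C3 * card C1"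
    unfolding t by (simp add: algebra_simps)
  moreover have Es: "E + k \<le> 2 + (card C1 + card C2 + card C3)" using nb b unfolding bound_def by simp
  \<comment> \<open>The two estimates of the products of class sizes leave \<open>4 (t1 + t2 + t3) + 5 k \<le> 1\<close>.\<close>
  ultimately have "t1 + t2 + t3 = 0 \<and> k = 0" using w t by simp
  then have c3: "card C1 = 3" "card C2 = 3" "card C3 = 3" using t by simp_all
  have "54 + 36 \<le> 8 * E"
    using pair_count_strong[OF b c3(1,2)] tripartite.pair_count_strong[OF rot b(2,3,1) c3(2,3)]
      tripartite.pair_count_strong[OF rr b(3,1,2) c3(3,1)] ecounts_sym c3 unfolding E_def by simp
  then show False using Es c3 by simp
qed

text \<open>If all classes have at least two vertices, all degrees are at least two, so \<open>bound\<close> can fail only with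
  \<open>b1 |C1| + b2 |C2| + b3 |C3| \<le> 2\<close>. At most one of the three numbers is then nonzero,
  and if one is, its class has two vertices and \<open>bound_pair\<close> applies.\<close>

theorem bound: bound
proof -
  note rr = tripartite.rot[OF rot]
  have R: "tripartite.bound C2 C3 C1 h b2 b3 b1 k \<Longrightarrow> bound" using bound_rot by blast
  have RR: "tripartite.bound C3 C1 C2 h b3 b1 b2 k \<Longrightarrow> bound" using tripartite.bound_rot[OF rot] bound_rot by blast
  consider "C1 = {}" | "C2 = {}" | "C3 = {}" | "C1 \<noteq> {}" "C2 \<noteq> {}" "C3 \<noteq> {}" by blast
  then show ?thesis
  proof cases
    case 1 then show ?thesis by (rule bound_one_empty)
  next
    case 2 then show ?thesis using R tripartite.bound_one_empty[OF rot] by blast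
  next
    case 3 then show ?thesis using RR tripartite.bound_one_empty[OF rr] by blast
  next
    case 4
    have big: "2 \<le> card X" if "X \<noteq> {}" "card X \<noteq> 1" "finite X" for X :: "'a set"
    proof -
      have "card X \<noteq> 0" using that by simp
      then show ?thesis using that(2) by linarith
    qed
    consider "card C1 = 1" | "card C2 = 1" | "card C3 = 1" | "2 \<le> card C1" "2 \<le> card C2" "2 \<le> card C3"
      using big[OF 4(1) _ fin(1)] big[OF 4(2) _ fin(2)] big[OF 4(3) _ fin(3)] by blast
    then show ?thesis
    proof cases
      case 1 then show ?thesis using bound_single 4 by (auto simp: card_1_singleton_iff)
    next
      case 2 then show ?thesis using R tripartite.bound_single[OF rot] 4 by (auto simp: card_1_singleton_iff)
    next
      case 3 then show ?thesis using RR tripartite.bound_single[OF rr] 4 by (auto simp: card_1_singleton_iff)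
    next
      case c: 4
      show ?thesis
      proof (rule ccontr)
        assume nb: "\<not> bound"
        then have le: "b1 * card C1 + b2 * card C2 + b3 * card C3 \<le> 2"
          using E_ge[OF c] unfolding bound_def by linarith
        have m: "2 * b1 \<le> b1 * card C1" "2 * b2 \<le> b2 * card C2" "2 * b3 \<le> b3 * card C3"
          using c by simp_all
        have only: "card C1 \<noteq> 2 \<or> b2 \<noteq> 0 \<or> b3 \<noteq> 0" "card C2 \<noteq> 2 \<or> b3 \<noteq> 0 \<or> b1 \<noteq> 0" "card C3 \<noteq> 2 \<or> b1 \<noteq> 0 \<or> b2 \<noteq> 0"
          using nb bound_pair R tripartite.bound_pair[OF rot] RR tripartite.bound_pair[OF rr] by blast+
        have b1: "b1 = 0"
        proof (rule ccontr)
          assume "b1 \<noteq> 0"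
          then have "b2 = 0" "b3 = 0" "b1 = 1" using le m by linarith+
          then show False using only le c by simp
        qed
        have b2: "b2 = 0"
        proof (rule ccontr)
          assume "b2 \<noteq> 0"
          then have "b1 = 0" "b3 = 0" "b2 = 1" using le m by linarith+
          then show False using only le c by simp
        qed
        have b3: "b3 = 0"
        proof (rule ccontr)
          assume "b3 \<noteq> 0"
          then have "b1 = 0" "b2 = 0" "b3 = 1" using le m by linarith+
          then show False using only le c by simp
        qed
        have "3 \<le> card C1" "3 \<le> card C2" "3 \<le> card C3" using only b1 b2 b3 c by simp_all
        then show False using bound_big b1 b2 b3 nb by blast
      qed
    qed
  qed
qed

end

section \<open>Maximal triangle-free graphs of minimum degree three\<close>

locale saturated =
  fixes V :: "'a set" and r :: "'a \<Rightarrow> 'a \<Rightarrow> bool"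
  assumes finV: "finite V"
    and rV: "r u w \<Longrightarrow> u \<in> V"
    and rsym: "r u w \<Longrightarrow> r w u"
    and rtri: "r u v \<Longrightarrow> r v w \<Longrightarrow> \<not> r u w"
    and diam: "u \<in> V \<Longrightarrow> w \<in> V \<Longrightarrow> u \<noteq> w \<Longrightarrow> \<not> r u w \<Longrightarrow> \<exists>z. r u z \<and> r w z"
begin

lemma irr: "\<not> r u u"
  using rtri by blast

lemma rV2: "r u w \<Longrightarrow> w \<in> V"
  using rV rsym by blast

lemma fin_nbrs: "finite {w. r u w}"
  by (rule finite_subset[OF _ finV]) (use rV2 in blast)

end

locale cubic_vertex = saturated +
  fixes v a b c
  assumes nv: "r v w \<longleftrightarrow> w = a \<or> w = b \<or> w = c"
    and abc: "a \<noteq> b" "a \<noteq> c" "b \<noteq> c"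
    and deg3: "u \<in> V \<Longrightarrow> 3 \<le> card {w. r u w}"
begin

text \<open>The vertices other than \<open>v\<close>, \<open>a\<close>, \<open>b\<close>, \<open>c\<close> are classified by
  their neighbours among \<open>a\<close>, \<open>b\<close>, \<open>c\<close>: only \<open>a\<close> for
  \<open>S\<close>, all but \<open>a\<close> for \<open>D\<close>, all three for \<open>K\<close>. The versions of
  \<open>S\<close> and \<open>D\<close> for \<open>b\<close> and \<open>c\<close> arise by permuting the locale
  parameters.\<close>

definition S where "S = {y\<in>V - {v}. r y a \<and> \<not> r y b \<and> \<not> r y c}"
definition D where "D = {y\<in>V - {v}. \<not> r y a \<and> r y b \<and> r y c}"
definition K where "K = {y\<in>V - {v}. r y a \<and> r y b \<and> r y c}"

lemma rot: "cubic_vertex V r v b c a"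
  by unfold_locales (use nv abc deg3 in auto)

lemma swap: "cubic_vertex V r v a c b"
  by unfold_locales (use nv abc deg3 in auto)

lemma va: "r v a" "r v b" "r v c" "r a v" "r b v" "r c v"
  using nv rsym by blast+

lemma inV: "v \<in> V" "a \<in> V" "b \<in> V" "c \<in> V"
  using va rV by blast+

lemma ab: "\<not> r a b" "\<not> r a c" "\<not> r b c" "\<not> r b a" "\<not> r c a" "\<not> r c b"
  using rtri[OF va(4) va(2)] rtri[OF va(4) va(3)] rtri[OF va(5) va(3)] rtri[OF va(5) va(1)]
    rtri[OF va(6) va(1)] rtri[OF va(6) va(2)] by blast+

lemma va_ne: "v \<noteq> a" "v \<noteq> b" "v \<noteq> c"
  using va irr by metis+

lemma cover: "y \<in> V \<Longrightarrow> y \<noteq> v \<Longrightarrow> y \<noteq> a \<Longrightarrow> y \<noteq> b \<Longrightarrow> y \<noteq> c \<Longrightarrow> r y a \<or> r y b \<or> r y c"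
proof -
  assume y: "y \<in> V" "y \<noteq> v" "y \<noteq> a" "y \<noteq> b" "y \<noteq> c"
  then have "\<not> r y v" using nv[of y] rsym[of y v] by blast
  then obtain z where "r y z" "r v z" using diam[OF y(1) inV(1) y(2)] by blast
  then show "r y a \<or> r y b \<or> r y c" using nv[of z] by blast
qed

lemma cover_nbr: "r y z \<Longrightarrow> y \<noteq> a \<Longrightarrow> y \<noteq> b \<Longrightarrow> y \<noteq> c \<Longrightarrow> z \<noteq> a \<Longrightarrow> z \<noteq> b \<Longrightarrow> z \<noteq> c \<Longrightarrow>
    z \<in> V - {v} \<and> (r z a \<or> r z b \<or> r z c)"
proof -
  assume y: "r y z" "y \<noteq> a" "y \<noteq> b" "y \<noteq> c" and z: "z \<noteq> a" "z \<noteq> b" "z \<noteq> c"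
  have "z \<noteq> v" using nv[of y] rsym[OF y(1)] y by blast
  then show "z \<in> V - {v} \<and> (r z a \<or> r z b \<or> r z c)" using cover[of z] rV2[OF y(1)] z by blast
qed

abbreviation "Sb \<equiv> cubic_vertex.S V r v b c a"
abbreviation "Sc \<equiv> cubic_vertex.S V r v c a b"
abbreviation "Db \<equiv> cubic_vertex.D V r v b c a"
abbreviation "Dc \<equiv> cubic_vertex.D V r v c a b"

lemma SD:
  "y \<in> S \<longleftrightarrow> y \<in> V \<and> y \<noteq> v \<and> r y a \<and> \<not> r y b \<and> \<not> r y c"
  "y \<in> Sb \<longleftrightarrow> y \<in> V \<and> y \<noteq> v \<and> \<not> r y a \<and> r y b \<and> \<not> r y c"
  "y \<in> Sc \<longleftrightarrow> y \<in> V \<and> y \<noteq> v \<and> \<not> r y a \<and> \<not> r y b \<and> r y c"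
  "y \<in> D \<longleftrightarrow> y \<in> V \<and> y \<noteq> v \<and> \<not> r y a \<and> r y b \<and> r y c"
  "y \<in> Db \<longleftrightarrow> y \<in> V \<and> y \<noteq> v \<and> r y a \<and> \<not> r y b \<and> r y c"
  "y \<in> Dc \<longleftrightarrow> y \<in> V \<and> y \<noteq> v \<and> r y a \<and> r y b \<and> \<not> r y c"
  "y \<in> K \<longleftrightarrow> y \<in> V \<and> y \<noteq> v \<and> r y a \<and> r y b \<and> r y c"
  unfolding S_def D_def K_def cubic_vertex.S_def[OF rot] cubic_vertex.S_def[OF cubic_vertex.rot[OF rot]]
    cubic_vertex.D_def[OF rot] cubic_vertex.D_def[OF cubic_vertex.rot[OF rot]] by auto

lemma not_abc:
  "r y a \<or> r y b \<or> r y c \<Longrightarrow> y \<noteq> v \<Longrightarrow> y \<noteq> a \<and> y \<noteq> b \<and> y \<noteq> c"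
  using ab irr by metis

lemma swap_eq: "cubic_vertex.S V r v a c b = S" "cubic_vertex.D V r v a c b = D"
  "cubic_vertex.S V r v b a c = Sb" "cubic_vertex.S V r v c b a = Sc"
  unfolding S_def D_def cubic_vertex.S_def[OF swap] cubic_vertex.D_def[OF swap]
    cubic_vertex.S_def[OF rot] cubic_vertex.S_def[OF cubic_vertex.rot[OF rot]]
    cubic_vertex.S_def[OF cubic_vertex.rot[OF swap]] cubic_vertex.S_def[OF cubic_vertex.swap[OF rot]]
    cubic_vertex.S_def[OF cubic_vertex.rot[OF cubic_vertex.rot[OF swap]]] by auto

text \<open>A common neighbour is adjacent to neither \<open>a\<close> nor \<open>b\<close>, since red has no triangle, but
  it must be adjacent to one of the three.\<close>

lemma common_S:
  assumes u: "u \<in> S" and w: "w \<in> Sb" and n: "\<not> r u w"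
  shows "\<exists>z\<in>Sc. r u z \<and> r w z"
proof -
  have "u \<noteq> w" using u w unfolding SD by blast
  then obtain z where z: "r u z" "r w z" using diam[of u w] n u w unfolding SD by blast
  have za: "\<not> r z a" "\<not> r z b" using rtri[OF z(1)] rtri[OF z(2)] u w unfolding SD by blast+
  have "z \<noteq> a" "z \<noteq> b" "z \<noteq> c" using z u w unfolding SD by blast+
  moreover have "u \<noteq> a" "u \<noteq> b" "u \<noteq> c" using not_abc[of u] u unfolding SD by blast+
  ultimately have "z \<in> V - {v} \<and> (r z a \<or> r z b \<or> r z c)" using cover_nbr[OF z(1)] by blast
  then have "z \<in> Sc" using za unfolding SD by blast
  then show ?thesis using z by blast
qed

text \<open>Look at a common neighbour of \<open>u\<close> and \<open>b\<close>.\<close>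

lemma nbr_S:
  assumes u: "u \<in> S" and e: "D = {}"
  shows "\<exists>z\<in>Sb. r u z"
proof -
  have ub: "u \<noteq> b" using not_abc[of u] u unfolding SD by blast
  then obtain z where z: "r u z" "r b z" using diam[of u b] inV(3) u unfolding SD by blast
  have "z \<noteq> v" using z(1) nv[of u] rsym[of u v] not_abc[of u] u unfolding SD by blast
  moreover have "\<not> r z a" using rtri[OF z(1)] u unfolding SD by blast
  moreover have "z \<in> V" using rV2[OF z(1)] .
  moreover have "r z b" using rsym[OF z(2)] .
  ultimately have "r z c \<Longrightarrow> z \<in> D" "\<not> r z c \<Longrightarrow> z \<in> Sb" unfolding SD by blast+
  then show ?thesis using e z(1) by blast
qed

text \<open>A common neighbour would be adjacent to none of \<open>a\<close>, \<open>b\<close>, \<open>c\<close>.\<close>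

lemma D_S_edge:
  assumes u: "u \<in> D" and w: "w \<in> S"
  shows "r u w"
proof (rule ccontr)
  assume n: "\<not> r u w"
  have "u \<noteq> w" using u w unfolding SD by blast
  then obtain z where z: "r u z" "r w z" using diam[of u w] n u w unfolding SD by blast
  have "\<not> r z a" "\<not> r z b" "\<not> r z c" using rtri[OF z(1)] rtri[OF z(2)] u w unfolding SD by blast+
  moreover have "z \<noteq> a" "z \<noteq> b" "z \<noteq> c" using z u w unfolding SD by blast+
  moreover have "u \<noteq> a" "u \<noteq> b" "u \<noteq> c" using not_abc[of u] u unfolding SD by blast+
  ultimately show False using cover_nbr[OF z(1)] by blast
qed

text \<open>Look at a common neighbour of \<open>a\<close> and a vertex of \<open>D\<close>.\<close>

lemma S_nonempty: "D \<noteq> {} \<Longrightarrow> S \<noteq> {}"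
proof -
  assume "D \<noteq> {}"
  then obtain u where u: "u \<in> D" by blast
  have ua: "u \<noteq> a" using not_abc[of u] u unfolding SD by blast
  then obtain z where z: "r u z" "r a z" using diam[of u a] inV(2) u unfolding SD by blast
  have "z \<noteq> v" using z(1) nv[of u] rsym[of u v] not_abc[of u] u unfolding SD by blast
  moreover have "\<not> r z b" "\<not> r z c" using rtri[OF z(1)] u unfolding SD by blast+
  ultimately have "z \<in> S" using rV2[OF z(1)] rsym[OF z(2)] unfolding SD by blast
  then show ?thesis by blast
qed

lemma nbrs_S:
  assumes u: "u \<in> S"
  shows "{w. r u w} = insert a (D \<union> ({w\<in>Sb. r u w} \<union> {w\<in>Sc. r u w}))"
proof -
  have u': "u \<noteq> a" "u \<noteq> b" "u \<noteq> c" using not_abc[of u] u unfolding SD by blast+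
  have "w = a \<or> w \<in> D \<or> w \<in> Sb \<or> w \<in> Sc" if w: "r u w" for w
  proof -
    have "w \<noteq> b" "w \<noteq> c" "\<not> r w a" using w u rtri[OF w] unfolding SD by blast+
    then show ?thesis using cover_nbr[OF w u'] unfolding SD by blast
  qed
  moreover have "r u w" if "w \<in> D" for w using D_S_edge[OF that u] rsym by blast
  moreover have "r u a" using u unfolding SD by blast
  ultimately show ?thesis by blast
qed

lemma nbrs_D:
  assumes u: "u \<in> D"
  shows "{w. r u w} = insert b (insert c S)"
proof -
  have u': "u \<noteq> a" "u \<noteq> b" "u \<noteq> c" using not_abc[of u] u unfolding SD by blast+
  have "w = b \<or> w = c \<or> w \<in> S" if w: "r u w" for w
  proof -
    have "w \<noteq> a" "\<not> r w b" "\<not> r w c" using w u rtri[OF w] unfolding SD by blast+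
    then show ?thesis using cover_nbr[OF w u'] unfolding SD by blast
  qed
  moreover have "r u w" if "w \<in> S" for w using D_S_edge[OF u that] .
  moreover have "r u b" "r u c" using u unfolding SD by blast+
  ultimately show ?thesis by blast
qed

lemma nbrs_K:
  assumes u: "u \<in> K"
  shows "{w. r u w} = {a, b, c}"
proof -
  have u': "u \<noteq> a" "u \<noteq> b" "u \<noteq> c" using not_abc[of u] u unfolding SD by blast+
  have "w = a \<or> w = b \<or> w = c" if w: "r u w" for w
  proof (rule ccontr)
    assume "\<not> (w = a \<or> w = b \<or> w = c)"
    moreover have "\<not> r w a" "\<not> r w b" "\<not> r w c" using u rtri[OF w] unfolding SD by blast+
    ultimately show False using cover_nbr[OF w u'] by blast
  qed
  moreover have "r u a" "r u b" "r u c" using u unfolding SD by blast+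
  ultimately show ?thesis by blast
qed

lemma nbrs_a: "{w. r a w} = insert v (K \<union> (Db \<union> (Dc \<union> S)))"
proof -
  have "w = v \<or> w \<in> K \<or> w \<in> Db \<or> w \<in> Dc \<or> w \<in> S" if "r a w" for w
    using that rsym[OF that] rV2[OF that] unfolding SD by blast
  moreover have "r a w" if "w = v \<or> w \<in> K \<or> w \<in> Db \<or> w \<in> Dc \<or> w \<in> S" for w
    using that rsym[of w a] va(4) unfolding SD by blast
  ultimately show ?thesis by blast
qed

lemma fins: "finite S" "finite Sb" "finite Sc" "finite D" "finite Db" "finite Dc" "finite K"
proof -
  have "X \<subseteq> V \<Longrightarrow> finite X" for X using finV finite_subset by blast
  moreover have "S \<subseteq> V" "Sb \<subseteq> V" "Sc \<subseteq> V" "D \<subseteq> V" "Db \<subseteq> V" "Dc \<subseteq> V" "K \<subseteq> V"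
    unfolding subset_iff by (simp_all add: SD)
  ultimately show "finite S" "finite Sb" "finite Sc" "finite D" "finite Db" "finite Dc" "finite K" by blast+
qed

lemma disjS:
  "S \<inter> Sb = {}" "S \<inter> Sc = {}" "Sb \<inter> Sc = {}" "D \<inter> S = {}" "D \<inter> Sb = {}" "D \<inter> Sc = {}"
  "D \<inter> Db = {}" "D \<inter> Dc = {}" "Db \<inter> Dc = {}" "Db \<inter> S = {}" "Dc \<inter> S = {}" "K \<inter> S = {}" "K \<inter> D = {}"
  "K \<inter> Db = {}" "K \<inter> Dc = {}"
  unfolding disjoint_iff by (simp_all add: SD)

lemma degS:
  assumes "u \<in> S"
  shows "card {w. r u w} = 1 + card D + (card {w\<in>Sb. r u w} + card {w\<in>Sc. r u w})"
proof -
  have 1: "card ({w\<in>Sb. r u w} \<union> {w\<in>Sc. r u w}) = card {w\<in>Sb. r u w} + card {w\<in>Sc. r u w}"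
    by (rule card_Un_disjoint) (use fins disjS(3) in auto)
  have 2: "card (D \<union> ({w\<in>Sb. r u w} \<union> {w\<in>Sc. r u w})) = card D + card ({w\<in>Sb. r u w} \<union> {w\<in>Sc. r u w})"
    by (rule card_Un_disjoint) (use fins disjS(5,6) in auto)
  have "a \<notin> D \<union> ({w\<in>Sb. r u w} \<union> {w\<in>Sc. r u w})" by (simp add: SD ab irr)
  then show ?thesis unfolding nbrs_S[OF assms] using 1 2 fins by simp
qed

lemma degD:
  assumes "u \<in> D"
  shows "card {w. r u w} = 2 + card S"
proof -
  have "b \<notin> insert c S" "c \<notin> S" by (simp_all add: SD ab irr abc)
  then show ?thesis unfolding nbrs_D[OF assms] using fins by simp
qed

lemma degK: "u \<in> K \<Longrightarrow> card {w. r u w} = 3"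
  unfolding nbrs_K using abc by simp

lemma dega: "card {w. r a w} = 1 + card K + card Db + card Dc + card S"
proof -
  have "v \<notin> K \<union> (Db \<union> (Dc \<union> S))" by (simp add: SD)
  moreover have "card (K \<union> (Db \<union> (Dc \<union> S))) = card K + (card Db + (card Dc + card S))"
    using fins disjS by (simp add: card_Un_disjoint Int_Un_distrib)
  ultimately show ?thesis unfolding nbrs_a using fins by simp
qed

lemma nbr_S2: "u \<in> S \<Longrightarrow> D = {} \<Longrightarrow> \<exists>z\<in>Sc. r u z"
  using cubic_vertex.nbr_S[OF swap] unfolding swap_eq by blast

lemma nbr_Sb_Sc:
  "u \<in> Sb \<Longrightarrow> Db = {} \<Longrightarrow> \<exists>z\<in>S. r u z"
  "u \<in> Sc \<Longrightarrow> Dc = {} \<Longrightarrow> \<exists>z\<in>Sb. r u z"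
  using cubic_vertex.nbr_S2[OF rot] cubic_vertex.nbr_S2[OF cubic_vertex.rot[OF rot]] by blast+

lemma V_split: "V = {v, a, b, c} \<union> (K \<union> (D \<union> (Db \<union> (Dc \<union> (S \<union> (Sb \<union> Sc))))))" (is "V = ?W")
proof
  show "V \<subseteq> ?W"
  proof
    fix y assume "y \<in> V"
    then show "y \<in> ?W" using cover[of y] by (simp add: SD) blast
  qed
  show "?W \<subseteq> V" using inV by (auto simp: SD)
qed

lemma sum_V:
  "sum f V = f v + f a + f b + f c + sum f K + sum f D + sum f Db + sum f Dc + sum f S + sum f Sb + (sum f Sc :: nat)"
proof -
  let ?U1 = "Sb \<union> Sc"
  let ?U2 = "S \<union> ?U1"
  let ?U3 = "Dc \<union> ?U2"
  let ?U4 = "Db \<union> ?U3"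
  let ?U5 = "D \<union> ?U4"
  let ?U6 = "K \<union> ?U5"
  have 1: "sum f ?U1 = sum f Sb + sum f Sc"
    by (rule sum.union_disjoint) (use fins in \<open>auto simp: SD\<close>)
  have 2: "sum f ?U2 = sum f S + sum f ?U1"
    by (rule sum.union_disjoint) (use fins in \<open>auto simp: SD\<close>)
  have 3: "sum f ?U3 = sum f Dc + sum f ?U2"
    by (rule sum.union_disjoint) (use fins in \<open>auto simp: SD\<close>)
  have 4: "sum f ?U4 = sum f Db + sum f ?U3"
    by (rule sum.union_disjoint) (use fins in \<open>auto simp: SD\<close>)
  have 5: "sum f ?U5 = sum f D + sum f ?U4"
    by (rule sum.union_disjoint) (use fins in \<open>auto simp: SD\<close>)
  have 6: "sum f ?U6 = sum f K + sum f ?U5"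
    by (rule sum.union_disjoint) (use fins in \<open>auto simp: SD\<close>)
  have 7: "sum f V = sum f {v, a, b, c} + sum f ?U6"
    by (subst V_split, rule sum.union_disjoint) (use fins in \<open>auto simp: SD ab irr\<close>)
  have "sum f {v, a, b, c} = f v + f a + f b + f c" using va_ne abc by simp
  then show ?thesis using 1 2 3 4 5 6 7 by simp
qed

lemma card_V: "card V = 4 + card K + card D + card Db + card Dc + card S + card Sb + card Sc"
  using sum_V[of "\<lambda>_. 1"] by simp

lemma tripartite_S:
  assumes "13 \<le> card V"
  shows "tripartite S Sb Sc r (card D) (card Db) (card Dc) (card K)"
proof unfold_locales
  note r1 = rot and r2 = cubic_vertex.rot[OF rot]
  show "finite S" "finite Sb" "finite Sc" by (fact fins)+
  show "S \<inter> Sb = {}" "S \<inter> Sc = {}" "Sb \<inter> Sc = {}" by (fact disjS)+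
  show "r w u" if "r u w" for u w using rsym[OF that] .
  show "\<not> r u w" if "r u y" "r y w" for u y w using rtri[OF that] .
  show "\<exists>w\<in>Sc. r u w \<and> r y w" if "u \<in> S" "y \<in> Sb" "\<not> r u y" for u y using common_S[OF that] .
  show "\<exists>w\<in>S. r u w \<and> r y w" if "u \<in> Sb" "y \<in> Sc" "\<not> r u y" for u y using cubic_vertex.common_S[OF r1 that] .
  show "\<exists>w\<in>Sb. r u w \<and> r y w" if "u \<in> S" "y \<in> Sc" "\<not> r u y" for u y
    using cubic_vertex.common_S[OF r2 that(2,1)] that(3) rsym by blast
  show "(\<exists>w\<in>Sb. r u w) \<and> (\<exists>w\<in>Sc. r u w)" if "card D = 0" "u \<in> S" for u
    using nbr_S[OF that(2)] nbr_S2[OF that(2)] that(1) fins by simp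
  show "(\<exists>w\<in>S. r u w) \<and> (\<exists>w\<in>Sc. r u w)" if "card Db = 0" "u \<in> Sb" for u
    using cubic_vertex.nbr_S[OF r1 that(2)] nbr_Sb_Sc(1)[OF that(2)] that(1) fins by simp
  show "(\<exists>w\<in>S. r u w) \<and> (\<exists>w\<in>Sb. r u w)" if "card Dc = 0" "u \<in> Sc" for u
    using cubic_vertex.nbr_S[OF r2 that(2)] nbr_Sb_Sc(2)[OF that(2)] that(1) fins by simp
  show "S \<noteq> {}" if "0 < card D" using that S_nonempty by force
  show "Sb \<noteq> {}" if "0 < card Db" using that cubic_vertex.S_nonempty[OF r1] by force
  show "Sc \<noteq> {}" if "0 < card Dc" using that cubic_vertex.S_nonempty[OF r2] by force
  show "2 \<le> card D + card {w\<in>Sb. r u w} + card {w\<in>Sc. r u w}" if "u \<in> S" for u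
    using degS[OF that] deg3[of u] that SD by simp
  show "2 \<le> card Db + card {w\<in>S. r u w} + card {w\<in>Sc. r u w}" if "u \<in> Sb" for u
    using cubic_vertex.degS[OF r1 that] deg3[of u] that SD by simp
  show "2 \<le> card Dc + card {w\<in>S. r u w} + card {w\<in>Sb. r u w}" if "u \<in> Sc" for u
    using cubic_vertex.degS[OF r2 that] deg3[of u] that SD by simp
  show "9 \<le> card K + card D + card Db + card Dc + card S + card Sb + card Sc"
    using assms card_V by simp
qed

lemma degree_sum:
  assumes "13 \<le> card V"
  shows "4 * card V \<le> (\<Sum>u\<in>V. card {w. r u w}) + 4"
proof -
  note r1 = rot and r2 = cubic_vertex.rot[OF rot]
  interpret t: tripartite S Sb Sc r "card D" "card Db" "card Dc" "card K" by (rule tripartite_S[OF assms])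
  let ?d = "\<lambda>u. card {w. r u w}"
  have dv: "?d v = 3"
  proof -
    have "{w. r v w} = {a, b, c}" using nv by blast
    then show ?thesis using abc by simp
  qed
  have sK: "sum ?d K = 3 * card K" using degK by simp
  have sD: "sum ?d D = 2 * card D + card D * card S" using degD by (simp add: algebra_simps)
  have sDb: "sum ?d Db = 2 * card Db + card Db * card Sb"
    using cubic_vertex.degD[OF r1] by (simp add: algebra_simps)
  have sDc: "sum ?d Dc = 2 * card Dc + card Dc * card Sc"
    using cubic_vertex.degD[OF r2] by (simp add: algebra_simps)
  have sS: "sum ?d S = card S + card D * card S + ecount r S Sb + ecount r S Sc"
  proof -
    have "sum ?d S = (\<Sum>u\<in>S. 1 + card D + (card {w\<in>Sb. r u w} + card {w\<in>Sc. r u w}))"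
      by (rule sum.cong) (simp_all add: degS)
    then show ?thesis unfolding ecount_def by (simp only: sum.distrib sum_constant) (simp add: mult.commute)
  qed
  have sSb: "sum ?d Sb = card Sb + card Db * card Sb + ecount r Sb Sc + ecount r Sb S"
  proof -
    have "sum ?d Sb = (\<Sum>u\<in>Sb. 1 + card Db + (card {w\<in>Sc. r u w} + card {w\<in>S. r u w}))"
      by (rule sum.cong) (simp_all add: cubic_vertex.degS[OF r1])
    then show ?thesis unfolding ecount_def by (simp only: sum.distrib sum_constant) (simp add: mult.commute)
  qed
  have sSc: "sum ?d Sc = card Sc + card Dc * card Sc + ecount r Sc S + ecount r Sc Sb"
  proof -
    have "sum ?d Sc = (\<Sum>u\<in>Sc. 1 + card Dc + (card {w\<in>S. r u w} + card {w\<in>Sb. r u w}))"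
      by (rule sum.cong) (simp_all add: cubic_vertex.degS[OF r2])
    then show ?thesis unfolding ecount_def by (simp only: sum.distrib sum_constant) (simp add: mult.commute)
  qed
  have K: "cubic_vertex.K V r v b c a = K" "cubic_vertex.K V r v c a b = K"
    unfolding K_def cubic_vertex.K_def[OF r1] cubic_vertex.K_def[OF r2] by auto
  have da: "?d a = 1 + card K + card Db + card Dc + card S" by (rule dega)
  have db: "?d b = 1 + card K + card Dc + card D + card Sb" using cubic_vertex.dega[OF r1] unfolding K .
  have dc: "?d c = 1 + card K + card D + card Db + card Sc" using cubic_vertex.dega[OF r2] unfolding K .
  show ?thesis
    using t.bound sum_V[of ?d] dv da db dc sK sD sDb sDc sS sSb sSc card_V t.ecounts_sym
    unfolding t.bound_def t.E_def by linarith
qed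

end

context cocritical begin

section \<open>Blue degrees\<close>

definition blue_deg :: "('a \<Rightarrow> 'a \<Rightarrow> bool) \<Rightarrow> 'a \<Rightarrow> nat" where
  "blue_deg r v = card {w. g v w \<and> \<not> r v w}"

lemma fin_g: "finite {w. g v w \<and> P w}"
  by (rule finite_subset[OF _ fin]) (use gV2 in blast)

lemma blue_deg_le_2: "critical g r \<Longrightarrow> blue_deg r v \<le> 2"
proof -
  assume r: "critical g r"
  obtain a b where "\<forall>w. g v w \<and> \<not> r v w \<longrightarrow> w = a \<or> w = b" using criticalD(4)[OF r, of v] by blast
  then have "{w. g v w \<and> \<not> r v w} \<subseteq> {a, b}" by blast
  then have "blue_deg r v \<le> card {a, b}" unfolding blue_deg_def by (rule card_mono[rotated]) simp
  also have "\<dots> \<le> 2" by (simp add: card_insert_if)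
  finally show ?thesis .
qed

lemma low_iff: "blue_le_1 g r v \<longleftrightarrow> blue_deg r v \<le> 1"
proof -
  have f: "finite {w. g v w \<and> \<not> r v w}" by (rule fin_g)
  have "blue_le_1 g r v \<longleftrightarrow> (\<exists>a. {w. g v w \<and> \<not> r v w} \<subseteq> {a})" unfolding blue_le_1_def by blast
  also have "\<dots> \<longleftrightarrow> blue_deg r v \<le> 1"
  proof
    assume "\<exists>a. {w. g v w \<and> \<not> r v w} \<subseteq> {a}"
    then obtain a where "{w. g v w \<and> \<not> r v w} \<subseteq> {a}" by blast
    then have "card {w. g v w \<and> \<not> r v w} \<le> card {a}" by (intro card_mono) auto
    then show "blue_deg r v \<le> 1" unfolding blue_deg_def by simp
  next
    assume "blue_deg r v \<le> 1"
    then have "card {w. g v w \<and> \<not> r v w} = 0 \<or> card {w. g v w \<and> \<not> r v w} = 1" unfolding blue_deg_def by linarith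
    then show "\<exists>a. {w. g v w \<and> \<not> r v w} \<subseteq> {a}" using f by (auto simp: card_1_singleton_iff)
  qed
  finally show ?thesis .
qed

lemma blue_deg_0: "blue_deg r v = 0 \<longleftrightarrow> (\<forall>w. g v w \<longrightarrow> r v w)"
  unfolding blue_deg_def using fin_g[of v "\<lambda>w. \<not> r v w"] by auto

text \<open>Let \<open>L\<close> be the set of vertices of blue degree at most one, a clique. If \<open>L\<close> has no
  blue edge, then it has at most two vertices. Otherwise let \<open>s1 s2\<close> be a blue edge in
  \<open>L\<close>. All other vertices of \<open>L\<close> are joined to \<open>s1\<close> in red, so they are
  joined to each other in blue, and there are at most two of them. The second part records how equality arises: in
  each of the extremal configurations the blue neighbours of vertices of \<open>L\<close> lie in \<open>L\<close>
  and some edge of \<open>L\<close> is red.\<close>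

lemma deficit:
  assumes r: "critical g r"
  shows "(\<Sum>v\<in>V. 2 - blue_deg r v) \<le> 4"
    and "4 \<le> (\<Sum>v\<in>V. 2 - blue_deg r v) \<Longrightarrow> \<exists>s t. r s t \<and> blue_le_1 g r s \<and> blue_le_1 g r t \<and>
       (\<forall>z w. z \<in> {s, t} \<longrightarrow> g z w \<longrightarrow> \<not> r z w \<longrightarrow> blue_le_1 g r w)"
proof -
  let ?\<delta> = "\<lambda>v. 2 - blue_deg r v"
  define L where "L = {v\<in>V. blue_le_1 g r v}"
  have fL: "finite L" unfolding L_def using fin by simp
  have sum: "(\<Sum>v\<in>V. ?\<delta> v) = sum ?\<delta> L"
    unfolding L_def by (rule sum.mono_neutral_right[OF fin]) (auto simp: low_iff)
  have clique: "g u w" if "u \<in> L" "w \<in> L" "u \<noteq> w" for u w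
    using full[OF r] that unfolding L_def by blast
  have one: "blue_deg r s = 1" if "s \<in> L" "g s t" "\<not> r s t" for s t
  proof -
    have "blue_deg r s \<noteq> 0" using that(2,3) blue_deg_0 by blast
    moreover have "blue_deg r s \<le> 1" using that(1) low_iff unfolding L_def by blast
    ultimately show ?thesis by linarith
  qed
  have uniq: "w = t" if "s \<in> L" "g s t" "\<not> r s t" "g s w" "\<not> r s w" for s t w
    using that unfolding L_def blue_le_1_def by blast
  let ?C = "\<exists>s t. r s t \<and> blue_le_1 g r s \<and> blue_le_1 g r t \<and> (\<forall>z w. z \<in> {s, t} \<longrightarrow> g z w \<longrightarrow> \<not> r z w \<longrightarrow> blue_le_1 g r w)"
  have "sum ?\<delta> L \<le> 4 \<and> (4 \<le> sum ?\<delta> L \<longrightarrow> ?C)"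
  proof (cases "\<exists>s1\<in>L. \<exists>s2\<in>L. g s1 s2 \<and> \<not> r s1 s2")
    case False
    then have red: "r u w" if "u \<in> L" "w \<in> L" "u \<noteq> w" for u w using clique that by blast
    have "\<not> (\<exists>u v w. u \<in> L \<and> v \<in> L \<and> w \<in> L \<and> u \<noteq> v \<and> u \<noteq> w \<and> v \<noteq> w)"
      using red criticalD(3)[OF r] by metis
    then have "\<exists>u w. \<forall>z. z \<in> L \<longrightarrow> z = u \<or> z = w"
      using not_three_iff[of "\<lambda>z. z \<in> L"] by blast
    then obtain s t where st: "L \<subseteq> {s, t}" by blast
    have two: "?\<delta> z \<le> 2" for z by simp
    have "sum ?\<delta> L \<le> sum ?\<delta> {s, t}" by (rule sum_mono2) (use st in auto)
    also have "\<dots> \<le> 4" by (cases "s = t") auto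
    finally have le: "sum ?\<delta> L \<le> 4" .
    moreover have ?C if 4: "4 \<le> sum ?\<delta> L"
    proof -
      have sL: "s \<in> L" "t \<in> L" "s \<noteq> t" "blue_deg r s = 0" "blue_deg r t = 0"
      proof -
        have "L = {s, t} \<and> s \<noteq> t"
        proof (rule ccontr)
          assume "\<not> (L = {s, t} \<and> s \<noteq> t)"
          then have "L = {} \<or> L = {s} \<or> L = {t}" using st by blast
          then show False using 4 by auto
        qed
        then show "s \<in> L" "t \<in> L" "s \<noteq> t" "blue_deg r s = 0" "blue_deg r t = 0" using 4 by auto
      qed
      have "r s t" using red sL by blast
      moreover have "blue_le_1 g r s" "blue_le_1 g r t" using sL unfolding L_def by blast+
      ultimately show ?C using sL(4,5) unfolding blue_deg_0 by blast
    qed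
    ultimately show ?thesis by blast
  next
    case True
    then obtain s1 s2 where s: "s1 \<in> L" "s2 \<in> L" "g s1 s2" "\<not> r s1 s2" by blast
    have s': "g s2 s1" "\<not> r s2 s1" using gsym[OF s(3)] criticalD(1)[OF r] s(4) by blast+
    have ne: "s1 \<noteq> s2" using s(3) girr by blast
    define L' where "L' = L - {s1, s2}"
    have red: "r s1 z" if "z \<in> L'" for z
    proof -
      have "g s1 z" using clique s(1) that unfolding L'_def by blast
      then show ?thesis using uniq[OF s(1,3,4), of z] that unfolding L'_def by blast
    qed
    have blue: "g z w \<and> \<not> r z w" if "z \<in> L'" "w \<in> L'" "z \<noteq> w" for z w
      using clique[of z w] criticalD(3)[OF r red[OF that(1)], of w] red[OF that(2)] that unfolding L'_def by blast
    have sumL: "sum ?\<delta> L = 2 + sum ?\<delta> L'"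
    proof -
      have "L = insert s1 (insert s2 L')" using s unfolding L'_def by blast
      moreover have "finite L'" "s1 \<notin> L'" "s2 \<notin> L'" using fL unfolding L'_def by auto
      ultimately have "sum ?\<delta> L = ?\<delta> s1 + (?\<delta> s2 + sum ?\<delta> L')" using ne by simp
      then show ?thesis using one[OF s(1,3,4)] one[OF s(2) s'] by simp
    qed
    have lows: "blue_le_1 g r z" if "z \<in> L" for z using that unfolding L_def by blast
    have cl1: "blue_le_1 g r w" if "g s1 w" "\<not> r s1 w" for w using uniq[OF s(1,3,4) that] lows s(2) by blast
    have CI: ?C if z: "z \<in> L'" and cl: "\<And>w. g z w \<Longrightarrow> \<not> r z w \<Longrightarrow> blue_le_1 g r w" for z
    proof (intro exI conjI)
      show "r s1 z" using red[OF z] .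
      show "blue_le_1 g r s1" using lows s(1) .
      show "blue_le_1 g r z" using lows z unfolding L'_def by blast
      show "\<forall>y w. y \<in> {s1, z} \<longrightarrow> g y w \<longrightarrow> \<not> r y w \<longrightarrow> blue_le_1 g r w" using cl1 cl by blast
    qed
    consider "L' = {}" | z where "L' = {z}" | z w where "z \<in> L'" "w \<in> L'" "z \<noteq> w" by blast
    then show ?thesis
    proof cases
      case 1 then show ?thesis using sumL by simp
    next
      case 2
      have "?C" if "4 \<le> sum ?\<delta> L"
      proof (rule CI[of z])
        have "blue_deg r z = 0" using that sumL 2 by simp
        then show "blue_le_1 g r w" if "g z w" "\<not> r z w" for w using that unfolding blue_deg_0 by blast
      qed (use 2 in simp)
      moreover have "sum ?\<delta> L \<le> 4" using sumL 2 by simp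
      ultimately show ?thesis by blast
    next
      case 3
      have zL: "z \<in> L" "w \<in> L" using 3 unfolding L'_def by blast+
      have zw: "g z w" "\<not> r z w" using blue[OF 3] by blast+
      have wz: "g w z" "\<not> r w z" using blue[of w z] 3 by blast+
      have "L' = {z, w}"
      proof -
        have "t = w" if "t \<in> L'" "t \<noteq> z" for t
          using uniq[OF zL(1) zw, of t] blue[OF 3(1) that(1)] that(2) by blast
        then show ?thesis using 3 by blast
      qed
      then have "sum ?\<delta> L' = 2" using 3(3) one[OF zL(1) zw] one[OF zL(2) wz] by simp
      moreover have ?C using CI[OF 3(1)] uniq[OF zL(1) zw] lows zL(2) by blast
      ultimately show ?thesis using sumL by simp
    qed
  qed
  then show "(\<Sum>v\<in>V. 2 - blue_deg r v) \<le> 4" "4 \<le> (\<Sum>v\<in>V. 2 - blue_deg r v) \<Longrightarrow> ?C" unfolding sum by blast+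
qed

lemma deficit_2:
  assumes r: "critical g r" and 2: "2 \<le> (\<Sum>v\<in>V. 2 - blue_deg r v)"
  shows "(\<forall>w. g z w \<longrightarrow> r z w) \<or> (\<exists>v\<in>V. v \<noteq> z \<and> blue_le_1 g r v)"
proof (rule ccontr)
  assume n: "\<not> ((\<forall>w. g z w \<longrightarrow> r z w) \<or> (\<exists>v\<in>V. v \<noteq> z \<and> blue_le_1 g r v))"
  have 0: "2 - blue_deg r v = 0" if "v \<in> V - {z}" for v using n that unfolding low_iff by force
  have "blue_deg r z \<noteq> 0" using n blue_deg_0 by blast
  moreover have "(\<Sum>v\<in>V. 2 - blue_deg r v) \<le> 2 - blue_deg r z"
  proof (cases "z \<in> V")
    case True
    then show ?thesis using sum.remove[OF fin True, of "\<lambda>v. 2 - blue_deg r v"] 0 by simp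
  next
    case False
    then show ?thesis using 0 by simp
  qed
  ultimately show False using 2 by linarith
qed

lemma blue_degree_sum:
  assumes "critical g r"
  shows "(\<Sum>v\<in>V. blue_deg r v) + (\<Sum>v\<in>V. 2 - blue_deg r v) = 2 * card V"
proof -
  have "(\<Sum>v\<in>V. blue_deg r v + (2 - blue_deg r v)) = (\<Sum>v\<in>V. 2)"
    by (rule sum.cong) (use blue_deg_le_2[OF assms] in auto)
  then show ?thesis by (simp add: sum.distrib)
qed

lemma degree_split:
  assumes "critical g r"
  shows "(\<Sum>v\<in>V. card {w. g v w}) = (\<Sum>v\<in>V. card {w. r v w}) + (\<Sum>v\<in>V. blue_deg r v)"
proof -
  have "card {w. g v w} = card {w. r v w} + blue_deg r v" for v
  proof -
    have eq: "{w. g v w} = {w. g v w \<and> r v w} \<union> {w. g v w \<and> \<not> r v w}" by blast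
    have un: "card ({w. g v w \<and> r v w} \<union> {w. g v w \<and> \<not> r v w}) = card {w. g v w \<and> r v w} + card {w. g v w \<and> \<not> r v w}"
      by (rule card_Un_disjoint, rule fin_g, rule fin_g) blast
    have "card {w. g v w} = card {w. g v w \<and> r v w} + blue_deg r v"
      unfolding blue_deg_def un[symmetric] by (rule arg_cong[OF eq])
    moreover have "{w. g v w \<and> r v w} = {w. r v w}" using criticalD(2)[OF assms] by blast
    ultimately show ?thesis by simp
  qed
  then show ?thesis by (simp add: sum.distrib)
qed

section \<open>Colourings with the most red edges\<close>

lemma max_red:
  assumes "critical g r0"
  obtains r where "critical g r" "\<And>r'. critical g r' \<Longrightarrow> (\<Sum>v\<in>V. card {w. r' v w}) \<le> (\<Sum>v\<in>V. card {w. r v w})"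
proof -
  have "(\<Sum>v\<in>V. card {w. r v w}) \<le> card V * card V" if r: "critical g r" for r
  proof -
    have "{w. r v w} \<subseteq> V" for v using criticalD(2)[OF r] gV2 by blast
    then have "card {w. r v w} \<le> card V" for v by (rule card_mono[OF fin])
    then show ?thesis using sum_bounded_above[of V "\<lambda>v. card {w. r v w}" "card V"] by simp
  qed
  then have "\<forall>r. critical g r \<longrightarrow> (\<Sum>v\<in>V. card {w. r v w}) < Suc (card V * card V)"
    by (simp add: less_Suc_eq_le)
  from ex_has_greatest_nat[of "critical g" r0 "\<lambda>r. \<Sum>v\<in>V. card {w. r v w}", OF assms this]
  obtain r where A: "critical g r" and B: "\<forall>r'. critical g r' \<longrightarrow> (\<Sum>v\<in>V. card {w. r' v w}) \<le> (\<Sum>v\<in>V. card {w. r v w})"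
    by (elim exE conjE)
  show thesis by (rule that[OF A]) (rule B[rule_format])
qed

text \<open>If two vertices without a red edge between them have no common red neighbour, they are adjacent by
  co-criticality, and their blue edge can be recoloured red.\<close>

lemma max_red_saturated:
  assumes r: "critical g r"
    and max: "\<And>r'. critical g r' \<Longrightarrow> (\<Sum>v\<in>V. card {w. r' v w}) \<le> (\<Sum>v\<in>V. card {w. r v w})"
  shows "saturated V r"
proof
  show "finite V" by (fact fin)
  show "u \<in> V" if "r u w" for u w using criticalD(2)[OF r that] by (rule gV)
  show "r w u" if "r u w" for u w using criticalD(1)[OF r that] .
  show "\<not> r u w" if "r u v" "r v w" for u v w using criticalD(3)[OF r that] by blast
  show "\<exists>z. r u z \<and> r w z" if uw: "u \<in> V" "w \<in> V" "u \<noteq> w" "\<not> r u w" for u w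
  proof (cases "g u w")
    case False
    then show ?thesis using common[OF r uw(1-3)] by blast
  next
    case True
    show ?thesis
    proof (rule ccontr)
      assume nc: "\<nexists>z. r u z \<and> r w z"
      let ?r = "\<lambda>a b. r a b \<or> a = u \<and> b = w \<or> a = w \<and> b = u"
      have irr: "\<not> r a a" for a using criticalD(2)[OF r, of a a] girr by blast
      have c: "critical g ?r"
      proof (rule criticalI)
        show "g a b" if "?r a b" for a b using that criticalD(2)[OF r] True gsym[OF True] by blast
        show "?r b a" if "?r a b" for a b using that criticalD(1)[OF r] by blast
        show "\<exists>a b. \<forall>z. g v z \<and> \<not> ?r v z \<longrightarrow> z = a \<or> z = b" for v
          using criticalD(4)[OF r, of v] by blast
        show False if t: "?r a b" "?r b d" "?r a d" for a b d
        proof -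
          have "a \<noteq> b" "b \<noteq> d" "a \<noteq> d" using t irr uw(3) by auto
          moreover have "\<not> (r u z \<and> r w z)" "\<not> (r z u \<and> r z w)" "\<not> (r u z \<and> r z w)" "\<not> (r z u \<and> r w z)" for z
            using nc criticalD(1)[OF r] by blast+
          ultimately show False using t criticalD(3)[OF r, of a b d] by (elim disjE conjE) auto
        qed
      qed
      have "(\<Sum>v\<in>V. card {z. r v z}) < (\<Sum>v\<in>V. card {z. ?r v z})"
      proof (rule sum_strict_mono_ex1[OF fin])
        have f: "finite {z. ?r v z}" for v
          by (rule finite_subset[OF _ fin]) (use criticalD(2)[OF c] gV2 in blast)
        show "\<forall>v\<in>V. card {z. r v z} \<le> card {z. ?r v z}"
          using card_mono[OF f] by (simp add: Collect_mono_iff)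
        have "{z. r u z} \<subset> {z. ?r u z}" using uw(4) by blast
        then show "\<exists>v\<in>V. card {z. r v z} < card {z. ?r v z}" using psubset_card_mono[OF f] uw(1) by blast
      qed
      then show False using max[OF c] by linarith
    qed
  qed
qed

text \<open>All other vertices are joined to \<open>w\<close> in red, so that the edges among them are blue. Putting
  \<open>v\<close> on the side of \<open>w\<close> would force \<open>v\<close> to be adjacent to all other
  vertices.\<close>

lemma star_absurd:
  assumes r: "critical g r" and sat: "saturated V r" and big: "13 \<le> card V"
    and v: "v \<in> V" "{z. r v z} = {w}"
  shows False
proof -
  interpret s: saturated V r by (rule sat)
  have vw: "r v w" using v(2) by blast
  have w: "w \<in> V" using s.rV2[OF vw] .
  have all: "r u w" if u: "u \<in> V" "u \<noteq> v" "u \<noteq> w" for u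
  proof -
    have "\<not> r u v" using u v(2) s.rsym by blast
    then obtain z where z: "r u z" "r v z" using s.diam[of u v] u v(1) by blast
    then have "z = w" using v(2) by blast
    then show ?thesis using z by blast
  qed
  have vu: "g v u" if "u \<in> V - {v, w}" for u
  proof (rule split_edges[of "{v, w}"])
    show "{v, w} \<subseteq> V" using v w by blast
    show "\<exists>a b. \<forall>z\<in>{v, w}. g x z \<longrightarrow> z = a \<or> z = b" for x by blast
    show "\<exists>a b. \<forall>z\<in>V - {v, w}. g x z \<longrightarrow> z = a \<or> z = b" if x: "x \<in> V - {v, w}" for x
    proof -
      have "\<not> r x z" if z: "z \<in> V - {v, w}" for z
        using s.rtri[of x w z] all[of x] all[of z] s.rsym[of z w] x z by blast
      then show ?thesis using two_exceptions_mono[OF criticalD(4)[OF r, of x], of "V - {v, w}" "g x"] by blast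
    qed
  qed (use that in auto)
  obtain a b where ab: "\<forall>z. g v z \<and> \<not> r v z \<longrightarrow> z = a \<or> z = b" using criticalD(4)[OF r, of v] by blast
  have "V \<subseteq> {v, w, a, b}"
  proof
    fix z assume z: "z \<in> V"
    show "z \<in> {v, w, a, b}"
    proof (cases "z = v \<or> z = w")
      case False
      then have "g v z" "\<not> r v z" using vu z v(2) by blast+
      then show ?thesis using ab by blast
    qed blast
  qed
  then have "card V \<le> card {v, w, a, b}" by (rule card_mono[rotated]) simp
  also have "\<dots> \<le> 4" by (simp add: card_insert_if)
  finally show False using big by simp
qed

text \<open>The classes are formed by adjacency to \<open>x\<close> and \<open>y\<close>; everything is adjacent to one of
  them, because it is \<open>v\<close> or has a common neighbour with \<open>v\<close>. A vertex of
  \<open>P\<close> and one of \<open>Q\<close> cannot have a common neighbour, so they are adjacent.\<close>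

lemma blow_up_of_degree_2:
  assumes r: "critical g r" and sat: "saturated V r"
    and v: "v \<in> V" "{z. r v z} = {x, y}" "x \<noteq> y"
  shows "blow_up r x y {z. r x z \<and> \<not> r y z} {z. r y z \<and> \<not> r x z} {z. r x z \<and> r y z}"
    (is "blow_up r x y ?P ?Q ?M")
proof -
  interpret s: saturated V r by (rule sat)
  have vn: "r v z \<longleftrightarrow> z = x \<or> z = y" for z using v(2) by blast
  have vx: "r v x" "r v y" "r x v" "r y v" using vn s.rsym by blast+
  have nxy: "\<not> r x y" "\<not> r y x" using s.rtri[OF vx(3,2)] s.rtri[OF vx(4,1)] .
  have inV: "x \<in> V" "y \<in> V" using s.rV vx by blast+
  have cov: "z \<in> ?P \<union> ?Q \<union> ?M" if z: "z \<in> V" "z \<noteq> x" "z \<noteq> y" for z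
  proof (cases "z = v")
    case True then show ?thesis using vx by blast
  next
    case False
    have "\<not> r z v" using z vn[of z] s.rsym[of z v] by blast
    then obtain t where t: "r z t" "r v t" using s.diam[of z v] False z(1) v(1) by blast
    then have "r x z \<or> r y z" using vn[of t] s.rsym[OF t(1)] by blast
    then show ?thesis by blast
  qed
  have P: "w = x \<or> w \<in> ?Q" if u: "u \<in> ?P" "r u w" for u w
  proof (rule ccontr)
    assume n: "\<not> (w = x \<or> w \<in> ?Q)"
    have "\<not> r x w" using s.rtri[of x u w] u by blast
    moreover have "w \<noteq> y" using u s.rsym[OF u(2)] by blast
    ultimately show False using cov[of w] s.rV2[OF u(2)] n by blast
  qed
  have Q: "w = y \<or> w \<in> ?P" if u: "u \<in> ?Q" "r u w" for u w
  proof (rule ccontr)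
    assume n: "\<not> (w = y \<or> w \<in> ?P)"
    have "\<not> r y w" using s.rtri[of y u w] u by blast
    moreover have "w \<noteq> x" using u s.rsym[OF u(2)] by blast
    ultimately show False using cov[of w] s.rV2[OF u(2)] n by blast
  qed
  have PQ: "r u w" if u: "u \<in> ?P" and w: "w \<in> ?Q" for u w
  proof (rule ccontr)
    assume n: "\<not> r u w"
    have "u \<noteq> w" using u w by blast
    moreover have "u \<in> V" "w \<in> V" using u w s.rV2[of x u] s.rV2[of y w] by blast+
    ultimately obtain z where z: "r u z" "r w z" using s.diam n by blast
    then show False using P[OF u z(1)] Q[OF w z(2)] v(3) nxy s.irr[of x] s.irr[of y] by blast
  qed
  have M: "w = x \<or> w = y" if u: "u \<in> ?M" "r u w" for u w
  proof -
    have "\<not> r x w" "\<not> r y w" using s.rtri[of x u w] s.rtri[of y u w] u by blast+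
    then show ?thesis using cov[of w] s.rV2[OF u(2)] by blast
  qed
  show ?thesis
    unfolding blow_up_def
  proof (intro conjI)
    show "critical g r" by (fact r)
    show "x \<noteq> y" by (fact v(3))
    show "V = insert x (insert y (?P \<union> ?Q \<union> ?M))"
    proof
      show "V \<subseteq> insert x (insert y (?P \<union> ?Q \<union> ?M))" using cov by blast
      show "insert x (insert y (?P \<union> ?Q \<union> ?M)) \<subseteq> V" using inV s.rV2[of x] s.rV2[of y] by blast
    qed
    show "x \<notin> ?P \<union> ?Q \<union> ?M" "y \<notin> ?P \<union> ?Q \<union> ?M" using nxy s.irr by simp_all
    show "\<forall>w. r x w \<longleftrightarrow> w \<in> ?P \<union> ?M" "\<forall>w. r y w \<longleftrightarrow> w \<in> ?Q \<union> ?M" by blast+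
    show "\<forall>u\<in>?P. \<forall>w. r u w \<longleftrightarrow> w = x \<or> w \<in> ?Q"
    proof (intro ballI allI iffI)
      fix u w assume u: "u \<in> ?P"
      show "w = x \<or> w \<in> ?Q" if "r u w" using P[OF u that] .
      show "r u w" if "w = x \<or> w \<in> ?Q" using that PQ[OF u, of w] u s.rsym[of x u] by blast
    qed
    show "\<forall>u\<in>?Q. \<forall>w. r u w \<longleftrightarrow> w = y \<or> w \<in> ?P"
    proof (intro ballI allI iffI)
      fix u w assume u: "u \<in> ?Q"
      show "w = y \<or> w \<in> ?P" if "r u w" using Q[OF u that] .
      show "r u w" if "w = y \<or> w \<in> ?P" using that PQ[of w u] u s.rsym[of w u] s.rsym[of y u] by blast
    qed
    show "\<forall>u\<in>?M. \<forall>w. r u w \<longleftrightarrow> w = x \<or> w = y"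
    proof (intro ballI allI iffI)
      fix u w assume u: "u \<in> ?M"
      show "w = x \<or> w = y" if "r u w" using M[OF u that] .
      show "r u w" if "w = x \<or> w = y" using that u s.rsym[of x u] s.rsym[of y u] by blast
    qed
  qed blast+
qed

end

context pentagon begin

lemma finites: "finite P" "finite Q" "finite M"
  by (rule finite_subset[OF _ fin], use V in blast)+

lemma card_V: "card V = 2 + card P + card Q + card M"
proof -
  have 1: "card (P \<union> Q) = card P + card Q"
    by (rule card_Un_disjoint[OF finites(1,2)]) (use disj(8) in blast)
  have 2: "card (P \<union> Q \<union> M) = card (P \<union> Q) + card M"
    by (rule card_Un_disjoint) (use finites disj(9,10) in auto)
  have "x \<notin> insert y (P \<union> Q \<union> M)" "y \<notin> P \<union> Q \<union> M" using disj(1-7) by auto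
  then show ?thesis unfolding V using 1 2 finites by simp
qed

lemma red_degree_sum:
  "(\<Sum>v\<in>V. card {w. r v w}) = 2 * card P + 2 * card Q + 4 * card M + 2 * (card P * card Q)"
proof -
  let ?d = "\<lambda>v. card {w. r v w}"
  have dx: "?d x = card P + card M"
  proof -
    have "{w. r x w} = P \<union> M" using red(1) by blast
    then show ?thesis using card_Un_disjoint[OF finites(1,3)] disj(9) by auto
  qed
  have dy: "?d y = card Q + card M"
  proof -
    have "{w. r y w} = Q \<union> M" using red(2) by blast
    then show ?thesis using card_Un_disjoint[OF finites(2,3)] disj(10) by auto
  qed
  have dP: "?d u = 1 + card Q" if "u \<in> P" for u
  proof -
    have "{w. r u w} = insert x Q" using red(3)[OF that] by blast
    then show ?thesis using finites disj(3) by simp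
  qed
  have dQ: "?d u = 1 + card P" if "u \<in> Q" for u
  proof -
    have "{w. r u w} = insert y P" using red(4)[OF that] by blast
    then show ?thesis using finites disj(5) by simp
  qed
  have dM: "?d u = 2" if "u \<in> M" for u
  proof -
    have "{w. r u w} = {x, y}" using red(5)[OF that] by blast
    then show ?thesis using disj(1) by simp
  qed
  have 1: "sum ?d (P \<union> Q) = sum ?d P + sum ?d Q"
    by (rule sum.union_disjoint[OF finites(1,2)]) (use disj(8) in blast)
  have 2: "sum ?d (P \<union> Q \<union> M) = sum ?d (P \<union> Q) + sum ?d M"
    by (rule sum.union_disjoint) (use finites disj(9,10) in auto)
  have "x \<notin> insert y (P \<union> Q \<union> M)" "y \<notin> P \<union> Q \<union> M" using disj(1-7) by auto
  then have "sum ?d V = ?d x + (?d y + sum ?d (P \<union> Q \<union> M))" unfolding V using finites by simp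
  then show ?thesis using 1 2 dx dy dP dQ dM by (simp add: algebra_simps)
qed

lemma P_Q_empty:
  assumes sat: "saturated V r"
  shows "P = {} \<longleftrightarrow> Q = {}"
proof -
  interpret s: saturated V r by (rule sat)
  have "False" if P: "P = {}" and q: "q \<in> Q" for q
  proof -
    have "\<not> r x q" using red(1)[of q] P disj(10)[OF q] by blast
    then obtain z where z: "r x z" "r q z" using s.diam[OF inV(1) inV(4)[OF q]] disj(16)[OF q] by blast
    then show False using red(1)[of z] red(4)[OF q, of z] P disj(7) by blast
  qed
  moreover have "False" if Q: "Q = {}" and p: "p \<in> P" for p
  proof -
    have "\<not> r y p" using red(2)[of p] Q disj(9)[OF p] by blast
    then obtain z where z: "r y z" "r p z" using s.diam[OF inV(2) inV(3)[OF p]] disj(15)[OF p] by blast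
    then show False using red(2)[of z] red(3)[OF p, of z] Q disj(4) by blast
  qed
  ultimately show ?thesis by blast
qed

text \<open>The red degrees fall short of \<open>4n - 4\<close> by four or two. If the total stays below
  \<open>6n - 8\<close>, the blue degrees fall short of \<open>2n\<close> by at least two or four, as needed for
  the two refutations.\<close>

lemma small_blow_up_absurd:
  assumes big: "13 \<le> card V" and few: "(\<Sum>v\<in>V. card {w. g v w}) + 10 \<le> 6 * card V"
    and P: "card P = 2" and Q: "card Q = 2 \<or> card Q = 3"
  shows False
proof -
  have M: "4 \<le> card M" using big card_V P Q by auto
  have "(\<Sum>v\<in>V. blue_deg r v) + (\<Sum>v\<in>V. card {w. r v w}) + 10 \<le> 6 * card V"
    using few degree_split[OF crit] by simp
  then have def: "2 * card V + (\<Sum>v\<in>V. card {w. r v w}) + 10 \<le> 6 * card V + (\<Sum>v\<in>V. 2 - blue_deg r v)"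
    using blue_degree_sum[OF crit] by linarith
  obtain p1 p2 where p: "P = {p1, p2}" "p1 \<noteq> p2" using P by (auto simp: card_2_iff)
  from Q show False
  proof
    assume Q: "card Q = 2"
    obtain q1 q2 where q: "Q = {q1, q2}" "q1 \<noteq> q2" using Q by (auto simp: card_2_iff)
    have "2 \<le> (\<Sum>v\<in>V. 2 - blue_deg r v)" using def red_degree_sum card_V P Q by simp
    then show False using blow_up_2_2_absurd[OF p q M] deficit_2[OF crit] by blast
  next
    assume Q: "card Q = 3"
    obtain q1 q2 where q: "q1 \<in> Q" "q2 \<in> Q" "q1 \<noteq> q2" using Q by (auto simp: card_3_iff)
    have "4 \<le> (\<Sum>v\<in>V. 2 - blue_deg r v)" using def red_degree_sum card_V P Q by simp
    then obtain s t where "r s t" "blue_le_1 g r s" "blue_le_1 g r t"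
       "\<forall>z w. z \<in> {s, t} \<longrightarrow> g z w \<longrightarrow> \<not> r z w \<longrightarrow> blue_le_1 g r w" using deficit(2)[OF crit] by blast
    then show False using blow_up_2_3_absurd[OF p M q] by blast
  qed
qed

text \<open>The red graph has \<open>2n - 5 + (|P| - 1)(|Q| - 1)\<close> edges, so with at most
  \<open>2n - 3\<close> edges \<open>P\<close> and \<open>Q\<close> are empty, or one of them is a single
  vertex, or they have two and two or two and three vertices.\<close>

lemma few_edges_absurd:
  assumes sat: "saturated V r"
    and big: "13 \<le> card V" and few: "(\<Sum>v\<in>V. card {w. g v w}) + 10 \<le> 6 * card V"
    and deg: "4 * card V > (\<Sum>v\<in>V. card {w. r v w}) + 4"
  shows False
proof -
  interpret sw: pentagon V g r y x Q P M by (rule swapped)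
  have lt: "2 * card P + 2 * card Q + 4 * card M + 2 * (card P * card Q) + 4 < 4 * (2 + card P + card Q + card M)"
    using deg unfolding red_degree_sum card_V .
  consider "card P = 0" | "card P = 1" | "card Q = 1" | "2 \<le> card P" "2 \<le> card Q"
    using P_Q_empty[OF sat] finites by (metis One_nat_def Suc_1 card_0_eq not_less_eq_eq le_zero_eq le_antisym)
  then show False
  proof cases
    case 1
    then have "P = {}" "Q = {}" using P_Q_empty[OF sat] finites by auto
    then show False using bipartite_absurd card_V big by simp
  next
    case 2
    then obtain p1 where p1: "P = {p1}" by (auto simp: card_1_singleton_iff)
    have "4 \<le> card M \<or> 4 \<le> card Q" using card_V big 2 by linarith
    then show False using single_P_absurd[OF p1] by blast
  next
    case 3
    then obtain q1 where q1: "Q = {q1}" by (auto simp: card_1_singleton_iff)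
    have "4 \<le> card M \<or> 4 \<le> card P" using card_V big 3 by linarith
    then show False using sw.single_P_absurd[OF q1] by blast
  next
    case 4
    obtain a b where ab: "card P = 2 + a" "card Q = 2 + b" using 4 by (metis le_Suc_ex)
    \<comment> \<open>This is \<open>(|P| - 1)(|Q| - 1) \<le> 2\<close>.\<close>
    have "a * b + a + b < 2" using lt unfolding ab by (simp add: algebra_simps)
    then have "a = 0 \<and> b \<le> 1 \<or> b = 0 \<and> a \<le> 1" by auto
    then show False
      using small_blow_up_absurd[OF big few] sw.small_blow_up_absurd[OF big few] ab by force
  qed
qed

end

context cocritical begin

theorem degree_sum_ge:
  assumes big: "13 \<le> card V" and r0: "critical g r0"
  shows "6 * card V \<le> (\<Sum>v\<in>V. card {w. g v w}) + 9"
proof (rule ccontr)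
  assume "\<not> 6 * card V \<le> (\<Sum>v\<in>V. card {w. g v w}) + 9"
  then have few: "(\<Sum>v\<in>V. card {w. g v w}) + 10 \<le> 6 * card V" by linarith
  obtain r where r: "critical g r" and max: "\<And>r'. critical g r' \<Longrightarrow> (\<Sum>v\<in>V. card {w. r' v w}) \<le> (\<Sum>v\<in>V. card {w. r v w})"
    using max_red[OF r0] by blast
  have sat: "saturated V r" by (rule max_red_saturated[OF r max])
  interpret s: saturated V r by (rule sat)
  have deg: "4 * card V > (\<Sum>v\<in>V. card {w. r v w}) + 4"
    using few degree_split[OF r] blue_degree_sum[OF r] deficit(1)[OF r] by linarith
  have "\<not> (\<forall>v\<in>V. 4 \<le> card {w. r v w})"
    using deg sum_bounded_below[of V 4 "\<lambda>v. card {w. r v w}"] by auto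
  then obtain v where v: "v \<in> V" "card {w. r v w} \<le> 3" by force
  have nonzero: "card {w. r u w} \<noteq> 0" if u: "u \<in> V" for u
  proof
    assume "card {w. r u w} = 0"
    then have e: "\<not> r u w" for w using s.fin_nbrs[of u] by auto
    have "V \<noteq> {u}" using big by auto
    then obtain t where "t \<in> V" "t \<noteq> u" using u by blast
    then show False using s.diam[of u t] u e by blast
  qed
  show False
  proof (cases "\<exists>v\<in>V. card {w. r v w} \<le> 2")
    case True
    then obtain u where u: "u \<in> V" "card {w. r u w} \<le> 2" by blast
    then consider "card {w. r u w} = 1" | "card {w. r u w} = 2" using nonzero[OF u(1)] by linarith
    then show False
    proof cases
      case 1
      then obtain w where "{w. r u w} = {w}" by (auto simp: card_1_singleton_iff)
      then show False using star_absurd[OF r sat big u(1)] by blast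
    next
      case 2
      then obtain x y where xy: "{w. r u w} = {x, y}" "x \<noteq> y" by (auto simp: card_2_iff)
      interpret p: pentagon V g r x y "{z. r x z \<and> \<not> r y z}" "{z. r y z \<and> \<not> r x z}" "{z. r x z \<and> r y z}"
        by unfold_locales (rule blow_up_of_degree_2[OF r sat u(1) xy])
      show False by (rule p.few_edges_absurd[OF sat big few deg])
    qed
  next
    case False
    then have d3: "3 \<le> card {w. r u w}" if "u \<in> V" for u using that by force
    then have "card {w. r v w} = 3" using v by (simp add: le_antisym)
    then obtain a b c where abc: "{w. r v w} = {a, b, c}" "a \<noteq> b" "a \<noteq> c" "b \<noteq> c" by (auto simp: card_3_iff)
    interpret cv: cubic_vertex V r v a b c
      by unfold_locales (use abc d3 in auto)
    show False using cv.degree_sum[OF big] deg by linarith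
  qed
qed

end

text \<open>Each edge gives two ordered pairs.\<close>

lemma handshake:
  assumes G: "simple_graph G"
  shows "(\<Sum>v\<in>verts G. card {w. adj G v w}) = 2 * card (edges G)"
proof -
  have fV: "finite (verts G)" using G unfolding simple_graph_def by blast
  have "edges G \<subseteq> Pow (verts G)" using G unfolding simple_graph_def nsets_def by blast
  then have fE: "finite (edges G)" using fV finite_subset by blast
  have fN: "finite {w. adj G v w}" for v
    by (rule finite_subset[OF _ fV]) (use adj_verts[OF G] in blast)
  let ?pairs = "\<lambda>e. {(u, w). {u, w} = e}"
  have "(\<Sum>v\<in>verts G. card {w. adj G v w}) = card (SIGMA v:verts G. {w. adj G v w})"
    using fV fN by (simp add: card_SigmaI)
  also have "(SIGMA v:verts G. {w. adj G v w}) = (\<Union>e\<in>edges G. ?pairs e)"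
  proof -
    have "u \<in> verts G" if "{u, w} \<in> edges G" for u w
      using adj_verts[OF G, of u w] that unfolding adj_def by blast
    then show ?thesis unfolding adj_def by auto
  qed
  also have "card (\<Union>e\<in>edges G. ?pairs e) = (\<Sum>e\<in>edges G. card (?pairs e))"
  proof (rule card_UN_disjoint[OF fE])
    show "\<forall>e\<in>edges G. finite (?pairs e)"
    proof
      fix e assume "e \<in> edges G"
      have "?pairs e \<subseteq> e \<times> e" by auto
      moreover have "finite e" using \<open>e \<in> edges G\<close> \<open>edges G \<subseteq> Pow (verts G)\<close> fV finite_subset by blast
      ultimately show "finite (?pairs e)" using finite_subset by blast
    qed
    show "\<forall>e\<in>edges G. \<forall>e'\<in>edges G. e \<noteq> e' \<longrightarrow> ?pairs e \<inter> ?pairs e' = {}" by blast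
  qed
  also have "(\<Sum>e\<in>edges G. card (?pairs e)) = (\<Sum>e\<in>edges G. 2)"
  proof (rule sum.cong[OF refl])
    fix e assume "e \<in> edges G"
    then obtain u w where e: "e = {u, w}" "adj G u w" using edge_adj[OF G] by blast
    then have "u \<noteq> w" using adj_verts[OF G] by blast
    moreover have "?pairs e = {(u, w), (w, u)}" unfolding e(1) by (auto simp: doubleton_eq_iff)
    ultimately show "card (?pairs e) = 2" by simp
  qed
  finally show ?thesis by simp
qed

theorem edges_ge:
  assumes G: "simple_graph G" and n: "card (verts G) = n" "13 \<le> n"
    and co: "co_critical G (complete_graph 3) (star 3)"
  shows "3 * n - 4 \<le> card (edges G)"
proof -
  have co': "(\<exists>r. critical (adj G) r) \<and>
    (\<forall>r u v. critical (adj G) r \<longrightarrow> u \<in> verts G \<longrightarrow> v \<in> verts G \<longrightarrow> u \<noteq> v \<longrightarrow> \<not> adj G u v \<longrightarrow>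
       (\<exists>w. r u w \<and> r v w) \<and> (\<not> blue_le_1 (adj G) r u \<or> \<not> blue_le_1 (adj G) r v))"
    using co unfolding co_critical_iff[OF G] by blast
  interpret cocritical "verts G" "adj G"
  proof
    show "finite (verts G)" using G unfolding simple_graph_def by blast
    show "adj G v u" if "adj G u v" for u v using that adj_sym[of G u v] by blast
    show "\<not> adj G u u" for u using adj_verts[OF G, of u u] by blast
    show "u \<in> verts G" if "adj G u v" for u v using adj_verts[OF G that] by blast
    show "\<exists>w. r u w \<and> r v w"
      if "critical (adj G) r" "u \<in> verts G" "v \<in> verts G" "u \<noteq> v" "\<not> adj G u v" for r u v
      using co' that by blast
    show "\<not> blue_le_1 (adj G) r v"
      if "critical (adj G) r" "u \<in> verts G" "v \<in> verts G" "u \<noteq> v" "\<not> adj G u v" "blue_le_1 (adj G) r u" for r u v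
      using co' that by blast
  qed
  obtain r where "critical (adj G) r" using co' by blast
  then have "6 * n \<le> 2 * card (edges G) + 9"
    using degree_sum_ge n handshake[OF G] by metis
  then show ?thesis by linarith
qed

section \<open>An extremal graph\<close>

text \<open>The vertices are \<open>x = 0\<close>, \<open>y = 1\<close>, \<open>P = {2, 3}\<close>,
  \<open>Q = {4, 5, 6}\<close> and \<open>M = {7, 8, 9, \<dots>, n - 1}\<close>. The red arcs form the
  blow-up \<open>x - P - Q - y - M - x\<close>. The blue ones are the triangle \<open>y, 2, 3\<close>,
  the four-cycle \<open>x, 4, 7, 5\<close>, the edge between \<open>6\<close> and \<open>8\<close>, and a cycle
  through \<open>9, \<dots>, n - 1\<close>. Each edge is listed with its smaller end first, so that counting
  pairs counts edges.\<close>

definition red_arcs :: "nat \<Rightarrow> (nat \<times> nat) set" where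
  "red_arcs n = {(0, 2), (0, 3), (2, 4), (2, 5), (2, 6), (3, 4), (3, 5), (3, 6), (1, 4), (1, 5), (1, 6),
     (0, 7), (0, 8), (1, 7), (1, 8)} \<union> {0, 1} \<times> {9..<n}"

definition blue_arcs :: "nat \<Rightarrow> (nat \<times> nat) set" where
  "blue_arcs n = {(0, 4), (0, 5), (1, 2), (1, 3), (2, 3), (4, 7), (5, 7), (6, 8), (9, n - 1)} \<union>
     (\<lambda>i. (i, Suc i)) ` {9..<n - 1}"

definition arcs :: "nat \<Rightarrow> (nat \<times> nat) set" where
  "arcs n = red_arcs n \<union> blue_arcs n"

definition sharp_graph :: "nat \<Rightarrow> nat graph" where
  "sharp_graph n = \<lparr>verts = {..<n}, edges = (\<lambda>(i, j). {i, j}) ` arcs n\<rparr>"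

definition c5_position :: "nat \<Rightarrow> nat" where
  "c5_position i = (if i = 0 then 0 else if i = 1 then 3 else if i \<in> {2, 3} then 1 else if i \<in> {4, 5, 6} then 2 else 4)"

context
  fixes n :: nat
  assumes n: "13 \<le> n"
begin

abbreviation "g \<equiv> adj (sharp_graph n)"

lemma arcs_less: "(i, j) \<in> arcs n \<Longrightarrow> i < j \<and> j < n"
  using n unfolding arcs_def red_arcs_def blue_arcs_def by auto

lemma c5_position_iff:
  "c5_position v = 0 \<longleftrightarrow> v = 0" "c5_position v = 1 \<longleftrightarrow> v = 2 \<or> v = 3" "c5_position v = 2 \<longleftrightarrow> v = 4 \<or> v = 5 \<or> v = 6"
  "c5_position v = 3 \<longleftrightarrow> v = 1" "c5_position v = 4 \<longleftrightarrow> v = 7 \<or> v = 8 \<or> 9 \<le> v"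
  unfolding c5_position_def by auto

definition std_red :: "nat \<Rightarrow> nat \<Rightarrow> bool" where
  "std_red u v \<longleftrightarrow> u < n \<and> v < n \<and> c5 (c5_position u) (c5_position v)"

lemma red_arcs_std_red: "(u, v) \<in> red_arcs n \<Longrightarrow> std_red u v"
  using n unfolding red_arcs_def std_red_def by (auto simp: c5_position_def c5_def)

lemma blue_arcs_std_red: "(u, v) \<in> blue_arcs n \<Longrightarrow> \<not> std_red u v"
proof -
  assume uv: "(u, v) \<in> blue_arcs n"
  have "\<not> c5 (c5_position u) (c5_position v)" if "9 \<le> u" "9 \<le> v"
  proof -
    have "c5_position u = 4" "c5_position v = 4" using that unfolding c5_position_iff by simp_all
    then show ?thesis by (simp add: c5_def)
  qed
  moreover have "(u, v) \<in> {(0, 4), (0, 5), (1, 2), (1, 3), (2, 3), (4, 7), (5, 7), (6, 8)} \<or> 9 \<le> u \<and> 9 \<le> v"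
    using uv unfolding blue_arcs_def by (elim UnE insertE imageE emptyE) (use n in simp_all)
  moreover have "\<not> c5 (c5_position u) (c5_position v)" if "(u, v) \<in> {(0, 4), (0, 5), (1, 2), (1, 3), (2, 3), (4, 7), (5, 7), (6, 8)}"
    using that by (auto simp: c5_position_def c5_def)
  ultimately show ?thesis unfolding std_red_def by blast
qed

lemma card_arcs: "card (arcs n) = 3 * n - 4"
proof -
  let ?R = "{(0, 2), (0, 3), (2, 4), (2, 5), (2, 6), (3, 4), (3, 5), (3, 6), (1, 4), (1, 5), (1, 6),
     (0, 7), (0, 8), (1, 7), (1, 8)} :: (nat \<times> nat) set"
  let ?B = "{(0, 4), (0, 5), (1, 2), (1, 3), (2, 3), (4, 7), (5, 7), (6, 8), (9, n - 1)} :: (nat \<times> nat) set"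
  let ?S = "{0, 1 :: nat} \<times> {9..<n}" and ?C = "(\<lambda>i. (i, Suc i)) ` {9..<n - 1}"
  have R: "card ?R = 15" "finite ?R" and B: "card ?B = 9" "finite ?B" by simp_all
  have S: "card ?S = 2 * (n - 9)" "finite ?S" by (simp_all add: card_cartesian_product)
  have C: "card ?C = n - 10" "finite ?C" using n by (simp_all add: card_image inj_on_def)
  have "card (red_arcs n) = 15 + 2 * (n - 9)"
    unfolding red_arcs_def using R S by (subst card_Un_disjoint) auto
  moreover have "card (blue_arcs n) = 9 + (n - 10)"
    unfolding blue_arcs_def using B C n by (subst card_Un_disjoint) auto
  moreover have "red_arcs n \<inter> blue_arcs n = {}" using red_arcs_std_red blue_arcs_std_red by auto
  moreover have "finite (red_arcs n)" "finite (blue_arcs n)"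
    unfolding red_arcs_def blue_arcs_def by simp_all
  ultimately show ?thesis unfolding arcs_def using n by (simp add: card_Un_disjoint)
qed

lemma sharp_simple: "simple_graph (sharp_graph n)"
proof -
  have "{i, j} \<in> nsets {..<n} 2" if "(i, j) \<in> arcs n" for i j
    using arcs_less[OF that] unfolding nsets_def by auto
  then show ?thesis unfolding simple_graph_def sharp_graph_def by auto
qed

lemma sharp_card: "card (verts (sharp_graph n)) = n" "card (edges (sharp_graph n)) = 3 * n - 4"
proof -
  have "inj_on (\<lambda>(i, j). {i, j}) (arcs n)"
  proof (rule inj_onI, clarify)
    fix i j k l assume "(i, j) \<in> arcs n" "(k, l) \<in> arcs n" "{i, j} = {k, l}"
    then show "i = k \<and> j = l" using arcs_less[of i j] arcs_less[of k l] by (auto simp: doubleton_eq_iff)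
  qed
  then show "card (edges (sharp_graph n)) = 3 * n - 4"
    unfolding sharp_graph_def by (simp add: card_image card_arcs)
qed (simp add: sharp_graph_def)

lemma g_iff: "g u v \<longleftrightarrow> (u, v) \<in> arcs n \<or> (v, u) \<in> arcs n"
proof -
  have "g u v \<longleftrightarrow> (\<exists>i j. (i, j) \<in> arcs n \<and> {u, v} = {i, j})"
    unfolding adj_def sharp_graph_def by auto
  then show ?thesis by (auto simp: doubleton_eq_iff)
qed

lemma std_red_adj: "std_red u v \<Longrightarrow> g u v"
proof -
  assume r: "std_red u v"
  have uv: "u < n" "v < n" "c5 (c5_position u) (c5_position v)" using r unfolding std_red_def by blast+
  have "(u, v) \<in> arcs n \<or> (v, u) \<in> arcs n" if "c5_position u = 0" "c5_position v = 1 \<or> c5_position v = 4" "v < n" for u v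
    using that unfolding c5_position_iff by (elim disjE) (simp_all add: arcs_def red_arcs_def blue_arcs_def)
  moreover have "(u, v) \<in> arcs n \<or> (v, u) \<in> arcs n" if "c5_position u = 1" "c5_position v = 2" for u v
    using that unfolding c5_position_iff by (elim disjE) (simp_all add: arcs_def red_arcs_def blue_arcs_def)
  moreover have "(u, v) \<in> arcs n \<or> (v, u) \<in> arcs n" if "c5_position u = 3" "c5_position v = 2 \<or> c5_position v = 4" "v < n" for u v
    using that unfolding c5_position_iff by (elim disjE) (simp_all add: arcs_def red_arcs_def blue_arcs_def)
  moreover have "c5_position u = 0 \<and> (c5_position v = 1 \<or> c5_position v = 4) \<or> c5_position v = 0 \<and> (c5_position u = 1 \<or> c5_position u = 4) \<or>
      c5_position u = 1 \<and> c5_position v = 2 \<or> c5_position v = 1 \<and> c5_position u = 2 \<or>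
      c5_position u = 3 \<and> (c5_position v = 2 \<or> c5_position v = 4) \<or> c5_position v = 3 \<and> (c5_position u = 2 \<or> c5_position u = 4)"
    using uv(3) unfolding c5_def by argo
  ultimately have "(u, v) \<in> arcs n \<or> (v, u) \<in> arcs n" using uv(1,2) by metis
  then show ?thesis unfolding g_iff .
qed

lemma blue_iff: "g u v \<and> \<not> std_red u v \<longleftrightarrow> (u, v) \<in> blue_arcs n \<or> (v, u) \<in> blue_arcs n"
proof -
  have 1: "(u, v) \<in> arcs n \<and> \<not> std_red u v \<longleftrightarrow> (u, v) \<in> blue_arcs n" for u v
    using red_arcs_std_red blue_arcs_std_red unfolding arcs_def by blast
  have 2: "std_red v u = std_red u v" unfolding std_red_def using c5_sym by blast
  show ?thesis unfolding g_iff using 1[of u v] 1[of v u] 2 by blast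
qed

lemma blue_nbrs:
  "(g 0 w \<and> \<not> std_red 0 w) \<longleftrightarrow> w = 4 \<or> w = 5"
  "(g 1 w \<and> \<not> std_red 1 w) \<longleftrightarrow> w = 2 \<or> w = 3"
  "(g 2 w \<and> \<not> std_red 2 w) \<longleftrightarrow> w = 1 \<or> w = 3"
  "(g 3 w \<and> \<not> std_red 3 w) \<longleftrightarrow> w = 1 \<or> w = 2"
  "(g 4 w \<and> \<not> std_red 4 w) \<longleftrightarrow> w = 0 \<or> w = 7"
  "(g 5 w \<and> \<not> std_red 5 w) \<longleftrightarrow> w = 0 \<or> w = 7"
  "(g 6 w \<and> \<not> std_red 6 w) \<longleftrightarrow> w = 8"
  "(g 7 w \<and> \<not> std_red 7 w) \<longleftrightarrow> w = 4 \<or> w = 5"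
  "(g 8 w \<and> \<not> std_red 8 w) \<longleftrightarrow> w = 6"
  "9 \<le> v \<Longrightarrow> v < n \<Longrightarrow> (g v w \<and> \<not> std_red v w) \<longleftrightarrow>
     w = (if v = 9 then n - 1 else v - 1) \<or> w = (if v = n - 1 then 9 else v + 1)"
  unfolding blue_iff using n unfolding blue_arcs_def by (auto simp: image_iff)

lemma vertex_cases:
  assumes "v < n"
  obtains "v = 0" | "v = 1" | "v = 2" | "v = 3" | "v = 4" | "v = 5" | "v = 6" | "v = 7" | "v = 8" | "9 \<le> v"
  using assms by linarith

lemma g_less: "g u v \<Longrightarrow> u < n \<and> v < n"
  using adj_verts[OF sharp_simple] unfolding sharp_graph_def by auto

lemma std_red_critical: "critical g std_red"
proof (rule criticalI)
  show "std_red v u" if "std_red u v" for u v using that c5_sym unfolding std_red_def by blast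
  show "g u v" if "std_red u v" for u v using std_red_adj[OF that] .
  show False if "std_red u v" "std_red v w" "std_red u w" for u v w using that c5_no_triangle unfolding std_red_def by blast
  show "\<exists>a b. \<forall>w. g v w \<and> \<not> std_red v w \<longrightarrow> w = a \<or> w = b" for v
  proof (cases "v < n")
    case False
    then show ?thesis using g_less by blast
  next
    case True
    then show ?thesis
    proof (cases v rule: vertex_cases)
      case 10
      then show ?thesis using blue_nbrs(10)[OF 10 True] by blast
    qed (simp only: blue_nbrs; blast)+
  qed
qed

lemma std_red_low: "v < n \<Longrightarrow> blue_le_1 g std_red v \<Longrightarrow> v = 6 \<or> v = 8"
proof -
  assume v: "v < n" and l: "blue_le_1 g std_red v"
  have no: "\<not> blue_le_1 g std_red v" if "g v a \<and> \<not> std_red v a" "g v b \<and> \<not> std_red v b" "a \<noteq> b" for a b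
    using that unfolding blue_le_1_def by blast
  show ?thesis
    using v
  proof (cases v rule: vertex_cases)
    case 1 then show ?thesis using no[of 4 5] l blue_nbrs(1) by simp
  next
    case 2 then show ?thesis using no[of 2 3] l blue_nbrs(2) by simp
  next
    case 3 then show ?thesis using no[of 1 3] l blue_nbrs(3) by simp
  next
    case 4 then show ?thesis using no[of 1 2] l blue_nbrs(4) by simp
  next
    case 5 then show ?thesis using no[of 0 7] l blue_nbrs(5) by simp
  next
    case 6 then show ?thesis using no[of 0 7] l blue_nbrs(6) by simp
  next
    case 8 then show ?thesis using no[of 4 5] l blue_nbrs(8) by simp
  next
    case 10
    let ?a = "if v = 9 then n - 1 else v - 1" and ?b = "if v = n - 1 then 9 else v + 1"
    have "?a \<noteq> ?b" using n 10 v by (auto split: if_splits)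
    then show ?thesis using no[of ?a ?b] l blue_nbrs(10)[OF 10 v] by blast
  qed simp_all
qed

text \<open>Distinct positions of a five-cycle that are not consecutive, and equal positions, have a common neighbouring
  position.\<close>

lemma std_red_common:
  assumes "u < n" "v < n" "\<not> std_red u v"
  shows "\<exists>w. std_red u w \<and> std_red v w"
proof -
  have p: "c5_position z \<in> {0, 1, 2, 3, 4}" for z unfolding c5_position_def by simp
  have s: "c5_position 0 = 0" "c5_position 2 = 1" "c5_position 4 = 2" "c5_position 1 = 3" "c5_position 7 = 4" unfolding c5_position_def by simp_all
  have "\<exists>w\<in>{0, 2, 4, 1, 7}. c5 (c5_position u) (c5_position w) \<and> c5 (c5_position v) (c5_position w)"
    using p[of u] p[of v] assms unfolding std_red_def by (auto simp: s c5_def simp del: One_nat_def)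
  then obtain w where w: "w \<in> {0, 2, 4, 1, 7}" "c5 (c5_position u) (c5_position w)" "c5 (c5_position v) (c5_position w)" by blast
  have "w < n" using w(1) n by auto
  then show ?thesis using assms(1,2) w(2,3) unfolding std_red_def by blast
qed

context
  fixes r :: "nat \<Rightarrow> nat \<Rightarrow> bool"
  assumes r: "critical g r"
begin

lemma red3:
  assumes "g v a" "g v b" "g v c" "a \<noteq> b" "a \<noteq> c" "b \<noteq> c"
  shows "r v a \<or> r v b \<or> r v c"
proof -
  obtain s t where "\<forall>w. g v w \<and> \<not> r v w \<longrightarrow> w = s \<or> w = t" using criticalD(4)[OF r, of v] by blast
  then show ?thesis using assms by metis
qed

lemma r_sym: "r u v \<longleftrightarrow> r v u"
  using criticalD(1)[OF r] by blast

lemma no_tri: "\<not> r u v \<or> \<not> r v w \<or> \<not> r u w"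
  using criticalD(3)[OF r] by blast

lemma arc_adj: "(u, v) \<in> arcs n \<Longrightarrow> g u v" "(u, v) \<in> arcs n \<Longrightarrow> g v u"
  unfolding g_iff by blast+

lemma g_core:
  "g 0 2" "g 0 3" "g 2 4" "g 2 5" "g 2 6" "g 3 4" "g 3 5" "g 3 6" "g 1 4" "g 1 5" "g 1 6"
  "g 0 7" "g 0 8" "g 1 7" "g 1 8" "g 0 4" "g 0 5" "g 1 2" "g 1 3" "g 2 3" "g 4 7" "g 5 7" "g 6 8"
  "g 2 0" "g 3 0" "g 4 2" "g 5 2" "g 6 2" "g 4 3" "g 5 3" "g 6 3" "g 4 1" "g 5 1" "g 6 1"
  "g 7 0" "g 8 0" "g 7 1" "g 8 1" "g 4 0" "g 5 0" "g 2 1" "g 3 1" "g 3 2" "g 7 4" "g 7 5" "g 8 6"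
  by (rule arc_adj, simp add: arcs_def red_arcs_def blue_arcs_def)+

text \<open>The vertices \<open>2\<close> and \<open>3\<close> have the five common neighbours
  \<open>0, 1, 4, 5, 6\<close>. If the edge between them were red, each of these would need a blue edge to one
  of them, but they have only four blue edges together.\<close>

lemma p_p'_blue: "\<not> r 2 3"
proof
  assume a: "r 2 3"
  have "\<not> r 2 w \<or> \<not> r 3 w" for w using a no_tri[of 2 3 w] by blast
  note t = this[of 0] this[of 1] this[of 4] this[of 5] this[of 6]
  have v2: "r 2 0 \<or> r 2 1 \<or> r 2 4" "r 2 0 \<or> r 2 1 \<or> r 2 5" "r 2 0 \<or> r 2 1 \<or> r 2 6" "r 2 0 \<or> r 2 4 \<or> r 2 5" "r 2 0 \<or> r 2 4 \<or> r 2 6" "r 2 0 \<or> r 2 5 \<or> r 2 6" "r 2 1 \<or> r 2 4 \<or> r 2 5" "r 2 1 \<or> r 2 4 \<or> r 2 6" "r 2 1 \<or> r 2 5 \<or> r 2 6" "r 2 4 \<or> r 2 5 \<or> r 2 6"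
    by ((rule red3; simp add: g_core del: One_nat_def)+)
  have v3: "r 3 0 \<or> r 3 1 \<or> r 3 4" "r 3 0 \<or> r 3 1 \<or> r 3 5" "r 3 0 \<or> r 3 1 \<or> r 3 6" "r 3 0 \<or> r 3 4 \<or> r 3 5" "r 3 0 \<or> r 3 4 \<or> r 3 6" "r 3 0 \<or> r 3 5 \<or> r 3 6" "r 3 1 \<or> r 3 4 \<or> r 3 5" "r 3 1 \<or> r 3 4 \<or> r 3 6" "r 3 1 \<or> r 3 5 \<or> r 3 6" "r 3 4 \<or> r 3 5 \<or> r 3 6"
    by ((rule red3; simp add: g_core del: One_nat_def)+)
  show False using t v2 v3 by argo
qed

text \<open>Suppose \<open>y p\<close> is red. For each of the three vertices of \<open>Q\<close>, its edge to
  \<open>p\<close> or to \<open>y\<close> is blue; as \<open>p p'\<close> is blue, \<open>p\<close> can cover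
  only one of them, so \<open>y\<close> covers the other two and has no further blue edge. Then
  \<open>y p'\<close> is red, too, and \<open>p'\<close> covers the same vertex of \<open>Q\<close> as
  \<open>p\<close>. The edge of this vertex to \<open>7\<close> or \<open>8\<close> is then red and lies in a red
  triangle with \<open>y\<close>.\<close>

lemma y_p_blue:
  fixes p p' :: nat
  assumes p: "p = 2 \<and> p' = 3 \<or> p = 3 \<and> p' = 2"
  shows "\<not> r 1 p"
proof
  assume a: "r 1 p"
  have pp: "\<not> r p p'" "\<not> r p' p" using p_p'_blue p r_sym by blast+
  have gs: "g p p'" "g p' p" "g p 4" "g p 5" "g p 6" "g p' 4" "g p' 5" "g p' 6" "g p' 1" "g p 0" "g p' 0"
    using p g_core by auto
  have ne: "p' \<noteq> 4" "p' \<noteq> 5" "p' \<noteq> 6" "p' \<noteq> 0" "p \<noteq> 4" "p \<noteq> 5" "p \<noteq> 6" "p \<noteq> 0" "p' \<noteq> 1" "p \<noteq> 1" "p \<noteq> p'"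
    using p by auto
  have t1: "\<not> r 1 w \<or> \<not> r p w" for w using a no_tri[of 1 p w] by blast
  have p_q: "r p a \<or> r p b" if "a \<in> {0, 4, 5, 6}" "b \<in> {0, 4, 5, 6}" "a \<noteq> b" for a b
    using red3[OF gs(1), of a b] that gs ne pp by blast
  have p'_q: "r p' a \<or> r p' b" if "a \<in> {0, 1, 4, 5, 6}" "b \<in> {0, 1, 4, 5, 6}" "a \<noteq> b" for a b
    using red3[OF gs(2), of a b] that gs ne pp by blast
  have g1p: "g 1 p'" using p g_core by auto
  have ne': "4 \<noteq> p'" "5 \<noteq> p'" "6 \<noteq> p'" using p by auto
  have y': "r 1 p' \<longrightarrow> \<not> r 1 w \<or> \<not> r p' w" for w using no_tri[of 1 p' w] by blast
  have q4: "r 4 7 \<or> r 4 p \<or> r 4 p'" "r 5 7 \<or> r 5 p \<or> r 5 p'" "r 6 8 \<or> r 6 p \<or> r 6 p'"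
    by ((rule red3; use p g_core in auto)+)
  note q4' = q4[unfolded r_sym[of 4 p] r_sym[of 4 p'] r_sym[of 5 p] r_sym[of 5 p'] r_sym[of 6 p] r_sym[of 6 p']]
  have t: "\<not> r 1 4 \<or> \<not> r 4 7 \<or> \<not> r 1 7" "\<not> r 1 5 \<or> \<not> r 5 7 \<or> \<not> r 1 7" "\<not> r 1 6 \<or> \<not> r 6 8 \<or> \<not> r 1 8"
    using no_tri by blast+
  have p_qs: "r p 4 \<or> r p 5" "r p 4 \<or> r p 6" "r p 5 \<or> r p 6" by ((rule p_q; simp)+)
  have p'_qs: "r p' 4 \<or> r p' 5" "r p' 4 \<or> r p' 6" "r p' 5 \<or> r p' 6" "r p' 1 \<or> r p' 4" "r p' 1 \<or> r p' 5" "r p' 1 \<or> r p' 6"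
    by ((rule p'_q; simp)+)
  have ys: "r 1 4 \<or> r 1 5 \<or> r 1 6" "r 1 4 \<or> r 1 5 \<or> r 1 7" "r 1 4 \<or> r 1 6 \<or> r 1 7" "r 1 5 \<or> r 1 6 \<or> r 1 7"
    "r 1 4 \<or> r 1 5 \<or> r 1 8" "r 1 4 \<or> r 1 6 \<or> r 1 8" "r 1 5 \<or> r 1 6 \<or> r 1 8"
    "r 1 4 \<or> r 1 5 \<or> r 1 p'" "r 1 4 \<or> r 1 6 \<or> r 1 p'" "r 1 5 \<or> r 1 6 \<or> r 1 p'"
    by ((rule red3; (rule g_core g1p ne' | simp))+)
  show False
    using t1[of 4] t1[of 5] t1[of 6] p_qs p'_qs ys y'[of 4] y'[of 5] y'[of 6] q4' t r_sym[of p' 1] by argo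
qed

text \<open>Now \<open>y, 2, 3\<close> is a blue triangle, so all other edges at these vertices are red. Red triangles
  with \<open>2\<close> force blue edges from \<open>x\<close> to \<open>4\<close> and \<open>5\<close>, which
  makes all other edges at \<open>x\<close> red.\<close>

lemma forced_colours:
  "\<not> r 2 3" "\<not> r 1 2" "\<not> r 1 3" "\<not> r 0 4" "\<not> r 0 5"
  "g 1 w \<Longrightarrow> w \<noteq> 2 \<Longrightarrow> w \<noteq> 3 \<Longrightarrow> r 1 w" "g 2 w \<Longrightarrow> w \<noteq> 1 \<Longrightarrow> w \<noteq> 3 \<Longrightarrow> r 2 w"
  "g 3 w \<Longrightarrow> w \<noteq> 1 \<Longrightarrow> w \<noteq> 2 \<Longrightarrow> r 3 w" "g 0 w \<Longrightarrow> w \<noteq> 4 \<Longrightarrow> w \<noteq> 5 \<Longrightarrow> r 0 w"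
proof -
  show b: "\<not> r 2 3" "\<not> r 1 2" "\<not> r 1 3" using p_p'_blue y_p_blue[of 2 3] y_p_blue[of 3 2] by simp_all
  show "r 1 w" if "g 1 w" "w \<noteq> 2" "w \<noteq> 3" for w
    using red3[of 1 2 3 w] g_core b that by auto
  show p2: "r 2 w" if "g 2 w" "w \<noteq> 1" "w \<noteq> 3" for w
    using red3[of 2 1 3 w] g_core b that r_sym[of 2 1] by auto
  show "r 3 w" if "g 3 w" "w \<noteq> 1" "w \<noteq> 2" for w
    using red3[of 3 1 2 w] g_core b that r_sym[of 3 1] r_sym[of 3 2] by auto
  show x4: "\<not> r 0 4" "\<not> r 0 5"
    using p2[of 0] p2[of 4] p2[of 5] g_core no_tri[of 2 0 4] no_tri[of 2 0 5] by simp_all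
  show "r 0 w" if "g 0 w" "w \<noteq> 4" "w \<noteq> 5" for w
    using red3[of 0 4 5 w] g_core x4 that by auto
qed

lemma x_y_red_to_cycle:
  assumes i: "9 \<le> i" "i < n"
  shows "r 0 i" "r 1 i"
proof -
  have gi: "g 0 i" "g 1 i" using i by (auto intro!: arc_adj(1) simp: arcs_def red_arcs_def)
  show "r 1 i" using forced_colours(6)[OF gi(2)] i by simp
  show "r 0 i" using forced_colours(9)[OF gi(1)] i by simp
qed

text \<open>The vertices of \<open>Q\<close> and \<open>M\<close> are all joined to \<open>y\<close> in red, hence
  no edge among them is red.\<close>

lemma unique_colouring: "r u v \<longleftrightarrow> std_red u v"
proof -
  note b = forced_colours(1-3) and x4 = forced_colours(4,5)
    and y = forced_colours(6) and p2 = forced_colours(7) and p3 = forced_colours(8) and x = forced_colours(9)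
  have m: "\<not> r 4 7" "\<not> r 5 7" "\<not> r 6 8"
    using y[of 4] y[of 5] y[of 6] y[of 7] y[of 8] g_core no_tri[of 1 4 7] no_tri[of 1 5 7] no_tri[of 1 6 8] by simp_all
  have blue: "\<not> r u v" if "(u, v) \<in> blue_arcs n" for u v
  proof -
    have cycle: "\<not> r i j" if "9 \<le> i" "i < n" "9 \<le> j" "j < n" for i j
      using x_y_red_to_cycle(1)[of i] x_y_red_to_cycle(1)[of j] no_tri[of 0 i j] that by blast
    show ?thesis using that n b x4 m cycle unfolding blue_arcs_def by auto
  qed
  have red: "r u v" if "(u, v) \<in> red_arcs n" for u v
    using that x[of 2] x[of 3] x[of 7] x[of 8] y[of 4] y[of 5] y[of 6] y[of 7] y[of 8] p2[of 4] p2[of 5] p2[of 6]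
      p3[of 4] p3[of 5] p3[of 6] g_core x_y_red_to_cycle unfolding red_arcs_def by auto
  have "r u v \<Longrightarrow> (u, v) \<in> red_arcs n \<or> (v, u) \<in> red_arcs n"
    using criticalD(2)[OF r, of u v] blue[of u v] blue[of v u] r_sym[of u v] unfolding g_iff arcs_def by blast
  moreover have "std_red u v \<Longrightarrow> (u, v) \<in> red_arcs n \<or> (v, u) \<in> red_arcs n"
    using std_red_adj[of u v] blue_arcs_std_red[of u v] blue_arcs_std_red[of v u] criticalD(1)[OF std_red_critical, of u v]
    unfolding g_iff arcs_def by blast
  ultimately show ?thesis
    using red[of u v] red[of v u] r_sym[of u v] red_arcs_std_red[of u v] red_arcs_std_red[of v u]
      criticalD(1)[OF std_red_critical, of v u] by blast
qed

end

theorem sharp_co_critical: "co_critical (sharp_graph n) (complete_graph 3) (star 3)"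
  unfolding co_critical_iff[OF sharp_simple]
proof (intro conjI allI impI)
  show "\<not> is_complete (sharp_graph n)"
  proof
    assume c: "is_complete (sharp_graph n)"
    have "{0, 1} \<in> nsets {..<n} 2" using n unfolding nsets_def by auto
    then have "g 0 1" using c unfolding is_complete_def adj_def by (simp add: sharp_graph_def)
    then show False unfolding g_iff arcs_def red_arcs_def blue_arcs_def by auto
  qed
  show "\<exists>r. critical g r" using std_red_critical by blast
  fix r u v
  assume r: "critical g r" and "u \<in> verts (sharp_graph n)" "v \<in> verts (sharp_graph n)" and uv: "u \<noteq> v" "\<not> g u v"
  then have lt: "u < n" "v < n" unfolding sharp_graph_def by simp_all
  have eq: "r = std_red" using unique_colouring[OF r] by blast
  show "\<exists>w. r u w \<and> r v w" unfolding eq using std_red_common[OF lt] std_red_adj uv(2) by blast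
  show "\<not> blue_le_1 g r u \<or> \<not> blue_le_1 g r v"
  proof (rule ccontr)
    assume "\<not> (\<not> blue_le_1 g r u \<or> \<not> blue_le_1 g r v)"
    then have "(u = 6 \<or> u = 8) \<and> (v = 6 \<or> v = 8)" using std_red_low lt unfolding eq by blast
    moreover have "g 6 8" "g 8 6" unfolding g_iff arcs_def red_arcs_def blue_arcs_def by simp_all
    ultimately show False using uv by blast
  qed
qed

end

theorem theorem1p8:
  shows "\<forall>n::nat. 13 \<le> n \<longrightarrow>
    (\<forall>G :: 'a graph. simple_graph G \<and> card (verts G) = n \<and>
        co_critical G (complete_graph 3) (star 3) \<longrightarrow> 3 * n - 4 \<le> card (edges G)) \<and>
    (\<exists>G :: nat graph. simple_graph G \<and> card (verts G) = n \<and>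
        co_critical G (complete_graph 3) (star 3) \<and> card (edges G) = 3 * n - 4)"
  using edges_ge sharp_simple sharp_card sharp_co_critical by blast

end
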